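(* Let $G=AB$ be a finite group which is a weak normal product of supersoluble subgroups $A$ and $B$, with $A$ normal in $G$. Then $$G^{\mathfrak{U}}=(G')^{\mathfrak{N}}=[A,B]^{\mathfrak{N}}.$$
   Context: All groups are finite. Two subgroups $X,Y$ of a group permute if $XY=YX$. Let $G=AB$ be a product of subgroups $A$ and $B$. $G$ is a weak normal product of $A$ and $B$ if (a) $A$ is normal in $G$, and (b) $B$ permutes with every maximal subgroup of every Sylow subgroup of $A$ (for all primes). $\mathfrak{U}$ and $\mathfrak{N}$ denote the classes of all finite supersoluble groups and all finite nilpotent groups, respectively. For $\mathfrak{F}\in\{\mathfrak{U},\mathfrak{N}\}$ and a finite group $X$, the $\mathfrak{F}$-residual $X^{\mathfrak{F}}$ is the smallest normal subgroup $N$ of $X$ such that $X/N\in\mathfrak{F}$. $G'$ is the derived subgroup of $G$ and $[A,B]$ is the subgroup generated by all commutators $[a,b]$ with $a\in A$, $b\in B$. *)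

theory Defs
  imports "HOL-Algebra.Elementary_Groups" "HOL-Algebra.Sylow"
begin

definition permuting :: "('a, 'b) monoid_scheme \<Rightarrow> 'a set \<Rightarrow> 'a set \<Rightarrow> bool" where
  "permuting G H K \<longleftrightarrow> H <#>\<^bsub>G\<^esub> K = K <#>\<^bsub>G\<^esub> H"

text \<open>The commutator convention is that of \<^const>\<open>derived\<close>. For subgroups \<open>H\<close> and \<open>K\<close> the
  convention is immaterial, since both are closed under inverses.\<close>

definition commutator_subgroup :: "('a, 'b) monoid_scheme \<Rightarrow> 'a set \<Rightarrow> 'a set \<Rightarrow> 'a set" where
  "commutator_subgroup G H K =
     generate G (\<Union>x \<in> H. \<Union>y \<in> K. {x \<otimes>\<^bsub>G\<^esub> y \<otimes>\<^bsub>G\<^esub> inv\<^bsub>G\<^esub> x \<otimes>\<^bsub>G\<^esub> inv\<^bsub>G\<^esub> y})"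

text \<open>The iterates below are the terms of the lower central series.\<close>

definition nilpotent :: "('a, 'b) monoid_scheme \<Rightarrow> bool" where
  "nilpotent G \<longleftrightarrow> group G \<and>
     (\<exists>n. ((\<lambda>K. commutator_subgroup G K (carrier G)) ^^ n) (carrier G) = {\<one>\<^bsub>G\<^esub>})"

text \<open>All terms of the series are normal in the whole group, not just in the next term;
  the latter would define polycyclic groups.\<close>

definition supersoluble :: "('a, 'b) monoid_scheme \<Rightarrow> bool" where
  "supersoluble G \<longleftrightarrow> group G \<and>
     (\<exists>n H. H 0 = {\<one>\<^bsub>G\<^esub>} \<and> H n = carrier G \<and>
        (\<forall>i\<le>n. H i \<lhd> G) \<and>
        (\<forall>i<n. H i \<subseteq> H (Suc i) \<and>
               cyclic_group ((G\<lparr>carrier := H (Suc i)\<rparr>) Mod H i)))"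

text \<open>The order on sets is inclusion. For finite \<open>G\<close> the least element exists if the class \<open>F\<close>
  is closed under isomorphisms, quotients and subdirect products of two groups, as are the
  supersoluble and the nilpotent groups.\<close>

definition residual :: "('a set monoid \<Rightarrow> bool) \<Rightarrow> ('a, 'b) monoid_scheme \<Rightarrow> 'a set" where
  "residual F G = (LEAST N. N \<lhd> G \<and> F (G Mod N))"

definition sylow_subgroup :: "nat \<Rightarrow> ('a, 'b) monoid_scheme \<Rightarrow> 'a set \<Rightarrow> bool" where
  "sylow_subgroup p G P \<longleftrightarrow> prime p \<and> subgroup P G \<and> card P = p ^ multiplicity p (order G)"

definition maximal_subgroup :: "('a, 'b) monoid_scheme \<Rightarrow> 'a set \<Rightarrow> bool" where
  "maximal_subgroup G M \<longleftrightarrow> subgroup M G \<and> M \<noteq> carrier G \<and>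
     (\<forall>K. subgroup K G \<longrightarrow> M \<subseteq> K \<longrightarrow> K = M \<or> K = carrier G)"

definition weak_normal_product :: "('a, 'b) monoid_scheme \<Rightarrow> 'a set \<Rightarrow> 'a set \<Rightarrow> bool" where
  "weak_normal_product G A B \<longleftrightarrow>
     subgroup A G \<and> subgroup B G \<and> carrier G = A <#>\<^bsub>G\<^esub> B \<and> A \<lhd> G \<and>
     (\<forall>p P M. sylow_subgroup p (G\<lparr>carrier := A\<rparr>) P \<longrightarrow>
        maximal_subgroup (G\<lparr>carrier := P\<rparr>) M \<longrightarrow> permuting G B M)"

end

theory Submission
  imports Defs "HOL-Algebra.Multiplicative_Group" "HOL-Algebra.Group_Action"
    "HOL-Number_Theory.Pocklington"
begin

text \<open>The core of the proof is a criterion: a weak normal product \<open>G = AB\<close> of supersoluble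
  subgroups is supersoluble if \<open>[A, B]\<close> is nilpotent
  (\<open>supersoluble_weak_normal_product\<close>). The nilpotent residual of a finite group is the last term
  of its lower central series (\<open>nilpotent_residual\<close>), hence monotone in the group, so that
  the residual \<open>R\<close> of \<open>[A, B]\<close> is contained in that of \<open>G'\<close>. The criterion applies to
  \<open>G / R\<close>, so \<open>G / R\<close> is supersoluble. On the other hand, the derived subgroup of a
  supersoluble group is nilpotent (\<open>derived_supersoluble_nilpotent\<close>), so the residual of
  \<open>G'\<close> is contained in each normal subgroup \<open>N\<close> with \<open>G / N\<close> supersoluble, in
  particular in \<open>R\<close>. Therefore \<open>R\<close> is equal to the residual of \<open>G'\<close>, and it is the least
  such \<open>N\<close>.

  The hypotheses of the criterion pass to quotients (\<open>weak_normal_product_image\<close>), so that it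
  suffices to find a normal subgroup of prime order (\<open>supersolubleI\<close> and
  \<open>normal_prime_of_product\<close>). If \<open>A\<close> is trivial, then \<open>G = B\<close>. Otherwise let \<open>p\<close> be the largest prime divisor of the order of \<open>A\<close>. The
  Sylow \<open>p\<close>-subgroup \<open>P\<close> of the supersoluble group \<open>A\<close> is normal in \<open>G\<close>
  (\<open>largest_prime_Sylow_normal\<close>); let \<open>X\<close> be a minimal normal subgroup of \<open>G\<close> inside
  \<open>P\<close>. A nilpotent normal subgroup of \<open>G\<close> centralizes \<open>X\<close>, for instance \<open>A'\<close> or
  \<open>[A, B]\<close>. Consequently an eigenspace of an element of \<open>A\<close> on \<open>X\<close> is normal in \<open>G\<close>, hence
  equal to \<open>X\<close>; and there are eigenvectors, because \<open>A\<close> has a normal subgroup of prime order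
  inside \<open>X\<close>. So \<open>A\<close> acts on \<open>X\<close> by power maps (\<open>power_map_on_minimal_normal\<close>).

  For \<open>B\<close> the permutability is needed: it says that \<open>B\<close> normalizes those maximal subgroups of
  \<open>P\<close> that contain \<open>B \<inter> P\<close> (\<open>permuting_imp_normalizes\<close>). Let \<open>K\<close> be the subgroup of
  \<open>B\<close> that acts trivially on all sections of order \<open>p\<close> normalized by \<open>B\<close>; then \<open>B / K\<close> is
  abelian of exponent dividing \<open>p - 1\<close>. By coprime action, the elements of \<open>K\<close> whose order is a
  power of another prime centralize \<open>B \<inter> P\<close> and then \<open>P\<close>
  (\<open>section_kernel_centralizes\<close>). So \<open>K\<close> acts on \<open>X\<close> as a \<open>p\<close>-group and has nontrivial fixed
  points, and by the minimality of \<open>X\<close> it acts trivially. Hence \<open>B\<close> acts on \<open>X\<close> as an abelian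
  group of exponent dividing \<open>p - 1\<close>, its elements have eigenvectors in \<open>X\<close>
  (\<open>endomorphism_eigenvector\<close>), and they act by power maps as well. Now all subgroups of \<open>X\<close>
  are normal in \<open>G\<close>, so \<open>X\<close> has order \<open>p\<close>.\<close>

section \<open>Conjugation, powers and supersoluble series\<close>

lemma (in group) inv_cancel:
  assumes "x \<in> carrier G" "y \<in> carrier G"
  shows "x \<otimes> (inv x \<otimes> y) = y" "inv x \<otimes> (x \<otimes> y) = y"
  using assms by (simp_all flip: m_assoc)

text \<open>A rewriting system for words in group elements: products are bracketed to the right
  and adjacent inverse pairs cancel.\<close>

lemmas (in group) word_simps = m_assoc inv_mult_group inv_cancel

lemma (in group) normal_conj:
  "N \<lhd> G \<Longrightarrow> g \<in> carrier G \<Longrightarrow> h \<in> N \<Longrightarrow> g \<otimes> h \<otimes> inv g \<in> N"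
  by (simp add: normal_inv_iff)

lemma (in group) normal_in_carrier: "N \<lhd> G \<Longrightarrow> h \<in> N \<Longrightarrow> h \<in> carrier G"
  using normal_imp_subgroup subgroup.subset by blast

lemma (in group) conj_int_pow:
  assumes "g \<in> carrier G" "x \<in> carrier G"
  shows "(g \<otimes> x \<otimes> inv g) [^] (k::int) = g \<otimes> x [^] k \<otimes> inv g"
proof -
  have "(\<lambda>x. g \<otimes> x \<otimes> inv g) \<in> hom G G"
    using assms(1) by (auto intro!: homI simp: word_simps)
  from hom_int_pow[OF this assms(2)] show ?thesis
    by (simp add: is_group)
qed

lemma (in group) conj_nat_pow:
  assumes "g \<in> carrier G" "x \<in> carrier G"
  shows "(g \<otimes> x \<otimes> inv g) [^] (k::nat) = g \<otimes> x [^] k \<otimes> inv g"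
  using conj_int_pow[OF assms, of "int k"] by (simp add: int_pow_int)

lemma (in group) cyclic_FactGroup_iff:
  assumes "N \<lhd> G"
  shows "cyclic_group (G Mod N) \<longleftrightarrow>
    (\<exists>x\<in>carrier G. \<forall>y\<in>carrier G. \<exists>k::int. \<exists>h\<in>N. y = h \<otimes> x [^] k)"
proof -
  interpret N: normal N G by fact
  interpret Q: group "G Mod N" by (rule N.factorgroup_is_group)
  have "cyclic_group (G Mod N) \<longleftrightarrow>
      (\<exists>x\<in>carrier G. carrier (G Mod N) = range (\<lambda>k::int. N #> x [^] k))"
    unfolding Q.cyclic_group by (auto simp: carrier_FactGroup N.FactGroup_int_pow)
  also have "\<dots> \<longleftrightarrow> (\<exists>x\<in>carrier G. \<forall>y\<in>carrier G. \<exists>k::int. y \<in> N #> x [^] k)"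
  proof (rule bex_cong[OF refl])
    fix x assume x: "x \<in> carrier G"
    have eq: "N #> y = N #> x [^] k \<longleftrightarrow> y \<in> N #> x [^] k" if "y \<in> carrier G" for y and k :: int
      using that x rcos_self[OF _ N.subgroup_axioms, of y]
        repr_independence[OF _ _ N.subgroup_axioms, of y "x [^] k"] by auto
    have sub: "range (\<lambda>k::int. N #> x [^] k) \<subseteq> carrier (G Mod N)"
      using x by (auto simp: carrier_FactGroup)
    show "carrier (G Mod N) = range (\<lambda>k::int. N #> x [^] k) \<longleftrightarrow>
        (\<forall>y\<in>carrier G. \<exists>k::int. y \<in> N #> x [^] k)" (is "?l \<longleftrightarrow> ?r")
    proof
      assume ?l
      show ?r
      proof
        fix y assume y: "y \<in> carrier G"
        then have "N #> y \<in> carrier (G Mod N)" by (simp add: carrier_FactGroup)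
        then obtain k :: int where "N #> y = N #> x [^] k" using \<open>?l\<close> by blast
        then show "\<exists>k::int. y \<in> N #> x [^] k" using eq[OF y] by blast
      qed
    next
      assume ?r
      then have "carrier (G Mod N) \<subseteq> range (\<lambda>k::int. N #> x [^] k)"
        unfolding carrier_FactGroup using eq by blast
      with sub show ?l by blast
    qed
  qed
  finally show ?thesis
    by (auto simp: r_coset_def)
qed

lemma (in group) normal_in_subgroup:
  assumes "N \<lhd> G" "subgroup K G" "N \<subseteq> K"
  shows "N \<lhd> G\<lparr>carrier := K\<rparr>"
  using assms normal_restrict_supergroup by blast

lemma (in group) cyclic_section_iff:
  assumes "N \<lhd> G" "subgroup K G" "N \<subseteq> K"
  shows "cyclic_group (G\<lparr>carrier := K\<rparr> Mod N) \<longleftrightarrow>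
    (\<exists>x\<in>K. \<forall>y\<in>K. \<exists>k::int. \<exists>h\<in>N. y = h \<otimes> x [^] k)"
proof -
  interpret K: group "G\<lparr>carrier := K\<rparr>" using assms(2) by (rule subgroup_imp_group)
  show ?thesis
    using K.cyclic_FactGroup_iff[OF normal_in_subgroup[OF assms]] int_pow_consistent[OF assms(2)]
    by simp
qed

text \<open>The series of a supersoluble group in terms of elements. Its bottom term \<open>H
  0\<close> is left free, so that a series above a normal subgroup can be prolonged
  downwards.\<close>

definition cyclic_series :: "('a, 'b) monoid_scheme \<Rightarrow> nat \<Rightarrow> (nat \<Rightarrow> 'a set) \<Rightarrow> bool" where
  "cyclic_series G n H \<longleftrightarrow> H n = carrier G \<and> (\<forall>i\<le>n. H i \<lhd> G) \<and>
     (\<forall>i<n. H i \<subseteq> H (Suc i) \<and>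
       (\<exists>x\<in>H (Suc i). \<forall>y\<in>H (Suc i). \<exists>k::int. \<exists>h\<in>H i. y = h \<otimes>\<^bsub>G\<^esub> x [^]\<^bsub>G\<^esub> k))"

lemma (in group) supersoluble_iff:
  "supersoluble G \<longleftrightarrow> (\<exists>n H. H 0 = {\<one>} \<and> cyclic_series G n H)"
proof -
  have eq: "(\<forall>i<n. H i \<subseteq> H (Suc i) \<and> cyclic_group ((G\<lparr>carrier := H (Suc i)\<rparr>) Mod H i)) \<longleftrightarrow>
     (\<forall>i<n. H i \<subseteq> H (Suc i) \<and>
       (\<exists>x\<in>H (Suc i). \<forall>y\<in>H (Suc i). \<exists>k::int. \<exists>h\<in>H i. y = h \<otimes> x [^] k))"
    if "\<forall>i\<le>n. H i \<lhd> G" for n and H :: "nat \<Rightarrow> 'a set"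
    using that by (auto simp: cyclic_section_iff normal_imp_subgroup Suc_leI)
  have "H 0 = {\<one>} \<and> H n = carrier G \<and> (\<forall>i\<le>n. H i \<lhd> G) \<and>
      (\<forall>i<n. H i \<subseteq> H (Suc i) \<and> cyclic_group ((G\<lparr>carrier := H (Suc i)\<rparr>) Mod H i)) \<longleftrightarrow>
      H 0 = {\<one>} \<and> cyclic_series G n H" for n H
    unfolding cyclic_series_def by (cases "\<forall>i\<le>n. H i \<lhd> G") (simp_all only: eq simp_thms)
  then show ?thesis
    by (simp only: supersoluble_def is_group simp_thms)
qed

lemma (in group_hom) supersoluble_image:
  assumes "supersoluble G" "h ` carrier G = carrier H"
  shows "supersoluble H"
proof -
  obtain n S where S: "S 0 = {\<one>}" "cyclic_series G n S"
    using assms(1) G.supersoluble_iff by blast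
  have car: "S i \<subseteq> carrier G" if "i \<le> n" for i
    using S(2) that G.normal_in_carrier unfolding cyclic_series_def by blast
  have "h ` S i \<lhd> H" if "i \<le> n" for i
    using S(2) that normal.surj_hom_normal_subgroup[OF _ group_hom_axioms assms(2)]
    unfolding cyclic_series_def by blast
  moreover have "\<exists>x\<in>h ` S (Suc i). \<forall>y\<in>h ` S (Suc i). \<exists>k::int. \<exists>u\<in>h ` S i.
      y = u \<otimes>\<^bsub>H\<^esub> x [^]\<^bsub>H\<^esub> k" if i: "i < n" for i
  proof -
    obtain x where x: "x \<in> S (Suc i)"
      and gen: "\<forall>y\<in>S (Suc i). \<exists>k::int. \<exists>u\<in>S i. y = u \<otimes> x [^] k"
      using S(2) i unfolding cyclic_series_def by blast
    have xc: "x \<in> carrier G" using x car i by (meson Suc_leI subsetD)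
    have "\<exists>k::int. \<exists>u\<in>h ` S i. h y = u \<otimes>\<^bsub>H\<^esub> h x [^]\<^bsub>H\<^esub> k" if y: "y \<in> S (Suc i)" for y
    proof -
      obtain k :: int and u where u: "u \<in> S i" "y = u \<otimes> x [^] k" using gen y by blast
      then have "h y = h u \<otimes>\<^bsub>H\<^esub> h x [^]\<^bsub>H\<^esub> k"
        using xc car[of i] i by (simp add: subset_iff hom_int_pow)
      with u(1) show ?thesis by blast
    qed
    with x show ?thesis by blast
  qed
  moreover have "h ` S i \<subseteq> h ` S (Suc i)" if "i < n" for i
    using S(2) that unfolding cyclic_series_def by (intro image_mono) blast
  moreover have "h ` S n = carrier H"
    using S(2) assms(2) unfolding cyclic_series_def by simp
  ultimately have "cyclic_series H n (\<lambda>i. h ` S i)"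
    unfolding cyclic_series_def by blast
  moreover have "h ` S 0 = {\<one>\<^bsub>H\<^esub>}" using S(1) by simp
  ultimately show ?thesis
    using H.supersoluble_iff by (intro iffD2[OF H.supersoluble_iff] exI[of _ n] exI[of _ "\<lambda>i. h ` S i"] conjI)
qed

lemma (in normal) quotient_hom: "group_hom G (G Mod H) (\<lambda>x. H #> x)"
  by (simp add: group_hom_def group_hom_axioms_def factorgroup_is_group r_coset_hom_Mod is_group)

lemma (in group) subgroup_pow_card:
  assumes "subgroup H G" "x \<in> H" shows "x [^] card H = \<one>"
  using group.pow_order_eq_1[OF subgroup_imp_group[OF assms(1)], of x] assms(2)
  by (simp add: order_def flip: nat_pow_consistent)

lemma (in group) Cauchy:
  assumes "finite (carrier G)" "prime p" "p dvd order G"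
  obtains x where "x \<in> carrier G" "x \<noteq> \<one>" "x [^] p = \<one>"
proof -
  obtain m where "order G = p ^ 1 * m" using assms(3) by auto
  then obtain H where H: "subgroup H G" "card H = p"
    using sylow_thm[OF assms(2) is_group _ assms(1)] by fastforce
  have "H \<noteq> {\<one>}" using H(2) assms(2) by auto
  then obtain x where x: "x \<in> H" "x \<noteq> \<one>" using subgroup.one_closed[OF H(1)] by blast
  have "x [^] p = \<one>" using subgroup_pow_card[OF H(1) x(1)] H(2) by simp
  then show thesis using that x subgroup.mem_carrier[OF H(1)] by blast
qed

lemma (in group) card_generate_prime:
  assumes "x \<in> carrier G" "x \<noteq> \<one>" "prime p" "x [^] (p::nat) = \<one>"
  shows "card (generate G {x}) = p"
proof -
  have "ord x dvd p" using assms pow_eq_id by simp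
  then have "ord x = p" using assms ord_eq_1 prime_nat_iff by metis
  then show ?thesis using generate_pow_card assms by simp
qed

lemma (in group) normal_Int:
  assumes "N \<lhd> G" "M \<lhd> G" shows "N \<inter> M \<lhd> G"
  using assms by (simp add: normal_inv_iff subgroups_Inter_pair)

lemma (in group) generate_singleton_normal:
  assumes "x \<in> carrier G" "\<And>g. g \<in> carrier G \<Longrightarrow> \<exists>m::int. g \<otimes> x \<otimes> inv g = x [^] m"
  shows "generate G {x} \<lhd> G"
proof (rule normal_invI)
  show "subgroup (generate G {x}) G" using assms(1) generate_is_subgroup by simp
  fix g w assume g: "g \<in> carrier G" and "w \<in> generate G {x}"
  then obtain a :: int where a: "w = x [^] a" using generate_pow[OF assms(1)] by blast
  obtain m :: int where m: "g \<otimes> x \<otimes> inv g = x [^] m" using assms(2)[OF g] by blast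
  have "g \<otimes> w \<otimes> inv g = x [^] (m * a)"
    unfolding a using conj_int_pow[OF g assms(1), of a] m assms(1) by (simp add: int_pow_pow)
  then show "g \<otimes> w \<otimes> inv g \<in> generate G {x}" using generate_pow[OF assms(1)] by blast
qed

text \<open>For the projection \<open>h\<close> modulo a normal subgroup: if conjugation by
  \<open>g\<close> is the \<open>m\<close>-th power map on the coset of \<open>x\<close>, then
  it is the \<open>m\<close>-th power map on all powers of this coset.\<close>

lemma (in group_hom) conj_eq_power:
  assumes "g \<in> carrier G" "x \<in> carrier G" "u \<in> carrier G" "v \<in> carrier G"
    and "z = u \<otimes> x [^] (k::int)" "g \<otimes> x \<otimes> inv g = v \<otimes> x [^] (m::int)"
    and "h u = \<one>\<^bsub>H\<^esub>" "h v = \<one>\<^bsub>H\<^esub>"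
  shows "h (g \<otimes> z \<otimes> inv g) = h (z [^] m)"
proof -
  have z: "h z = h x [^]\<^bsub>H\<^esub> k" using assms by (simp add: hom_int_pow)
  have "h g \<otimes>\<^bsub>H\<^esub> h x \<otimes>\<^bsub>H\<^esub> inv\<^bsub>H\<^esub> h g = h (g \<otimes> x \<otimes> inv g)" using assms(1,2) by simp
  also have "\<dots> = h x [^]\<^bsub>H\<^esub> m" unfolding assms(6) using assms by (simp add: hom_int_pow)
  finally have *: "h g \<otimes>\<^bsub>H\<^esub> h x \<otimes>\<^bsub>H\<^esub> inv\<^bsub>H\<^esub> h g = h x [^]\<^bsub>H\<^esub> m" .
  have zc: "z \<in> carrier G" using assms by simp
  have "h (g \<otimes> z \<otimes> inv g) = h g \<otimes>\<^bsub>H\<^esub> h x [^]\<^bsub>H\<^esub> k \<otimes>\<^bsub>H\<^esub> inv\<^bsub>H\<^esub> h g"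
    using assms(1) zc z by simp
  also have "\<dots> = (h x [^]\<^bsub>H\<^esub> m) [^]\<^bsub>H\<^esub> k"
    using H.conj_int_pow[of "h g" "h x" k] assms(1,2) * by simp
  also have "\<dots> = h (z [^] m)"
    using zc z assms(2) by (simp add: hom_int_pow H.int_pow_pow mult.commute)
  finally show ?thesis .
qed

text \<open>\<open>Z\<close> first meets the series in a subgroup that embeds into a cyclic
  section. There conjugation is a power map, so that an element of prime order in this
  intersection generates a normal subgroup.\<close>

lemma (in group) supersoluble_normal_prime:
  assumes "finite (carrier G)" "supersoluble G" "Z \<lhd> G" "Z \<noteq> {\<one>}"
  obtains X where "X \<lhd> G" "X \<subseteq> Z" "prime (card X)"
proof -
  obtain n H where H0: "H 0 = {\<one>}" and H: "cyclic_series G n H"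
    using assms(2) supersoluble_iff by blast
  have sZ: "subgroup Z G" using assms(3) normal_imp_subgroup by blast
  have "H n \<inter> Z \<noteq> {\<one>}"
    using H assms(3,4) normal_in_carrier unfolding cyclic_series_def by blast
  define j where "j = (LEAST j. H j \<inter> Z \<noteq> {\<one>})"
  have j: "H j \<inter> Z \<noteq> {\<one>}" "j \<le> n" "\<And>i. i < j \<Longrightarrow> H i \<inter> Z = {\<one>}"
    unfolding j_def using \<open>H n \<inter> Z \<noteq> {\<one>}\<close>
    by (fact LeastI, fact Least_le, use not_less_Least in blast)
  have "j \<noteq> 0" using j(1) H0 subgroup.one_closed[OF sZ] by (intro notI) auto
  then obtain i where "j = Suc i" using not0_implies_Suc by blast
  then have i: "i < n" "H i \<inter> Z = {\<one>}" "H (Suc i) \<inter> Z \<noteq> {\<one>}"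
    using j by auto
  have Hi: "H i \<lhd> G" "H (Suc i) \<lhd> G" using H i(1) unfolding cyclic_series_def by auto
  obtain x where x: "x \<in> H (Suc i)"
    and gen: "\<forall>y\<in>H (Suc i). \<exists>k::int. \<exists>u\<in>H i. y = u \<otimes> x [^] k"
    using H i(1) unfolding cyclic_series_def by blast
  define C where "C = H (Suc i) \<inter> Z"
  have C: "C \<lhd> G" unfolding C_def using Hi(2) assms(3) by (rule normal_Int)
  have sC: "subgroup C G" using C normal_imp_subgroup by blast
  have fC: "finite C" using assms(1) subgroup.subset[OF sC] finite_subset by blast
  have "card C \<noteq> 1" using i(3) subgroup.one_closed[OF sC] unfolding C_def
    by (metis card_1_singletonE singletonD)
  then obtain r where r: "prime r" "r dvd card C" using prime_factor_nat by blast
  interpret C: group "G\<lparr>carrier := C\<rparr>" using sC by (rule subgroup_imp_group)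
  obtain z where z: "z \<in> C" "z \<noteq> \<one>" "z [^] r = \<one>"
    using C.Cauchy[of r] fC r by (auto simp: order_def simp flip: nat_pow_consistent)
  have xc: "x \<in> carrier G" and zc: "z \<in> carrier G"
    using x z(1) Hi(2) C normal_in_carrier by blast+
  obtain k :: int and u where u: "u \<in> H i" "z = u \<otimes> x [^] k" using gen z(1) C_def by blast
  have uc: "u \<in> carrier G" using u Hi(1) normal_in_carrier by blast
  interpret Hi: normal "H i" G by fact
  have key: "\<exists>m::int. g \<otimes> z \<otimes> inv g = z [^] m" if g: "g \<in> carrier G" for g
  proof -
    have "g \<otimes> x \<otimes> inv g \<in> H (Suc i)" using normal_conj Hi(2) g x by blast
    then obtain m :: int and v where v: "v \<in> H i" "g \<otimes> x \<otimes> inv g = v \<otimes> x [^] m"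
      using gen by blast
    have vc: "v \<in> carrier G" using v Hi(1) normal_in_carrier by blast
    have "(\<lambda>x. H i #> x) (g \<otimes> z \<otimes> inv g) = (\<lambda>x. H i #> x) (z [^] m)"
      using Hi.rcos_const u(1) v(1)
      by (intro group_hom.conj_eq_power[OF Hi.quotient_hom _ _ _ _ u(2) v(2)])
        (simp_all add: g xc uc vc)
    then have "(g \<otimes> z \<otimes> inv g) \<otimes> inv (z [^] m) \<in> H i"
      using g zc Hi.rcos_module[OF is_group, of "z [^] m" "g \<otimes> z \<otimes> inv g"]
        rcos_self[OF _ Hi.subgroup_axioms, of "g \<otimes> z \<otimes> inv g"] by simp
    moreover have "(g \<otimes> z \<otimes> inv g) \<otimes> inv (z [^] m) \<in> Z"
    proof -
      have "z \<in> Z" using z(1) C_def by simp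
      then show ?thesis
        using normal_conj[OF assms(3) g] subgroup_int_pow_closed[OF sZ] sZ
        by (simp add: subgroup.m_closed subgroup.m_inv_closed)
    qed
    ultimately have "(g \<otimes> z \<otimes> inv g) \<otimes> inv (z [^] m) = \<one>" using i(2) by blast
    then have "g \<otimes> z \<otimes> inv g = z [^] m"
      using g zc inv_solve_right'[of \<one> "g \<otimes> z \<otimes> inv g" "z [^] m"] by simp
    then show ?thesis by blast
  qed
  have "generate G {z} \<lhd> G" using zc key by (rule generate_singleton_normal)
  moreover have "generate G {z} \<subseteq> Z"
    using z(1) sZ generate_subgroup_incl[of "{z}" Z] C_def by simp
  moreover have "card (generate G {z}) = r" using card_generate_prime zc z r(1) by blast
  ultimately show thesis using that r(1) by blast
qed

section \<open>Fixed points of group actions\<close>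

lemma (in group) action_from_fun:
  assumes "\<And>g x. g \<in> carrier G \<Longrightarrow> x \<in> S \<Longrightarrow> f g x \<in> S"
    and "\<And>x. x \<in> S \<Longrightarrow> f \<one> x = x"
    and "\<And>g h x. g \<in> carrier G \<Longrightarrow> h \<in> carrier G \<Longrightarrow> x \<in> S \<Longrightarrow> f (g \<otimes> h) x = f g (f h x)"
  shows "group_action G S (\<lambda>g. \<lambda>x\<in>S. f g x)"
proof -
  have "bij_betw (f g) S S" if "g \<in> carrier G" for g
    using that assms(1) assms(2,3)[symmetric]
    by (intro bij_betw_byWitness[of _ "f (inv g)"]) auto
  then have "(\<lambda>x\<in>S. f g x) \<in> carrier (BijGroup S)" if "g \<in> carrier G" for g
    using that by (simp add: BijGroup_def Bij_def bij_betw_restrict_eq)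
  moreover have "(\<lambda>x\<in>S. f (g \<otimes> h) x) =
      (\<lambda>x\<in>S. f g x) \<otimes>\<^bsub>BijGroup S\<^esub> (\<lambda>x\<in>S. f h x)"
    if "g \<in> carrier G" "h \<in> carrier G" for g h
    using that calculation assms(1) assms(3)
    by (auto simp: BijGroup_def compose_def fun_eq_iff)
  ultimately show ?thesis
    by (auto simp: group_action_def group_hom_def group_hom_axioms_def group_BijGroup intro!: homI)
qed

lemma (in group) orbit_stabilizer_card:
  assumes "\<And>g x. g \<in> carrier G \<Longrightarrow> x \<in> S \<Longrightarrow> f g x \<in> S"
    and "\<And>x. x \<in> S \<Longrightarrow> f \<one> x = x"
    and "\<And>g h x. g \<in> carrier G \<Longrightarrow> h \<in> carrier G \<Longrightarrow> x \<in> S \<Longrightarrow> f (g \<otimes> h) x = f g (f h x)"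
    and "x \<in> S"
  shows "card ((\<lambda>g. f g x) ` carrier G) * card {g \<in> carrier G. f g x = x} = order G"
    and "subgroup {g \<in> carrier G. f g x = x} G"
proof -
  let ?f = "\<lambda>g. \<lambda>x\<in>S. f g x"
  interpret group_action G S ?f using assms(1-3) by (rule action_from_fun)
  have o: "orbit G ?f x = (\<lambda>g. f g x) ` carrier G"
    using assms(4) by (auto simp: orbit_def)
  have s: "stabilizer G ?f x = {g \<in> carrier G. f g x = x}"
    using assms(4) by (auto simp: stabilizer_def)
  show "card ((\<lambda>g. f g x) ` carrier G) * card {g \<in> carrier G. f g x = x} = order G"
    using orbit_stabilizer_theorem[OF assms(4)] unfolding o s .
  show "subgroup {g \<in> carrier G. f g x = x} G"
    using stabilizer_subgroup[OF assms(4)] unfolding s .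
qed

text \<open>The condition on the orbits, instead of the assumption that \<open>G\<close> is a
  \<open>p\<close>-group, allows groups whose elements of order prime to \<open>p\<close> act
  trivially.\<close>

lemma (in group) card_fixed_points_cong:
  assumes "\<And>g x. g \<in> carrier G \<Longrightarrow> x \<in> S \<Longrightarrow> f g x \<in> S"
    and "\<And>x. x \<in> S \<Longrightarrow> f \<one> x = x"
    and "\<And>g h x. g \<in> carrier G \<Longrightarrow> h \<in> carrier G \<Longrightarrow> x \<in> S \<Longrightarrow> f (g \<otimes> h) x = f g (f h x)"
    and "finite S"
    and dvd: "\<And>x. x \<in> S \<Longrightarrow> \<exists>g\<in>carrier G. f g x \<noteq> x \<Longrightarrow> p dvd card ((\<lambda>g. f g x) ` carrier G)"
  shows "[card S = card {x \<in> S. \<forall>g\<in>carrier G. f g x = x}] (mod p)"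
proof -
  let ?f = "\<lambda>g. \<lambda>x\<in>S. f g x"
  interpret group_action G S ?f using assms(1-3) by (rule action_from_fun)
  let ?F = "{x \<in> S. \<forall>g\<in>carrier G. f g x = x}"
  define w where "w x = (if x \<in> ?F then 0 else 1::nat)" for x
  have "p dvd (\<Sum>x\<in>W. w x)" if W: "W \<in> orbits G S ?f" for W
  proof -
    obtain x where x: "x \<in> S" "W = orbit G ?f x" using W unfolding orbits_def by blast
    have "orbit G ?f x = (\<lambda>g. f g x) ` carrier G" using x(1) by (auto simp: orbit_def)
    then have x: "x \<in> S" "W = (\<lambda>g. f g x) ` carrier G" using x by auto
    show ?thesis
    proof (cases "x \<in> ?F")
      case True
      then have "W = {x}" using x(2) by auto
      then show ?thesis using True by (simp add: w_def)
    next
      case False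
      have "w y = 1" if y: "y \<in> W" for y
      proof -
        obtain g where g: "g \<in> carrier G" "y = f g x" using y x(2) by auto
        have "f (inv g) y = x" using g assms(2) assms(3)[of "inv g" g x] x(1) by simp
        have "y = x" if "y \<in> ?F"
          using that \<open>f (inv g) y = x\<close> inv_closed[OF g(1)] by fastforce
        then have "y \<notin> ?F" using False by blast
        then show ?thesis by (simp add: w_def)
      qed
      then have "(\<Sum>x\<in>W. w x) = card W" by simp
      then show ?thesis using False dvd[OF x(1)] x by auto
    qed
  qed
  then have "p dvd (\<Sum>W\<in>orbits G S ?f. \<Sum>x\<in>W. w x)" by (rule dvd_sum)
  also have "\<dots> = (\<Sum>x\<in>S. w x)" by (rule disjoint_sum) fact
  also have "\<dots> = card (S - ?F)"
  proof -
    have "(\<Sum>x\<in>S. w x) = (\<Sum>x\<in>S - ?F. 1)"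
      by (rule sum.mono_neutral_cong_right) (use assms(4) in \<open>auto simp: w_def\<close>)
    then show ?thesis by simp
  qed
  finally have "p dvd card (S - ?F)" .
  moreover have "card S = card ?F + card (S - ?F)"
    using assms(4) by (subst card_Un_disjoint[symmetric]) (auto intro: arg_cong[where f = card])
  ultimately show ?thesis
    by (auto simp: cong_def elim!: dvdE)
qed

lemma (in group) p_group_fixed_points_cong:
  assumes "\<And>g x. g \<in> carrier G \<Longrightarrow> x \<in> S \<Longrightarrow> f g x \<in> S"
    and "\<And>x. x \<in> S \<Longrightarrow> f \<one> x = x"
    and "\<And>g h x. g \<in> carrier G \<Longrightarrow> h \<in> carrier G \<Longrightarrow> x \<in> S \<Longrightarrow> f (g \<otimes> h) x = f g (f h x)"
    and "finite S" and p: "prime p" and "order G = p ^ k"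
  shows "[card S = card {x \<in> S. \<forall>g\<in>carrier G. f g x = x}] (mod p)"
proof (rule card_fixed_points_cong[where f = f])
  fix x assume x: "x \<in> S" "\<exists>g\<in>carrier G. f g x \<noteq> x"
  let ?O = "(\<lambda>g. f g x) ` carrier G"
  have "card ?O * card {g \<in> carrier G. f g x = x} = order G"
    using assms(1-3) x(1) by (rule orbit_stabilizer_card(1))
  then have "card ?O dvd p ^ k" unfolding assms(6)[symmetric] by (metis dvd_triv_left)
  then obtain i where i: "card ?O = p ^ i" using p by (auto simp: divides_primepow_nat)
  have "card ?O \<noteq> 1"
  proof
    assume "card ?O = 1"
    then obtain y where "?O = {y}" by (auto simp: card_1_singleton_iff)
    moreover have "f \<one> x \<in> ?O" by blast
    ultimately have "y = x" using assms(2)[OF x(1)] by simp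
    with \<open>?O = {y}\<close> x(2) show False by blast
  qed
  then show "p dvd card ?O" using i by (cases i) auto
qed (use assms in auto)

lemma (in group) card_fixed_cosets_cong:
  assumes "finite (carrier G)" "prime p" "subgroup P G" "subgroup U G" "card U = p ^ k"
  shows "[card (rcosets P) = card {C \<in> rcosets P. \<forall>u\<in>U. C #> inv u = C}] (mod p)"
proof -
  interpret U: group "G\<lparr>carrier := U\<rparr>" using assms(4) by (rule subgroup_imp_group)
  have Uc: "u \<in> carrier G" if "u \<in> U" for u using that subgroup.subset[OF assms(4)] by blast
  have Psub: "P \<subseteq> carrier G" using subgroup.subset[OF assms(3)] .
  have "[card (rcosets P) =
      card {C \<in> rcosets P. \<forall>u\<in>carrier (G\<lparr>carrier := U\<rparr>). C #> inv u = C}] (mod p)"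
  proof (rule U.p_group_fixed_points_cong)
    show "finite (rcosets P)" using assms(1) by (simp add: RCOSETS_def)
    show "order (G\<lparr>carrier := U\<rparr>) = p ^ k" using assms(5) by (simp add: order_def)
    fix g x assume gx: "g \<in> carrier (G\<lparr>carrier := U\<rparr>)" "x \<in> rcosets P"
    then obtain a where a: "a \<in> carrier G" "x = P #> a" by (auto simp: RCOSETS_def)
    then show "x #> inv g \<in> rcosets P"
      using gx Uc Psub by (auto simp: coset_mult_assoc intro!: rcosetsI)
  next
    fix x assume "x \<in> rcosets P"
    then show "x #> inv \<one>\<^bsub>G\<lparr>carrier := U\<rparr>\<^esub> = x"
      using rcosets_subset_PowG[OF assms(3)] by auto
  next
    fix g h x assume gh: "g \<in> carrier (G\<lparr>carrier := U\<rparr>)" "h \<in> carrier (G\<lparr>carrier := U\<rparr>)"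
      and x: "x \<in> rcosets P"
    have "x \<subseteq> carrier G" using x rcosets_subset_PowG[OF assms(3)] by auto
    then show "x #> inv (g \<otimes>\<^bsub>G\<lparr>carrier := U\<rparr>\<^esub> h) = x #> inv h #> inv g"
      using gh Uc by (simp add: coset_mult_assoc inv_mult_group)
  qed fact
  then show ?thesis by simp
qed

lemma (in group) conj_mem_of_fixed_coset:
  assumes "subgroup P G" "subgroup U G" "a \<in> carrier G"
    and fixed: "\<And>u. u \<in> U \<Longrightarrow> P #> a #> inv u = P #> a" and u: "u \<in> U"
  shows "a \<otimes> u \<otimes> inv a \<in> P"
proof -
  have uc: "u \<in> carrier G" using subgroup.mem_carrier[OF assms(2) u] .
  have "P #> (a \<otimes> u) = P #> a"
    using fixed[OF subgroup.m_inv_closed[OF assms(2) u]] uc assms(3) subgroup.subset[OF assms(1)]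
    by (simp add: coset_mult_assoc)
  then have "a \<otimes> u \<in> P #> a" using rcos_self[OF _ assms(1), of "a \<otimes> u"] assms(3) uc by simp
  then show ?thesis
    using assms(3) uc subgroup.rcos_module_imp[OF assms(1) is_group, of a "a \<otimes> u"] by simp
qed

text \<open>\<open>U\<close> permutes the cosets of \<open>P\<close>, whose number is prime to
  \<open>p\<close>, and therefore fixes one of them.\<close>

lemma (in group) p_subgroup_into_conjugate:
  assumes "finite (carrier G)" "prime p" "subgroup P G" "\<not> p dvd card (rcosets P)"
    and "subgroup U G" "card U = p ^ k"
  obtains g where "g \<in> carrier G" "\<And>u. u \<in> U \<Longrightarrow> g \<otimes> u \<otimes> inv g \<in> P"
proof -
  let ?F = "{C \<in> rcosets P. \<forall>u\<in>U. C #> inv u = C}"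
  have "card ?F \<noteq> 0"
    using card_fixed_cosets_cong[OF assms(1-3,5,6)] assms(4) by (metis cong_0_iff)
  then have "?F \<noteq> {}" by (metis card.empty)
  then obtain C where C: "C \<in> rcosets P" "\<And>u. u \<in> U \<Longrightarrow> C #> inv u = C" by auto
  obtain a where a: "a \<in> carrier G" "C = P #> a" using C(1) by (auto simp: RCOSETS_def)
  show thesis
    using that[OF a(1)] conj_mem_of_fixed_coset[OF assms(3,5) a(1)] C(2) unfolding a(2) by blast
qed

lemma (in group) subgroup_card_dvd:
  assumes "subgroup H G" shows "card H dvd order G"
  using lagrange[OF assms] by (metis dvd_triv_right)

lemma (in group) subgroup_card_dvd_subgroup:
  assumes "subgroup H G" "subgroup K G" "H \<subseteq> K" shows "card H dvd card K"
proof -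
  have "subgroup H (G\<lparr>carrier := K\<rparr>)" using assms subgroup_incl by blast
  then show ?thesis
    using group.subgroup_card_dvd[OF subgroup_imp_group[OF assms(2)]] by (simp add: order_def)
qed

lemma (in group) prime_order_generate:
  assumes "subgroup X G" "prime (card X)" "x \<in> X" "x \<noteq> \<one>"
  shows "X = generate G {x}"
proof -
  have xc: "x \<in> carrier G" using subgroup.mem_carrier[OF assms(1,3)] .
  have sub: "generate G {x} \<subseteq> X" using assms(1,3) by (intro generate_subgroup_incl) auto
  have "card (generate G {x}) dvd card X"
    using xc by (intro subgroup_card_dvd_subgroup[OF generate_is_subgroup assms(1) sub]) auto
  moreover have "card (generate G {x}) \<noteq> 1"
    using ord_eq_1[OF xc] assms(4) generate_pow_card[OF xc] by simp
  ultimately have "card (generate G {x}) = card X" using assms(2) by (auto simp: prime_nat_iff)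
  then show ?thesis
    using card_subset_eq[OF card_ge_0_finite sub] assms(2) prime_gt_0_nat by auto
qed

lemma (in group) p_element_subgroup_order:
  assumes "finite (carrier G)" "prime p" "x \<in> carrier G" "x [^] (p ^ k :: nat) = \<one>"
  obtains i where "card (generate G {x}) = p ^ i"
proof -
  have "ord x dvd p ^ k" using assms pow_eq_id by simp
  then show thesis using that generate_pow_card[OF assms(3)] assms(2) by (auto simp: divides_primepow_nat)
qed

text \<open>The nontrivial orbits of the \<open>p\<close>-group generated by \<open>w\<close>
  have at least \<open>p\<close> elements, more than \<open>X\<close> has.\<close>

lemma (in group) p_element_centralizes_small_prime:
  assumes "finite (carrier G)" "prime p" "w \<in> carrier G" "w [^] (p ^ k :: nat) = \<one>"
    and "X \<lhd> G" "card X < p" "x \<in> X"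
  shows "w \<otimes> x = x \<otimes> w"
proof -
  let ?W = "generate G {w}"
  have sW: "subgroup ?W G" using assms(3) generate_is_subgroup by simp
  interpret W: group "G\<lparr>carrier := ?W\<rparr>" using sW by (rule subgroup_imp_group)
  have Wc: "u \<in> carrier G" if "u \<in> ?W" for u using that subgroup.subset[OF sW] by blast
  have Xc: "u \<in> carrier G" if "u \<in> X" for u using that normal_in_carrier assms(5) by blast
  obtain i where i: "card ?W = p ^ i" using p_element_subgroup_order assms(1-4) by blast
  have fX: "finite X" using assms(1) Xc by (meson finite_subset subsetI)
  have cj: "g \<otimes> (y \<otimes> inv g) \<in> X" if "g \<in> ?W" "y \<in> X" for g y
    using normal_conj[OF assms(5), of g y] that Wc Xc by (simp add: m_assoc)
  let ?F = "{x \<in> X. \<forall>g\<in>carrier (G\<lparr>carrier := ?W\<rparr>). g \<otimes> x \<otimes> inv g = x}"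
  have "[card X = card ?F] (mod p)"
    by (rule W.p_group_fixed_points_cong[where k = i])
      (use assms i in \<open>auto simp: order_def fX Xc Wc cj word_simps\<close>)
  moreover have "card ?F \<le> card X" using fX by (intro card_mono) auto
  ultimately have "card ?F = card X" using assms(6) by (simp add: cong_def)
  then have "?F = X" using fX by (intro card_subset_eq) auto
  moreover have "w \<in> ?W" by (simp add: generate.incl)
  ultimately have "w \<otimes> x \<otimes> inv w = x" using assms(7) by auto
  then show ?thesis using assms(3,7) Xc inv_solve_right'[of x "w \<otimes> x" w] by auto
qed

section \<open>Prime sections and Sylow subgroups of supersoluble groups\<close>

lemma (in normal) quotient_surj: "(\<lambda>x. H #> x) ` carrier G = carrier (G Mod H)"
  by (simp add: carrier_FactGroup)

lemma (in normal) rcos_eq_self_iff: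
  assumes "x \<in> carrier G" shows "H #> x = H \<longleftrightarrow> x \<in> H"
  using assms by (metis coset_join2 is_group rcos_const rcos_self subgroup_axioms)

lemma (in normal) union_of_quotient_subgroup:
  assumes "finite (carrier G)" "subgroup K (G Mod H)"
  shows "H \<subseteq> \<Union>K" "card (\<Union>K) = card K * card H"
    and "\<And>x. x \<in> carrier G \<Longrightarrow> x \<in> \<Union>K \<longleftrightarrow> H #> x \<in> K"
proof -
  have s: "subgroup (\<Union>K) G" using assms(2) by (rule factgroup_subgroup_union_subgroup)
  show sub: "H \<subseteq> \<Union>K" using subgroup.one_closed[OF assms(2)] by auto
  interpret U: group "G\<lparr>carrier := \<Union>K\<rparr>" using s by (rule subgroup_imp_group)
  have "subgroup H (G\<lparr>carrier := \<Union>K\<rparr>)" using sub s subgroup_axioms subgroup_incl by blast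
  from U.lagrange[OF this] show "card (\<Union>K) = card K * card H"
    using factgroup_subgroup_union_factor[OF assms(2)] by (simp add: order_def)
  show "x \<in> \<Union>K \<longleftrightarrow> H #> x \<in> K" if "x \<in> carrier G" for x
    using factgroup_subgroup_union_char[OF assms(2)] that by blast
qed

lemma (in normal) finite_quotient: "finite (carrier G) \<Longrightarrow> finite (carrier (G Mod H))"
  by (simp add: carrier_FactGroup)

lemma (in normal) supersoluble_quotient: "supersoluble G \<Longrightarrow> supersoluble (G Mod H)"
  using group_hom.supersoluble_image[OF quotient_hom _ quotient_surj] .

lemma (in group) supersoluble_section_prime:
  assumes "finite (carrier G)" "supersoluble G" "Y \<lhd> G" "Z \<lhd> G" "Y \<subset> Z"
  obtains X where "X \<lhd> G" "Y \<subseteq> X" "X \<subseteq> Z" "prime (card X div card Y)"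
    "card X = (card X div card Y) * card Y"
proof -
  interpret Y: normal Y G by fact
  interpret Q: group "G Mod Y" by (rule Y.factorgroup_is_group)
  let ?Z = "(\<lambda>x. Y #> x) ` Z"
  have Zn: "?Z \<lhd> (G Mod Y)"
    using normal.surj_hom_normal_subgroup[OF assms(4) Y.quotient_hom Y.quotient_surj] .
  obtain z where z: "z \<in> Z" "z \<notin> Y" using assms(5) by blast
  then have "Y #> z \<noteq> Y" using Y.rcos_eq_self_iff normal_in_carrier[OF assms(4)] by simp
  then have "?Z \<noteq> {\<one>\<^bsub>G Mod Y\<^esub>}" using z by auto
  then obtain X where X: "X \<lhd> (G Mod Y)" "X \<subseteq> ?Z" "prime (card X)"
    using Q.supersoluble_normal_prime[OF Y.finite_quotient[OF assms(1)] Y.supersoluble_quotient[OF assms(2)] Zn]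
    by metis
  have "\<Union>X \<subseteq> Z"
  proof
    fix x assume "x \<in> \<Union>X"
    then obtain w where w: "w \<in> Z" "x \<in> Y #> w" using X(2) by blast
    then obtain y where "y \<in> Y" "x = y \<otimes> w" by (auto simp: r_coset_def)
    then show "x \<in> Z" using w(1) assms(5) subgroup.m_closed[OF normal_imp_subgroup[OF assms(4)]] by blast
  qed
  moreover have "card Y > 0" using Y.finite_imp_card_positive assms(1) by blast
  ultimately show thesis
    using that[of "\<Union>X"] Y.factgroup_subgroup_union_normal[OF X(1)] X(3)
      Y.union_of_quotient_subgroup[OF assms(1) normal_imp_subgroup[OF X(1)]] by simp
qed

lemma (in group) cyclic_series_Cons:
  assumes "cyclic_series G n H" "Y \<lhd> G" "Y \<subseteq> H 0"
    "\<exists>x\<in>H 0. \<forall>y\<in>H 0. \<exists>k::int. \<exists>h\<in>Y. y = h \<otimes> x [^] k"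
  shows "cyclic_series G (Suc n) (case_nat Y H)"
proof -
  have "(case_nat Y H) i \<lhd> G" if "i \<le> Suc n" for i
    using assms(1,2) that unfolding cyclic_series_def by (cases i) auto
  moreover have "case_nat Y H i \<subseteq> case_nat Y H (Suc i) \<and> (\<exists>x\<in>case_nat Y H (Suc i).
      \<forall>y\<in>case_nat Y H (Suc i). \<exists>k::int. \<exists>h\<in>case_nat Y H i. y = h \<otimes> x [^] k)" if "i < Suc n" for i
  proof (cases i)
    case 0
    show ?thesis unfolding 0 using assms(3,4) by simp
  next
    case (Suc j)
    then have "j < n" using that by simp
    then show ?thesis using assms(1) Suc unfolding cyclic_series_def by simp
  qed
  ultimately show ?thesis
    using assms(1) unfolding cyclic_series_def by simp
qed

text \<open>Induction on the order of the group would pass to quotients, whose elements are of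
  another type. Instead, each step is taken in a quotient of \<open>G\<close> and pulled back at
  once, so that the series grows inside \<open>G\<close>, from the top down to the trivial
  subgroup.\<close>

lemma (in group) supersolubleI:
  assumes "finite (carrier G)"
    and step: "\<And>Y. Y \<lhd> G \<Longrightarrow> Y \<noteq> carrier G \<Longrightarrow> \<exists>X. X \<lhd> (G Mod Y) \<and> prime (card X)"
  shows "supersoluble G"
proof -
  have "\<exists>n H. H 0 = Y \<and> cyclic_series G n H" if "Y \<lhd> G" for Y
    using that
  proof (induction "card (carrier G) - card Y" arbitrary: Y rule: less_induct)
    case less
    interpret Y: normal Y G by fact
    interpret Q: group "G Mod Y" by (rule Y.factorgroup_is_group)
    show ?case
    proof (cases "Y = carrier G")
      case True
      then have "cyclic_series G 0 (\<lambda>_. Y)" using less.prems by (simp add: cyclic_series_def)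
      then show ?thesis by (intro exI[of _ 0] exI[of _ "\<lambda>_. Y"]) simp
    next
      case False
      then obtain X where X: "X \<lhd> (G Mod Y)" "prime (card X)" using step less.prems by blast
      have sX: "subgroup X (G Mod Y)" using X(1) by (rule normal_imp_subgroup)
      have UN: "\<Union>X \<lhd> G" using X(1) by (rule Y.factgroup_subgroup_union_normal)
      note U = Y.union_of_quotient_subgroup[OF assms(1) sX]
      have fY: "card Y > 0" using Y.finite_imp_card_positive assms(1) by blast
      have "card (\<Union>X) > card Y" using U(2) fY X(2) prime_gt_1_nat by simp
      moreover have "card Y < card (carrier G)"
        using False Y.subset assms(1) by (simp add: psubset_card_mono psubsetI)
      ultimately have "card (carrier G) - card (\<Union>X) < card (carrier G) - card Y" by linarith
      then obtain n H where H: "H 0 = \<Union>X" "cyclic_series G n H"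
        using less.hyps UN by blast
      have "X \<noteq> {\<one>\<^bsub>G Mod Y\<^esub>}" using X(2) by auto
      then obtain C where C: "C \<in> X" "C \<noteq> \<one>\<^bsub>G Mod Y\<^esub>" using subgroup.one_closed[OF sX] by blast
      have Xgen: "X = generate (G Mod Y) {C}" using Q.prime_order_generate[OF sX X(2) C] .
      have Cc: "C \<in> carrier (G Mod Y)" using subgroup.mem_carrier[OF sX C(1)] .
      then obtain x where x: "x \<in> carrier G" "C = Y #> x" by (auto simp: carrier_FactGroup)
      have "\<exists>k::int. \<exists>h\<in>Y. y = h \<otimes> x [^] k" if y: "y \<in> \<Union>X" for y
      proof -
        have yc: "y \<in> carrier G" using y UN normal_in_carrier by blast
        then have "Y #> y \<in> generate (G Mod Y) {C}" using y U(3) Xgen by blast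
        then obtain k :: int where "Y #> y = C [^]\<^bsub>G Mod Y\<^esub> k" using Q.generate_pow[OF Cc] by blast
        then have "Y #> y = Y #> x [^] k" using x Y.FactGroup_int_pow by simp
        then have "y \<in> Y #> x [^] k" using rcos_self[OF yc Y.subgroup_axioms] by simp
        then show ?thesis by (auto simp: r_coset_def)
      qed
      moreover have "x \<in> \<Union>X" using U(3) x C(1) by blast
      ultimately have "\<exists>x\<in>\<Union>X. \<forall>y\<in>\<Union>X. \<exists>k::int. \<exists>h\<in>Y. y = h \<otimes> x [^] k" by blast
      then have "cyclic_series G (Suc n) (case_nat Y H)"
        using H U(1) less.prems by (intro cyclic_series_Cons) (simp_all del: Union_iff)
      then show ?thesis by (intro exI[of _ "Suc n"] exI[of _ "case_nat Y H"]) simp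
    qed
  qed
  from this[OF one_is_normal] show ?thesis by (simp only: supersoluble_iff)
qed

lemma (in group) normal_p_subgroup_le:
  assumes "finite (carrier G)" "prime p" "subgroup P G" "\<not> p dvd card (rcosets P)"
    and "U \<lhd> G" "card U = p ^ k"
  shows "U \<subseteq> P"
proof
  fix u assume u: "u \<in> U"
  obtain g where g: "g \<in> carrier G" "\<And>u. u \<in> U \<Longrightarrow> g \<otimes> u \<otimes> inv g \<in> P"
    using p_subgroup_into_conjugate[OF assms(1-4) normal_imp_subgroup[OF assms(5)] assms(6)] by blast
  have "inv g \<otimes> u \<otimes> g \<in> U" using normal_conj[OF assms(5), of "inv g" u] g u by simp
  then have "g \<otimes> (inv g \<otimes> u \<otimes> g) \<otimes> inv g \<in> P" by (rule g(2))
  then show "u \<in> P" using g(1) u normal_in_carrier[OF assms(5)] by (simp add: word_simps)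
qed

lemma (in group) p_element_in_normal_Sylow:
  assumes "finite (carrier G)" "prime p" "P \<lhd> G" "\<not> p dvd card (rcosets P)"
    and "u \<in> carrier G" "u [^] (p ^ k :: nat) = \<one>"
  shows "u \<in> P"
proof -
  let ?U = "generate G {u}"
  have sU: "subgroup ?U G" using assms(5) generate_is_subgroup by simp
  obtain i where "card ?U = p ^ i" using p_element_subgroup_order assms by blast
  then obtain g where g: "g \<in> carrier G" "\<And>u. u \<in> ?U \<Longrightarrow> g \<otimes> u \<otimes> inv g \<in> P"
    using p_subgroup_into_conjugate[OF assms(1,2) normal_imp_subgroup[OF assms(3)] assms(4) sU] by blast
  have "u \<in> ?U" by (simp add: generate.incl)
  then have "inv g \<otimes> (g \<otimes> u \<otimes> inv g) \<otimes> g \<in> P"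
    using normal_conj[OF assms(3), of "inv g"] g by simp
  then show ?thesis using g(1) assms(5) by (simp add: word_simps)
qed

lemma (in group) Sylow_index_coprime:
  assumes "finite (carrier G)" "prime p" "subgroup P G" "card P = p ^ multiplicity p (order G)"
  shows "\<not> p dvd card (rcosets P)"
proof
  assume "p dvd card (rcosets P)"
  then have "p * card P dvd order G" using lagrange[OF assms(3)] by (metis mult_dvd_mono dvd_refl)
  then have "p ^ Suc (multiplicity p (order G)) dvd order G" using assms(4) by simp
  moreover have "order G \<noteq> 0" using assms(1) order_gt_0_iff_finite by simp
  ultimately show False
    using assms(2) multiplicity_geI[of "order G" p "Suc (multiplicity p (order G))"] prime_gt_1_nat[OF assms(2)]
    by simp
qed

lemma (in group_hom) restrict_onto_image: "group_hom G (H\<lparr>carrier := h ` carrier G\<rparr>) h"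
  using G.is_group H.subgroup_imp_group[OF img_is_subgroup]
  by (auto simp: group_hom_def group_hom_axioms_def intro!: homI)

lemma (in group_hom) restrict_subgroups:
  assumes "subgroup S G"
  shows "group_hom (G\<lparr>carrier := S\<rparr>) (H\<lparr>carrier := h ` S\<rparr>) h"
  using group_hom.restrict_onto_image[OF induced_group_hom'[OF assms]] by simp

lemma (in group_hom) card_image_kernel: "order G = card (h ` carrier G) * card (kernel G H h)"
proof -
  interpret r: group_hom G "H\<lparr>carrier := h ` carrier G\<rparr>" h by (rule restrict_onto_image)
  have "card (rcosets\<^bsub>G\<^esub> (kernel G H h)) = card (h ` carrier G)"
    using iso_same_card[OF r.FactGroup_iso] by (simp add: FactGroup_def kernel_def)
  then show ?thesis using G.lagrange[OF subgroup_kernel] by simp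
qed

text \<open>The index of \<open>h ` P\<close> divides the index of \<open>P\<close>.\<close>

lemma (in group_hom) image_index_coprime:
  assumes "finite (carrier G)" "subgroup P G" "\<not> p dvd card (rcosets\<^bsub>G\<^esub> P)"
    and "h ` carrier G = carrier H"
  shows "\<not> p dvd card (rcosets\<^bsub>H\<^esub> (h ` P))"
proof -
  let ?K = "kernel G H h" and ?L = "kernel (G\<lparr>carrier := P\<rparr>) H h"
  interpret P: group_hom "G\<lparr>carrier := P\<rparr>" H h using assms(2) by (rule induced_group_hom')
  have sP: "subgroup (h ` P) H" using subgroup_img_is_subgroup assms(2) .
  have L: "subgroup ?L G"
    using G.incl_subgroup[OF assms(2) P.subgroup_kernel] .
  have "?L \<subseteq> ?K" using subgroup.subset[OF assms(2)] by (auto simp: kernel_def)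
  then have "card ?L dvd card ?K" using G.subgroup_card_dvd_subgroup[OF L subgroup_kernel] by blast
  then obtain c where c: "card ?K = card ?L * c" by blast
  have "card (rcosets\<^bsub>G\<^esub> P) * (card (h ` P) * card ?L) = order G"
    using G.lagrange[OF assms(2)] P.card_image_kernel by (simp add: order_def)
  also have "\<dots> = card (rcosets\<^bsub>H\<^esub> (h ` P)) * card (h ` P) * card ?K"
    using card_image_kernel H.lagrange[OF sP] assms(4) by (simp add: order_def)
  also have "\<dots> = card (rcosets\<^bsub>H\<^esub> (h ` P)) * c * (card (h ` P) * card ?L)"
    unfolding c by simp
  finally have eq: "card (rcosets\<^bsub>G\<^esub> P) * (card (h ` P) * card ?L) =
      card (rcosets\<^bsub>H\<^esub> (h ` P)) * c * (card (h ` P) * card ?L)" .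
  have "finite P" using assms(1) subgroup.subset[OF assms(2)] finite_subset by blast
  then have "order (G\<lparr>carrier := P\<rparr>) > 0" using P.G.order_gt_0_iff_finite by simp
  then have "card (h ` P) * card ?L \<noteq> 0" using P.card_image_kernel by simp
  from eq[unfolded mult_right_cancel[OF this]]
  have "card (rcosets\<^bsub>G\<^esub> P) = card (rcosets\<^bsub>H\<^esub> (h ` P)) * c" .
  with assms(3) show ?thesis by auto
qed

text \<open>Descending from \<open>G\<close> to the trivial subgroup through normal subgroups
  \<open>Y\<close> with quotients of prime order, all the products \<open>Y P\<close> are
  normal: a Sylow \<open>p\<close>-subgroup contains each normal subgroup of order
  \<open>p\<close>, and it centralizes each normal subgroup of smaller prime order.\<close>

lemma (in group) supersoluble_Sylow_normal:
  assumes "finite (carrier G)" "supersoluble G" "prime p"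
    and large: "\<And>q. prime q \<Longrightarrow> q dvd order G \<Longrightarrow> q \<le> p"
    and "subgroup P G" "card P = p ^ k" "\<not> p dvd card (rcosets P)"
  shows "P \<lhd> G"
proof -
  have Pc: "u \<in> carrier G" if "u \<in> P" for u using that subgroup.subset[OF assms(5)] by blast
  have Ppow: "u [^] (p ^ k) = \<one>" if u: "u \<in> P" for u
    using subgroup_pow_card[OF assms(5) u] assms(6) by simp
  have "\<exists>y\<in>Y. \<exists>v\<in>P. a \<otimes> u \<otimes> inv a = y \<otimes> v"
    if "Y \<lhd> G" "a \<in> carrier G" "u \<in> P" for Y a u
    using that
  proof (induction "card (carrier G) - card Y" arbitrary: Y a u rule: less_induct)
    case less
    interpret Y: normal Y G by fact
    show ?case
    proof (cases "Y = carrier G")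
      case True
      then show ?thesis using less.prems Pc subgroup.one_closed[OF assms(5)]
        by (intro bexI[of _ "a \<otimes> u \<otimes> inv a"] bexI[of _ \<one>]) auto
    next
      case False
      then have "Y \<subset> carrier G" using Y.subset by blast
      then obtain X where X: "X \<lhd> G" "Y \<subseteq> X" "prime (card X div card Y)"
          "card X = (card X div card Y) * card Y"
        using supersoluble_section_prime[OF assms(1,2) less.prems(1) normal_self] by metis
      define q where "q = card X div card Y"
      have q: "prime q" "card X = q * card Y" using X(3,4) q_def by auto
      have fY: "card Y > 0" using Y.finite_imp_card_positive assms(1) by blast
      have sX: "subgroup X G" using X(1) by (rule normal_imp_subgroup)
      have "card X dvd order G" using subgroup_card_dvd[OF sX] .
      then have qp: "q \<le> p" using large q by (metis dvd_mult_left)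
      have fX: "finite X" using assms(1) subgroup.subset[OF sX] finite_subset by blast
      have "card Y < card X" using q fY prime_gt_1_nat by simp
      moreover have "card X \<le> card (carrier G)"
        using assms(1) subgroup.subset[OF sX] by (simp add: card_mono)
      ultimately have "card (carrier G) - card X < card (carrier G) - card Y" by linarith
      then obtain x w where xw: "x \<in> X" "w \<in> P" "a \<otimes> u \<otimes> inv a = x \<otimes> w"
        using less.hyps[OF _ X(1) less.prems(2,3)] by blast
      have xc: "x \<in> carrier G" using xw(1) X(1) normal_in_carrier by blast
      have wc: "w \<in> carrier G" using xw(2) Pc by blast
      define Q where "Q = G Mod Y"
      define h where "h = (\<lambda>x. Y #> x)"
      interpret h: group_hom G Q h unfolding Q_def h_def by (rule Y.quotient_hom)
      have hsurj: "h ` carrier G = carrier Q" unfolding Q_def h_def by (rule Y.quotient_surj)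
      have hker: "kernel G Q h = Y"
        unfolding kernel_def Q_def h_def using Y.rcos_eq_self_iff Y.subset by auto
      have fQ: "finite (carrier Q)" unfolding Q_def using Y.finite_quotient assms(1) .
      have hX: "h ` X \<lhd> Q"
        using normal.surj_hom_normal_subgroup[OF X(1) h.group_hom_axioms hsurj] .
      have "kernel (G\<lparr>carrier := X\<rparr>) Q h = Y"
        using hker X(2) subgroup.subset[OF sX] by (auto simp: kernel_def)
      then have cX: "card (h ` X) = q"
        using group_hom.card_image_kernel[OF h.induced_group_hom'[OF sX]] q fY by (simp add: order_def)
      \<comment> \<open>In the quotient by \<open>Y\<close>, the image of \<open>X\<close>
        has order \<open>q\<close>, and the image of \<open>x \<otimes> w\<close> is a
        \<open>p\<close>-element that has to be found in the image of
        \<open>P\<close>.\<close>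
      have "h (x \<otimes> w) \<in> h ` P"
      proof (cases "q = p")
        case True
        have "\<not> p dvd card (rcosets\<^bsub>Q\<^esub> (h ` P))"
          by (rule h.image_index_coprime[OF assms(1,5,7) hsurj])
        then have "h ` X \<subseteq> h ` P"
          using h.H.normal_p_subgroup_le[OF fQ assms(3) h.subgroup_img_is_subgroup[OF assms(5)] _ hX, of 1]
            cX True by simp
        then have "h x \<in> h ` P" using xw(1) by blast
        then show ?thesis
          using subgroup.m_closed[OF h.subgroup_img_is_subgroup[OF assms(5)]] xw(2) xc wc by simp
      next
        case False
        have pw: "h v [^]\<^bsub>Q\<^esub> (p ^ k) = \<one>\<^bsub>Q\<^esub>" if "v \<in> P" for v
          using Ppow[OF that] Pc[OF that] by (metis h.hom_nat_pow h.hom_one)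
        have com: "h w \<otimes>\<^bsub>Q\<^esub> h x = h x \<otimes>\<^bsub>Q\<^esub> h w"
          using False qp cX xw(1) wc
          by (intro h.H.p_element_centralizes_small_prime[OF fQ assms(3) _ pw[OF xw(2)] hX]) auto
        have "(x \<otimes> w) [^] (p ^ k) = \<one>"
          using conj_nat_pow[OF less.prems(2) Pc[OF less.prems(3)], of "p ^ k"]
            Ppow[OF less.prems(3)] less.prems(2) xw(3) by simp
        then have "(h x \<otimes>\<^bsub>Q\<^esub> h w) [^]\<^bsub>Q\<^esub> (p ^ k) = \<one>\<^bsub>Q\<^esub>"
          using xc wc by (metis h.hom_mult h.hom_nat_pow h.hom_one m_closed)
        then have "h x [^]\<^bsub>Q\<^esub> (p ^ k) = \<one>\<^bsub>Q\<^esub>"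
          using h.H.pow_mult_distrib[OF com[symmetric], of "p ^ k"] pw[OF xw(2)] xc wc by simp
        then have "h.H.ord (h x) dvd p ^ k" using h.H.pow_eq_id xc by simp
        moreover have "h.H.ord (h x) dvd q"
        proof -
          have "h x [^]\<^bsub>Q\<^esub> q = \<one>\<^bsub>Q\<^esub>"
            using h.H.subgroup_pow_card[OF normal_imp_subgroup[OF hX], of "h x"] xw(1) cX by simp
          then show ?thesis using h.H.pow_eq_id xc by simp
        qed
        moreover have "coprime (p ^ k) q"
          using False q(1) assms(3) by (simp add: primes_coprime)
        ultimately have "h.H.ord (h x) = 1" by (metis coprime_common_divisor nat_dvd_1_iff_1)
        then have "h x = \<one>\<^bsub>Q\<^esub>" using h.H.ord_eq_1 xc by simp
        then show ?thesis using xw(2) xc wc by simp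
      qed
      then obtain v where v: "v \<in> P" "Y #> (x \<otimes> w) = Y #> v" unfolding h_def by auto
      then have "x \<otimes> w \<in> Y #> v"
        using rcos_self[OF _ Y.subgroup_axioms, of "x \<otimes> w"] xc wc by simp
      then show ?thesis using v(1) xw(3) by (auto simp: r_coset_def)
    qed
  qed
  from this[OF one_is_normal] have "a \<otimes> u \<otimes> inv a \<in> P" if "a \<in> carrier G" "u \<in> P" for a u
    using that Pc by (metis l_one singletonD)
  then show ?thesis using assms(5) by (intro normal_invI) auto
qed

section \<open>Lower central series and nilpotent residuals\<close>

text \<open>The lower central series of the subgroup \<open>H\<close>, formed in
  \<open>G\<close>: so the series of different subgroups can be compared.\<close>

definition lower_central :: "('a, 'b) monoid_scheme \<Rightarrow> 'a set \<Rightarrow> nat \<Rightarrow> 'a set" where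
  "lower_central G H n = ((\<lambda>K. commutator_subgroup G K H) ^^ n) H"

lemma lower_central_0 [simp]: "lower_central G H 0 = H"
  and lower_central_Suc [simp]:
    "lower_central G H (Suc n) = commutator_subgroup G (lower_central G H n) H"
  by (simp_all add: lower_central_def)

lemma nilpotent_iff:
  "nilpotent G \<longleftrightarrow> group G \<and> (\<exists>n. lower_central G (carrier G) n = {\<one>\<^bsub>G\<^esub>})"
  by (simp add: nilpotent_def lower_central_def)

context group
begin

lemma commutator_mem:
  "x \<in> H \<Longrightarrow> y \<in> K \<Longrightarrow> x \<otimes> y \<otimes> inv x \<otimes> inv y \<in> commutator_subgroup G H K"
  unfolding commutator_subgroup_def by (rule generate.incl) blast

lemma commutator_subgroup_subset:
  assumes "subgroup M G" "\<And>x y. x \<in> H \<Longrightarrow> y \<in> K \<Longrightarrow> x \<otimes> y \<otimes> inv x \<otimes> inv y \<in> M"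
  shows "commutator_subgroup G H K \<subseteq> M"
  unfolding commutator_subgroup_def using assms by (intro generate_subgroup_incl) blast+

lemma commutator_subgroup_subgroup:
  "H \<subseteq> carrier G \<Longrightarrow> K \<subseteq> carrier G \<Longrightarrow> subgroup (commutator_subgroup G H K) G"
  unfolding commutator_subgroup_def by (rule generate_is_subgroup) (auto simp: subset_iff)

lemma commutator_subgroup_mono:
  "H \<subseteq> H' \<Longrightarrow> K \<subseteq> K' \<Longrightarrow> commutator_subgroup G H K \<subseteq> commutator_subgroup G H' K'"
  unfolding commutator_subgroup_def by (rule mono_generate) blast

lemma commutator_subgroup_consistent:
  assumes "subgroup M G" "H \<subseteq> M" "K \<subseteq> M"
  shows "commutator_subgroup (G\<lparr>carrier := M\<rparr>) H K = commutator_subgroup G H K"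
proof -
  have "(\<Union>x\<in>H. \<Union>y\<in>K. {x \<otimes> y \<otimes> inv\<^bsub>G\<lparr>carrier := M\<rparr>\<^esub> x \<otimes> inv\<^bsub>G\<lparr>carrier := M\<rparr>\<^esub> y}) =
      (\<Union>x\<in>H. \<Union>y\<in>K. {x \<otimes> y \<otimes> inv x \<otimes> inv y})"
    using assms by (intro SUP_cong refl) (auto simp: subset_iff)
  moreover have "(\<Union>x\<in>H. \<Union>y\<in>K. {x \<otimes> y \<otimes> inv x \<otimes> inv y}) \<subseteq> M"
    using assms by (auto simp: subset_iff subgroup.m_closed subgroup.m_inv_closed)
  ultimately show ?thesis
    unfolding commutator_subgroup_def using generate_consistent[OF _ assms(1)] by simp
qed

lemma generate_conj_closed:
  assumes "S \<subseteq> carrier G" "g \<in> carrier G" "\<And>s. s \<in> S \<Longrightarrow> g \<otimes> s \<otimes> inv g \<in> generate G S"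
    and "w \<in> generate G S"
  shows "g \<otimes> w \<otimes> inv g \<in> generate G S"
  using assms(4)
proof (induction rule: generate.induct)
  case one
  then show ?case using assms(2) by (simp add: generate.one)
next
  case (incl s)
  then show ?case by (rule assms(3))
next
  case (inv s)
  then have "s \<in> carrier G" using assms(1) by blast
  then have "g \<otimes> inv s \<otimes> inv g = inv (g \<otimes> s \<otimes> inv g)" using assms(2) by (simp add: word_simps)
  then show ?case using generate_m_inv_closed[OF assms(1) assms(3)[OF inv]] by simp
next
  case (eng a b)
  then have "a \<in> carrier G" "b \<in> carrier G" using generate_in_carrier[OF assms(1)] by blast+
  then have "g \<otimes> (a \<otimes> b) \<otimes> inv g = (g \<otimes> a \<otimes> inv g) \<otimes> (g \<otimes> b \<otimes> inv g)"
    using assms(2) by (simp add: word_simps)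
  then show ?case using eng generate.eng by metis
qed

lemma commutator_conj_closed:
  assumes "H \<subseteq> carrier G" "K \<subseteq> carrier G" "g \<in> carrier G"
    and "\<And>x y. x \<in> H \<Longrightarrow> y \<in> K \<Longrightarrow>
      g \<otimes> (x \<otimes> y \<otimes> inv x \<otimes> inv y) \<otimes> inv g \<in> commutator_subgroup G H K"
    and "w \<in> commutator_subgroup G H K"
  shows "g \<otimes> w \<otimes> inv g \<in> commutator_subgroup G H K"
proof -
  let ?S = "\<Union>x\<in>H. \<Union>y\<in>K. {x \<otimes> y \<otimes> inv x \<otimes> inv y}"
  have "?S \<subseteq> carrier G" using assms(1,2) by (auto simp: subset_iff)
  moreover have "g \<otimes> s \<otimes> inv g \<in> generate G ?S" if s: "s \<in> ?S" for s
  proof -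
    obtain x y where "x \<in> H" "y \<in> K" "s = x \<otimes> y \<otimes> inv x \<otimes> inv y" using s by blast
    then show ?thesis using assms(4) unfolding commutator_subgroup_def by blast
  qed
  ultimately show ?thesis
    using assms(3,5) generate_conj_closed[of ?S g w] unfolding commutator_subgroup_def by blast
qed

lemma conj_commutator:
  assumes "g \<in> carrier G" "x \<in> carrier G" "y \<in> carrier G"
  shows "g \<otimes> (x \<otimes> y \<otimes> inv x \<otimes> inv y) \<otimes> inv g =
    (g \<otimes> x \<otimes> inv g) \<otimes> (g \<otimes> y \<otimes> inv g) \<otimes> inv (g \<otimes> x \<otimes> inv g) \<otimes> inv (g \<otimes> y \<otimes> inv g)"
  using assms by (simp add: word_simps)

lemma commutator_subgroup_normal:
  assumes "H \<lhd> G" "K \<lhd> G"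
  shows "commutator_subgroup G H K \<lhd> G"
proof (rule normal_invI)
  have sub: "H \<subseteq> carrier G" "K \<subseteq> carrier G" using assms normal_in_carrier by blast+
  then show "subgroup (commutator_subgroup G H K) G" by (rule commutator_subgroup_subgroup)
  fix g w assume g: "g \<in> carrier G" and w: "w \<in> commutator_subgroup G H K"
  show "g \<otimes> w \<otimes> inv g \<in> commutator_subgroup G H K"
  proof (rule commutator_conj_closed[OF sub g _ w])
    fix x y assume "x \<in> H" "y \<in> K"
    then show "g \<otimes> (x \<otimes> y \<otimes> inv x \<otimes> inv y) \<otimes> inv g \<in> commutator_subgroup G H K"
      using sub g assms by (subst conj_commutator) (auto intro!: commutator_mem normal_conj)
  qed
qed

lemma commutator_subgroup_le_left:
  assumes "H \<lhd> G" "K \<subseteq> carrier G"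
  shows "commutator_subgroup G H K \<subseteq> H"
proof (rule commutator_subgroup_subset)
  show s: "subgroup H G" using assms(1) by (rule normal_imp_subgroup)
  fix x y assume xy: "x \<in> H" "y \<in> K"
  then have c: "x \<in> carrier G" "y \<in> carrier G" using normal_in_carrier assms by blast+
  have "x \<otimes> (y \<otimes> inv x \<otimes> inv y) \<in> H"
    using xy c s normal_conj[OF assms(1), of y "inv x"] by (simp add: subgroup.m_closed subgroup.m_inv_closed)
  then show "x \<otimes> y \<otimes> inv x \<otimes> inv y \<in> H" using c by (simp add: m_assoc)
qed

text \<open>Conjugation by \<open>a'\<close> in \<open>A\<close> takes \<open>[a, b]\<close> to
  \<open>[a' a, b] [a', b]\<^sup>-\<^sup>1\<close>, and conjugation by an element of
  \<open>B\<close> maps both \<open>A\<close> and \<open>B\<close> to themselves.\<close>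

lemma commutator_subgroup_normal_product:
  assumes "A \<lhd> G" "subgroup B G" "carrier G = A <#> B"
  shows "commutator_subgroup G A B \<lhd> G"
proof (rule normal_invI)
  have sA: "subgroup A G" using assms(1) by (rule normal_imp_subgroup)
  have sub: "A \<subseteq> carrier G" "B \<subseteq> carrier G"
    using subgroup.subset[OF sA] subgroup.subset[OF assms(2)] .
  let ?C = "commutator_subgroup G A B"
  show sC: "subgroup ?C G" using sub by (rule commutator_subgroup_subgroup)
  have cA: "a \<otimes> w \<otimes> inv a \<in> ?C" if a: "a \<in> A" and w: "w \<in> ?C" for a w
  proof (rule commutator_conj_closed[OF sub _ _ w])
    show "a \<in> carrier G" using a sub by blast
    fix x y assume xy: "x \<in> A" "y \<in> B"
    have c: "a \<in> carrier G" "x \<in> carrier G" "y \<in> carrier G" using a xy sub by blast+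
    have "(a \<otimes> x) \<otimes> y \<otimes> inv (a \<otimes> x) \<otimes> inv y \<in> ?C"
      using a xy subgroup.m_closed[OF sA] by (intro commutator_mem) auto
    moreover have "a \<otimes> y \<otimes> inv a \<otimes> inv y \<in> ?C" using a xy by (intro commutator_mem)
    ultimately have "((a \<otimes> x) \<otimes> y \<otimes> inv (a \<otimes> x) \<otimes> inv y) \<otimes> inv (a \<otimes> y \<otimes> inv a \<otimes> inv y) \<in> ?C"
      using sC by (simp add: subgroup.m_closed subgroup.m_inv_closed)
    then show "a \<otimes> (x \<otimes> y \<otimes> inv x \<otimes> inv y) \<otimes> inv a \<in> ?C" using c by (simp add: word_simps)
  qed
  have cB: "b \<otimes> w \<otimes> inv b \<in> ?C" if b: "b \<in> B" and w: "w \<in> ?C" for b w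
  proof (rule commutator_conj_closed[OF sub _ _ w])
    show bc: "b \<in> carrier G" using b sub by blast
    fix x y assume xy: "x \<in> A" "y \<in> B"
    then have "b \<otimes> y \<otimes> inv b \<in> B" using b assms(2)
      by (simp add: subgroup.m_closed subgroup.m_inv_closed)
    then show "b \<otimes> (x \<otimes> y \<otimes> inv x \<otimes> inv y) \<otimes> inv b \<in> ?C"
      using sub xy bc normal_conj[OF assms(1) bc]
      by (subst conj_commutator) (auto intro!: commutator_mem)
  qed
  fix g w assume "g \<in> carrier G" and w: "w \<in> ?C"
  then obtain a b where ab: "a \<in> A" "b \<in> B" "g = a \<otimes> b" using assms(3) by (auto simp: set_mult_def)
  have "w \<in> carrier G" using w subgroup.subset[OF sC] by blast
  then have "g \<otimes> w \<otimes> inv g = a \<otimes> (b \<otimes> w \<otimes> inv b) \<otimes> inv a"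
    using ab sub by (auto simp: word_simps subset_iff)
  then show "g \<otimes> w \<otimes> inv g \<in> ?C" using cA cB ab w by simp
qed

lemma lower_central_subset:
  assumes "subgroup H G"
  shows "lower_central G H n \<subseteq> H"
proof (induction n)
  case (Suc n)
  have "commutator_subgroup G (lower_central G H n) H \<subseteq> H"
  proof (rule commutator_subgroup_subset[OF assms])
    fix x y assume "x \<in> lower_central G H n" "y \<in> H"
    then show "x \<otimes> y \<otimes> inv x \<otimes> inv y \<in> H"
      using Suc by (intro subgroup.m_closed[OF assms] subgroup.m_inv_closed[OF assms]) blast+
  qed
  then show ?case by simp
qed simp

lemma lower_central_normal: "H \<lhd> G \<Longrightarrow> lower_central G H n \<lhd> G"
  by (induction n) (auto intro: commutator_subgroup_normal)

lemma lower_central_mono: "H \<subseteq> K \<Longrightarrow> lower_central G H n \<subseteq> lower_central G K n"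
  by (induction n) (auto intro: commutator_subgroup_mono[THEN subsetD])

lemma lower_central_consistent:
  assumes "subgroup M G" "subgroup H G" "H \<subseteq> M"
  shows "lower_central (G\<lparr>carrier := M\<rparr>) H n = lower_central G H n"
proof (induction n)
  case (Suc n)
  have "lower_central G H n \<subseteq> M" using lower_central_subset[OF assms(2)] assms(3) by blast
  then show ?case using Suc commutator_subgroup_consistent[OF assms(1) _ assms(3)] by simp
qed simp

lemma lower_central_Suc_subset: "lower_central G (carrier G) (Suc n) \<subseteq> lower_central G (carrier G) n"
  using commutator_subgroup_le_left[OF lower_central_normal[OF normal_self]] by simp

lemma lower_central_antimono:
  "m \<le> n \<Longrightarrow> lower_central G (carrier G) n \<subseteq> lower_central G (carrier G) m"
  by (rule lift_Suc_antimono_le[of "lower_central G (carrier G)"]) (rule lower_central_Suc_subset)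

lemma commute_inv:
  assumes "a \<otimes> x = x \<otimes> a" "a \<in> carrier G" "x \<in> carrier G"
  shows "inv a \<otimes> x = x \<otimes> inv a"
proof -
  have "inv a \<otimes> (x \<otimes> a) \<otimes> inv a = inv a \<otimes> (a \<otimes> x) \<otimes> inv a" using assms(1) by simp
  then show ?thesis using assms(2,3) by (simp add: word_simps)
qed

lemma commute_mult:
  assumes "a \<otimes> x = x \<otimes> a" "b \<otimes> x = x \<otimes> b" "a \<in> carrier G" "b \<in> carrier G" "x \<in> carrier G"
  shows "a \<otimes> b \<otimes> x = x \<otimes> (a \<otimes> b)"
proof -
  have "a \<otimes> b \<otimes> x = a \<otimes> x \<otimes> b" using assms(2-5) by (simp add: m_assoc)
  then show ?thesis using assms by (simp add: m_assoc)
qed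

lemma centralizer_subgroup:
  assumes "S \<subseteq> carrier G"
  shows "subgroup {g \<in> carrier G. \<forall>x\<in>S. g \<otimes> x = x \<otimes> g} G"
  using assms by (intro subgroupI) (auto simp: subset_iff commute_inv commute_mult intro!: exI[of _ \<one>])

end

lemma (in group_hom) centralizer_preimage:
  assumes "y \<in> carrier H"
  shows "subgroup {g \<in> carrier G. h g \<otimes>\<^bsub>H\<^esub> y = y \<otimes>\<^bsub>H\<^esub> h g} G"
  using assms by (intro G.subgroupI) (auto simp: H.commute_inv H.commute_mult intro!: exI[of _ \<one>])

lemma (in group_hom) commutator_subgroup_image:
  assumes "K \<subseteq> carrier G" "L \<subseteq> carrier G"
  shows "h ` commutator_subgroup G K L = commutator_subgroup H (h ` K) (h ` L)"
proof -
  have "h ` (\<Union>x\<in>K. \<Union>y\<in>L. {x \<otimes> y \<otimes> inv x \<otimes> inv y}) =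
      (\<Union>x\<in>h ` K. \<Union>y\<in>h ` L. {x \<otimes>\<^bsub>H\<^esub> y \<otimes>\<^bsub>H\<^esub> inv\<^bsub>H\<^esub> x \<otimes>\<^bsub>H\<^esub> inv\<^bsub>H\<^esub> y})"
    using assms by (simp add: image_UN subset_iff)
  then show ?thesis
    unfolding commutator_subgroup_def using assms
    by (subst generate_img[symmetric]) (auto simp: subset_iff)
qed

lemma (in group_hom) lower_central_image:
  assumes "subgroup K G"
  shows "h ` lower_central G K n = lower_central H (h ` K) n"
proof (induction n)
  case (Suc n)
  have "lower_central G K n \<subseteq> carrier G" "K \<subseteq> carrier G"
    using G.lower_central_subset[OF assms] subgroup.subset[OF assms] by blast+
  then show ?case using Suc by (simp add: commutator_subgroup_image)
qed simp

lemma (in normal) nilpotent_quotient_iff: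
  "nilpotent (G Mod H) \<longleftrightarrow> (\<exists>n. lower_central G (carrier G) n \<subseteq> H)"
proof -
  have "lower_central (G Mod H) (carrier (G Mod H)) n = {\<one>\<^bsub>G Mod H\<^esub>} \<longleftrightarrow>
      lower_central G (carrier G) n \<subseteq> H" for n
  proof -
    let ?L = "lower_central G (carrier G) n"
    have s: "subgroup ?L G" using lower_central_normal[OF normal_self] normal_imp_subgroup by blast
    have "lower_central (G Mod H) (carrier (G Mod H)) n = (\<lambda>x. H #> x) ` ?L"
      using group_hom.lower_central_image[OF quotient_hom subgroup_self, of n] quotient_surj by simp
    also have "\<dots> = {H} \<longleftrightarrow> (\<forall>x\<in>?L. H #> x = H)"
      using subgroup.one_closed[OF s] by auto
    also have "\<dots> \<longleftrightarrow> ?L \<subseteq> H"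
      using rcos_eq_self_iff subgroup.subset[OF s] by blast
    finally show ?thesis by simp
  qed
  then show ?thesis by (simp add: nilpotent_iff factorgroup_is_group)
qed

context group
begin

lemma lower_central_stable:
  assumes "finite (carrier G)"
  obtains n where "(\<Inter>m. lower_central G (carrier G) m) = lower_central G (carrier G) n"
proof -
  let ?L = "lower_central G (carrier G)"
  obtain n where n: "\<And>m. card (?L n) \<le> card (?L m)"
    using ex_has_least_nat[of "\<lambda>_. True" 0 "\<lambda>n. card (?L n)"] by auto
  have fin: "finite (?L m)" for m
    using lower_central_subset[OF subgroup_self] assms finite_subset by blast
  have "?L n \<subseteq> ?L m" for m
  proof -
    have "?L (max m n) = ?L n"
      using n[of "max m n"] by (intro card_seteq fin lower_central_antimono) auto
    then show ?thesis using lower_central_antimono[of m "max m n"] by simp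
  qed
  then have "(\<Inter>m. ?L m) = ?L n" by blast
  with that show thesis .
qed

text \<open>In a finite group the series becomes stationary, so that its intersection is one of
  its terms and has a nilpotent quotient.\<close>

lemma nilpotent_residual:
  assumes "finite (carrier G)"
  shows "residual nilpotent G = (\<Inter>n. lower_central G (carrier G) n)"
  unfolding residual_def
proof (rule Least_equality)
  obtain n where n: "(\<Inter>m. lower_central G (carrier G) m) = lower_central G (carrier G) n"
    using lower_central_stable assms by blast
  have N: "lower_central G (carrier G) n \<lhd> G" using lower_central_normal normal_self by blast
  show "(\<Inter>n. lower_central G (carrier G) n) \<lhd> G \<and>
      nilpotent (G Mod (\<Inter>n. lower_central G (carrier G) n))"
    unfolding n using N normal.nilpotent_quotient_iff[OF N] by blast
  fix N assume N: "N \<lhd> G \<and> nilpotent (G Mod N)"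
  then obtain n where "lower_central G (carrier G) n \<subseteq> N"
    using normal.nilpotent_quotient_iff[of N G] by auto
  then show "(\<Inter>n. lower_central G (carrier G) n) \<subseteq> N" by blast
qed

lemma nilpotent_residual_subgroup:
  assumes "finite (carrier G)" "subgroup H G"
  shows "residual nilpotent (G\<lparr>carrier := H\<rparr>) = (\<Inter>n. lower_central G H n)"
    and "\<exists>n. (\<Inter>m. lower_central G H m) = lower_central G H n"
proof -
  interpret H: group "G\<lparr>carrier := H\<rparr>" using assms(2) by (rule subgroup_imp_group)
  have eq: "lower_central (G\<lparr>carrier := H\<rparr>) H n = lower_central G H n" for n
    using lower_central_consistent[OF assms(2) assms(2)] by simp
  have fin: "finite (carrier (G\<lparr>carrier := H\<rparr>))"
    using assms subgroup.subset finite_subset by fastforce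
  show "residual nilpotent (G\<lparr>carrier := H\<rparr>) = (\<Inter>n. lower_central G H n)"
    using H.nilpotent_residual[OF fin] eq by simp
  obtain n where "(\<Inter>m. lower_central (G\<lparr>carrier := H\<rparr>) (carrier (G\<lparr>carrier := H\<rparr>)) m) =
      lower_central (G\<lparr>carrier := H\<rparr>) (carrier (G\<lparr>carrier := H\<rparr>)) n"
    using H.lower_central_stable[OF fin] by blast
  then show "\<exists>n. (\<Inter>m. lower_central G H m) = lower_central G H n"
    using eq by (intro exI[of _ n]) simp
qed

text \<open>Conjugation by \<open>a\<close> and by \<open>b\<close> induces power maps on the
  powers of \<open>x\<close>, and power maps commute.\<close>

lemma commutator_centralizes_cyclic:
  assumes "a \<in> carrier G" "b \<in> carrier G" "x \<in> carrier G"
    and "inv a \<otimes> x \<otimes> a = x [^] (m::int)" "inv b \<otimes> x \<otimes> b = x [^] (k::int)"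
  shows "(a \<otimes> b \<otimes> inv a \<otimes> inv b) \<otimes> x = x \<otimes> (a \<otimes> b \<otimes> inv a \<otimes> inv b)"
proof -
  have "inv b \<otimes> (inv a \<otimes> x \<otimes> a) \<otimes> b = x [^] (m * k)"
    using conj_int_pow[of "inv b" x m] assms by (simp add: int_pow_pow mult.commute)
  moreover have "inv a \<otimes> (inv b \<otimes> x \<otimes> b) \<otimes> a = x [^] (m * k)"
    using conj_int_pow[of "inv a" x k] assms by (simp add: int_pow_pow)
  ultimately have "inv b \<otimes> (inv a \<otimes> x \<otimes> a) \<otimes> b = inv a \<otimes> (inv b \<otimes> x \<otimes> b) \<otimes> a" by simp
  then have "(a \<otimes> b) \<otimes> (inv b \<otimes> (inv a \<otimes> x \<otimes> a) \<otimes> b) \<otimes> (inv a \<otimes> inv b) =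
      (a \<otimes> b) \<otimes> (inv a \<otimes> (inv b \<otimes> x \<otimes> b) \<otimes> a) \<otimes> (inv a \<otimes> inv b)" by simp
  then show ?thesis using assms(1-3) by (simp add: word_simps)
qed

text \<open>The derived subgroup \<open>D\<close> centralizes the cyclic sections of a series of
  \<open>G\<close>, so that forming commutators with \<open>D\<close> leads at least one step
  down in this series.\<close>

lemma derived_supersoluble_nilpotent:
  assumes "supersoluble G"
  shows "\<exists>n. lower_central G (derived G (carrier G)) n = {\<one>}"
proof -
  obtain n H where H: "H 0 = {\<one>}" "cyclic_series G n H" using assms supersoluble_iff by blast
  let ?D = "derived G (carrier G)"
  have Dc: "?D \<subseteq> carrier G" by (rule derived_in_carrier) simp
  have sD: "subgroup ?D G" by (rule derived_is_subgroup) simp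
  have step: "y \<otimes> d \<otimes> inv y \<otimes> inv d \<in> H i" if i: "i < n" and y: "y \<in> H (Suc i)" and d: "d \<in> ?D" for i y d
  proof -
    have N: "H i \<lhd> G" "H (Suc i) \<lhd> G" using H(2) i unfolding cyclic_series_def by auto
    interpret N: normal "H i" G by fact
    obtain x where x: "x \<in> H (Suc i)"
      and gen: "\<forall>y\<in>H (Suc i). \<exists>k::int. \<exists>u\<in>H i. y = u \<otimes> x [^] k"
      using H(2) i unfolding cyclic_series_def by blast
    have xc: "x \<in> carrier G" and yc: "y \<in> carrier G" and dc: "d \<in> carrier G"
      using x y N(2) normal_in_carrier d Dc by blast+
    define Q where "Q = G Mod H i"
    define h where "h = (\<lambda>x. H i #> x)"
    interpret h: group_hom G Q h unfolding Q_def h_def by (rule N.quotient_hom)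
    have ker: "h u = \<one>\<^bsub>Q\<^esub> \<longleftrightarrow> u \<in> H i" if "u \<in> carrier G" for u
      unfolding h_def Q_def using N.rcos_eq_self_iff[OF that] by simp
    have pow: "\<exists>k::int. h y = h x [^]\<^bsub>Q\<^esub> k" if y: "y \<in> H (Suc i)" for y
    proof -
      obtain k :: int and u where u: "u \<in> H i" "y = u \<otimes> x [^] k" using gen y by blast
      then have "h y = h x [^]\<^bsub>Q\<^esub> k" using ker[of u] xc by (simp add: h.hom_int_pow)
      then show ?thesis ..
    qed
    have cj: "\<exists>k::int. h g \<otimes>\<^bsub>Q\<^esub> h x \<otimes>\<^bsub>Q\<^esub> inv\<^bsub>Q\<^esub> h g = h x [^]\<^bsub>Q\<^esub> k" if "g \<in> carrier G" for g
      using pow[of "g \<otimes> x \<otimes> inv g"] normal_conj[OF N(2) that x] that xc by simp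
    define C where "C = {g \<in> carrier G. h g \<otimes>\<^bsub>Q\<^esub> h x = h x \<otimes>\<^bsub>Q\<^esub> h g}"
    have "subgroup C G" unfolding C_def using xc by (intro h.centralizer_preimage) simp
    moreover have "derived_set G (carrier G) \<subseteq> C"
    proof
      fix c assume "c \<in> derived_set G (carrier G)"
      then obtain a b where ab: "a \<in> carrier G" "b \<in> carrier G" "c = a \<otimes> b \<otimes> inv a \<otimes> inv b" by auto
      obtain k m :: int where km: "inv\<^bsub>Q\<^esub> h a \<otimes>\<^bsub>Q\<^esub> h x \<otimes>\<^bsub>Q\<^esub> h a = h x [^]\<^bsub>Q\<^esub> k"
        "inv\<^bsub>Q\<^esub> h b \<otimes>\<^bsub>Q\<^esub> h x \<otimes>\<^bsub>Q\<^esub> h b = h x [^]\<^bsub>Q\<^esub> m"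
        using cj[of "inv a"] cj[of "inv b"] ab by auto
      show "c \<in> C" unfolding C_def ab(3)
        using h.H.commutator_centralizes_cyclic[OF _ _ _ km] ab xc by simp
    qed
    ultimately have "?D \<subseteq> C" unfolding derived_def by (rule generate_subgroup_incl[rotated])
    then have "h d \<otimes>\<^bsub>Q\<^esub> h x = h x \<otimes>\<^bsub>Q\<^esub> h d" using d unfolding C_def by auto
    then have hx: "h d \<otimes>\<^bsub>Q\<^esub> h x \<otimes>\<^bsub>Q\<^esub> inv\<^bsub>Q\<^esub> h d = h x"
      using xc dc by (simp add: h.H.inv_solve_right')
    obtain k :: int where k: "h y = h x [^]\<^bsub>Q\<^esub> k" using pow[OF y] by blast
    have "h d \<otimes>\<^bsub>Q\<^esub> h y \<otimes>\<^bsub>Q\<^esub> inv\<^bsub>Q\<^esub> h d = h y"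
      using h.H.conj_int_pow[of "h d" "h x" k] xc dc unfolding hx k by simp
    then have "h y \<otimes>\<^bsub>Q\<^esub> h d = h d \<otimes>\<^bsub>Q\<^esub> h y" using yc dc by (simp add: h.H.inv_solve_right')
    then have "h (y \<otimes> d \<otimes> inv y \<otimes> inv d) = \<one>\<^bsub>Q\<^esub>"
      using yc dc by (simp add: h.H.m_assoc)
    then show ?thesis by (rule iffD1[OF ker, rotated]) (use yc dc in simp)
  qed
  have "lower_central G ?D j \<subseteq> H (n - j)" if "j \<le> n" for j
    using that
  proof (induction j)
    case 0
    then show ?case using H(2) Dc unfolding cyclic_series_def by simp
  next
    case (Suc j)
    let ?i = "n - Suc j"
    have i: "?i < n" "n - j = Suc ?i" using Suc.prems by auto
    have "H ?i \<lhd> G" using H(2) i(1) unfolding cyclic_series_def by simp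
    then have "subgroup (H ?i) G" by (rule normal_imp_subgroup)
    have "commutator_subgroup G (lower_central G ?D j) ?D \<subseteq> H ?i"
    proof (rule commutator_subgroup_subset)
      fix y d assume "y \<in> lower_central G ?D j" "d \<in> ?D"
      moreover have "lower_central G ?D j \<subseteq> H (Suc ?i)" using Suc i(2) by simp
      ultimately show "y \<otimes> d \<otimes> inv y \<otimes> inv d \<in> H ?i" using step[OF i(1)] by blast
    qed fact
    then show ?case by simp
  qed
  from this[of n] have "lower_central G ?D n \<subseteq> {\<one>}" using H(1) by simp
  moreover have "\<one> \<in> lower_central G ?D n"
    using subgroup.one_closed[OF normal_imp_subgroup[OF lower_central_normal[OF derived_self_is_normal]]] .
  ultimately show ?thesis by blast
qed

text \<open>If the normal subgroup \<open>[X, N]\<close> were equal to \<open>X\<close>, then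
  \<open>X\<close> would lie in all terms of the lower central series of
  \<open>N\<close>.\<close>

lemma nilpotent_centralizes_minimal_normal:
  assumes "X \<lhd> G" "N \<lhd> G" "lower_central G N n = {\<one>}"
    and min: "\<And>Y. Y \<lhd> G \<Longrightarrow> Y \<subseteq> X \<Longrightarrow> Y = {\<one>} \<or> Y = X"
    and "x \<in> X" "y \<in> N"
  shows "x \<otimes> y = y \<otimes> x"
proof -
  let ?C = "commutator_subgroup G X N"
  have sub: "X \<subseteq> carrier G" "N \<subseteq> carrier G" using assms(1,2) normal_in_carrier by blast+
  have xc: "x \<in> carrier G" "y \<in> carrier G" using assms(5,6) sub by auto
  have C: "?C \<subseteq> X" using commutator_subgroup_le_left[OF assms(1) sub(2)] .
  have "?C = {\<one>}"
  proof (cases "?C = X")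
    case True
    have "X \<subseteq> lower_central G N m" for m
    proof (induction m)
      case 0
      have "commutator_subgroup G X N \<subseteq> N"
      proof (rule commutator_subgroup_subset)
        show "subgroup N G" using assms(2) by (rule normal_imp_subgroup)
        fix u v assume "u \<in> X" "v \<in> N"
        then show "u \<otimes> v \<otimes> inv u \<otimes> inv v \<in> N"
          using sub normal_conj[OF assms(2), of u v] normal_imp_subgroup[OF assms(2)]
          by (intro subgroup.m_closed[of N G "u \<otimes> v \<otimes> inv u"] subgroup.m_inv_closed) auto
      qed
      then show ?case using True by simp
    next
      case (Suc m)
      then show ?case using commutator_subgroup_mono[OF Suc order_refl, of N] True by simp
    qed
    from this[of n] C show ?thesis using assms(3) True
      subgroup.one_closed[OF normal_imp_subgroup[OF assms(1)]] by auto
  next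
    case False
    then show ?thesis using min[OF commutator_subgroup_normal[OF assms(1,2)] C] by blast
  qed
  then have "x \<otimes> y \<otimes> inv x \<otimes> inv y = \<one>" using commutator_mem[OF assms(5,6)] by blast
  then have "x \<otimes> y \<otimes> inv x = y" using xc inv_solve_right'[of \<one> "x \<otimes> y \<otimes> inv x" y] by simp
  then show ?thesis using xc inv_solve_right'[of y "x \<otimes> y" x] by simp
qed

end

section \<open>Eigenvectors in elementary abelian groups\<close>

text \<open>Multiplication by a primitive root \<open>g\<close> permutes the nonzero residues,
  but it multiplies the sum by \<open>g ^ k\<close>, which is not 1 modulo
  \<open>p\<close>.\<close>

lemma power_sum_cong_0:
  fixes p k :: nat
  assumes "prime p" "0 < k" "k < p - 1"
  shows "[(\<Sum>l\<in>{1..<p}. l ^ k) = 0] (mod p)"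
proof -
  have p1: "p > 1" using assms(1) prime_gt_1_nat by blast
  obtain g where "g \<in> totatives p" and o: "Pocklington.ord p g = p - 1"
    using residue_prime_has_primroot assms(1) by blast
  then have cop: "coprime p g" by (simp add: totatives_def coprime_commute)
  have ne: "\<not> [g ^ k = 1] (mod p)"
    using ord_divides[of g k p] o assms(2,3) nat_dvd_not_less by simp
  let ?S = "\<Sum>l\<in>{1..<p}. l ^ k"
  let ?f = "\<lambda>l. g * l mod p"
  have inj: "inj_on ?f {1..<p}"
  proof (rule inj_onI)
    fix x y assume "x \<in> {1..<p}" "y \<in> {1..<p}" "g * x mod p = g * y mod p"
    then have "[g * x = g * y] (mod p)" by (simp add: cong_def)
    then have "[x = y] (mod p)" using cop cong_mult_lcancel_nat[of g p x y] by (simp add: coprime_commute)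
    then show "x = y" using \<open>x \<in> _\<close> \<open>y \<in> _\<close> by (simp add: cong_def)
  qed
  have "?f ` {1..<p} \<subseteq> {1..<p}"
  proof
    fix y assume "y \<in> ?f ` {1..<p}"
    then obtain l where l: "l \<in> {1..<p}" "y = g * l mod p" by blast
    have "\<not> p dvd g" using cop assms(1) p1 by (metis coprime_absorb_left nat_dvd_1_iff_1 less_irrefl)
    moreover have "\<not> p dvd l" using l(1) by (auto dest: dvd_imp_le)
    ultimately have "\<not> p dvd g * l" using assms(1) prime_dvd_mult_iff by blast
    then show "y \<in> {1..<p}" using l(2) p1 by (simp add: dvd_eq_mod_eq_0)
  qed
  then have im: "?f ` {1..<p} = {1..<p}" using inj by (simp add: endo_inj_surj)
  have "?S = (\<Sum>l\<in>{1..<p}. (?f l) ^ k)"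
    using sum.reindex[OF inj, of "\<lambda>l. l ^ k"] unfolding im by simp
  moreover have "[(\<Sum>l\<in>{1..<p}. (?f l) ^ k) = (\<Sum>l\<in>{1..<p}. g ^ k * l ^ k)] (mod p)"
  proof (rule cong_sum)
    fix l
    have "[(g * l mod p) ^ k = (g * l) ^ k] (mod p)" by (intro cong_pow) (simp add: cong_def)
    then show "[(g * l mod p) ^ k = g ^ k * l ^ k] (mod p)" by (simp add: power_mult_distrib)
  qed
  ultimately have "[?S = (\<Sum>l\<in>{1..<p}. g ^ k * l ^ k)] (mod p)" by (simp only:)
  then have "[g ^ k * ?S = 1 * ?S] (mod p)" by (simp only: sum_distrib_left cong_sym_eq mult_1)
  then have "\<not> coprime ?S p" using ne cong_mult_rcancel_nat[of ?S p "g ^ k" 1] by blast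
  then have "p dvd ?S" using assms(1) prime_imp_coprime[of p ?S] by (auto simp: coprime_commute)
  then show ?thesis by (simp add: cong_0_iff)
qed

lemma power_sum_cong_last:
  fixes p :: nat
  assumes "prime p"
  shows "[(\<Sum>l\<in>{1..<p}. l ^ (p - 1)) = p - 1] (mod p)"
proof -
  have "[(\<Sum>l\<in>{1..<p}. l ^ (p - 1)) = (\<Sum>l\<in>{1..<p}. 1)] (mod p)"
  proof (rule cong_sum)
    fix l assume "l \<in> {1..<p}"
    then have "\<not> p dvd l" by (auto dest: dvd_imp_le)
    then show "[l ^ (p - 1) = 1] (mod p)" by (rule fermat_theorem[OF assms])
  qed
  then show ?thesis by simp
qed

lemma (in group) pow_cong:
  assumes "w \<in> carrier G" "w [^] (p::nat) = \<one>" "[a = b] (mod p)"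
  shows "w [^] (a::nat) = w [^] b"
proof -
  have "w [^] a = w [^] (a mod p)" for a
  proof -
    have "w [^] a = w [^] (p * (a div p) + a mod p)" by simp
    also have "\<dots> = w [^] (p * (a div p)) \<otimes> w [^] (a mod p)"
      using assms(1) by (simp only: nat_pow_mult)
    also have "w [^] (p * (a div p)) = \<one>"
      using assms(1,2) by (simp only: nat_pow_pow[symmetric] nat_pow_one)
    finally show ?thesis using assms(1) by simp
  qed
  then show ?thesis using assms(3) unfolding cong_def by metis
qed

lemma (in comm_group) finprod_pow_sum:
  assumes "finite L" "u \<in> carrier G"
  shows "(\<Otimes>l\<in>L. u [^] (e l :: nat)) = u [^] (\<Sum>l\<in>L. e l)"
  using assms by (induction rule: finite_induct) (simp_all add: nat_pow_mult)

lemma (in comm_group) finprod_pow_swap: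
  assumes "finite L" "\<And>i. u i \<in> carrier G"
  shows "(\<Otimes>l\<in>L. \<Otimes>i\<in>{..<n::nat}. u i [^] (e l i :: nat)) = (\<Otimes>i\<in>{..<n}. u i [^] (\<Sum>l\<in>L. e l i))"
proof (induction n)
  case (Suc n)
  have "(\<Otimes>l\<in>L. \<Otimes>i\<in>{..<Suc n}. u i [^] e l i) =
      (\<Otimes>l\<in>L. u n [^] e l n \<otimes> (\<Otimes>i\<in>{..<n}. u i [^] e l i))"
    using assms by (intro finprod_cong') (simp_all add: lessThan_Suc)
  also have "\<dots> = (\<Otimes>l\<in>L. u n [^] e l n) \<otimes> (\<Otimes>l\<in>L. \<Otimes>i\<in>{..<n}. u i [^] e l i)"
    using assms by (intro finprod_multf) simp_all
  also have "\<dots> = (\<Otimes>i\<in>{..<Suc n}. u i [^] (\<Sum>l\<in>L. e l i))"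
    using Suc assms by (simp add: finprod_pow_sum lessThan_Suc)
  finally show ?case .
qed simp

text \<open>The eigencomponents \<open>w l\<close> of \<open>v\<close> for the possible
  eigenvalues \<open>l = 1, \<dots>, p - 1\<close>, formed as in a discrete Fourier transform
  over the field with \<open>p\<close> elements, multiply up to the inverse of \<open>v\<close>;
  so one of them is nontrivial.\<close>

lemma (in comm_group) endomorphism_eigenvector:
  assumes p: "prime p" and exp: "\<And>w. w \<in> carrier G \<Longrightarrow> w [^] p = \<one>"
    and f: "f \<in> hom G G" and v: "v \<in> carrier G" "v \<noteq> \<one>" "(f ^^ (p - 1)) v = v"
  obtains l w where "w \<in> carrier G" "w \<noteq> \<one>" "f w = w [^] (l::nat)"
proof -
  interpret f: group_hom G G f
    using f by (simp add: group_hom_def group_hom_axioms_def is_group)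
  define m where "m = p - 1"
  have p1: "p > 1" using p prime_gt_1_nat by blast
  then have m: "m > 0" "p = Suc m" unfolding m_def by auto
  define u where "u i = (f ^^ i) v" for i
  have u: "u i \<in> carrier G" for i unfolding u_def using v(1) by (induction i) auto
  have um: "u m = v" "u 0 = v" using v(3) unfolding u_def m_def by simp_all
  define w where "w l = (\<Otimes>i\<in>{..<m}. u i [^] (l ^ (m - i)))" for l :: nat
  have wc: "w l \<in> carrier G" for l unfolding w_def using u by simp
  have eigen: "f (w l) = w l [^] l" for l
  proof -
    define t where "t i = u i [^] (l ^ (Suc m - i))" for i
    have t: "t i \<in> carrier G" for i unfolding t_def using u by simp
    \<comment> \<open>Applying \<open>f\<close> shifts the index: the factor \<open>t
      n\<close> is gained at one end and \<open>t 0\<close> is lost at the other. For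
      \<open>n = m\<close> these two agree.\<close>
    have "f (\<Otimes>i\<in>{..<n}. u i [^] (l ^ (m - i))) \<otimes> t 0 = (\<Otimes>i\<in>{..<n}. t i) \<otimes> t n" for n
    proof (induction n)
      case (Suc n)
      have "f (u n [^] (l ^ (m - n))) = t (Suc n)"
        unfolding t_def using u by (simp add: f.hom_nat_pow u_def)
      then have "f (\<Otimes>i\<in>{..<Suc n}. u i [^] (l ^ (m - i))) \<otimes> t 0 =
          t (Suc n) \<otimes> (f (\<Otimes>i\<in>{..<n}. u i [^] (l ^ (m - i))) \<otimes> t 0)"
        using u t by (simp add: lessThan_Suc m_assoc)
      also have "\<dots> = (\<Otimes>i\<in>{..<Suc n}. t i) \<otimes> t (Suc n)"
        unfolding Suc using t by (simp add: lessThan_Suc m_ac)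
      finally show ?case .
    qed (use t in simp)
    from this[of m] have "f (w l) \<otimes> t 0 = (\<Otimes>i\<in>{..<m}. t i) \<otimes> t m" unfolding w_def .
    moreover have "t m = t 0"
    proof -
      have "[l ^ 1 = l ^ p] (mod p)"
      proof (cases "p dvd l")
        case True
        moreover have "p dvd l ^ p" using dvd_power_le[OF True, of 1 p] p1 by simp
        ultimately have "[l = 0] (mod p)" "[l ^ p = 0] (mod p)" by (simp_all only: cong_0_iff)
        then show ?thesis by (simp add: cong_def)
      next
        case False
        from cong_scalar_left[OF fermat_theorem[OF p False], of l]
        show ?thesis using m by (simp add: cong_sym)
      qed
      then show ?thesis using pow_cong[OF v(1) exp[OF v(1)]] um m(2) unfolding t_def by simp
    qed
    ultimately have "f (w l) = (\<Otimes>i\<in>{..<m}. t i)" using t wc by simp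
    also have "\<dots> = (\<Otimes>i\<in>{..<m}. (u i [^] (l ^ (m - i))) [^] l)"
      using u unfolding t_def by (intro finprod_cong') (auto simp: nat_pow_pow Suc_diff_le mult.commute)
    also have "\<dots> = w l [^] l"
    proof -
      have "(\<Otimes>i\<in>{..<n}. (u i [^] (l ^ (m - i))) [^] l) = (\<Otimes>i\<in>{..<n}. u i [^] (l ^ (m - i))) [^] l" for n
        by (induction n) (use u in \<open>simp_all add: lessThan_Suc nat_pow_distrib\<close>)
      then show ?thesis unfolding w_def .
    qed
    finally show ?thesis .
  qed
  have "\<exists>l. w l \<noteq> \<one>"
  proof (rule ccontr)
    assume "\<not> (\<exists>l. w l \<noteq> \<one>)"
    then have "(\<Otimes>l\<in>{1..<p}. w l) = \<one>" by (intro finprod_one_eqI) simp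
    then have "(\<Otimes>i\<in>{..<m}. u i [^] (\<Sum>l\<in>{1..<p}. l ^ (m - i))) = \<one>"
      unfolding w_def using finprod_pow_swap[of "{1..<p}" u "\<lambda>l i. l ^ (m - i)" m] u by simp
    moreover have "{..<m} = insert 0 {1..<m}" using m(1) by auto
    moreover have "(\<Otimes>i\<in>{1..<m}. u i [^] (\<Sum>l\<in>{1..<p}. l ^ (m - i))) = \<one>"
    proof (rule finprod_one_eqI)
      fix i assume "i \<in> {1..<m}"
      then have "[(\<Sum>l\<in>{1..<p}. l ^ (m - i)) = 0] (mod p)"
        using p by (intro power_sum_cong_0) (auto simp: m_def)
      then show "u i [^] (\<Sum>l\<in>{1..<p}. l ^ (m - i)) = \<one>"
        using pow_cong[OF u exp[OF u]] by (metis nat_pow_0)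
    qed
    ultimately have "v [^] (\<Sum>l\<in>{1..<p}. l ^ m) = \<one>"
      using u v(1) um by (simp del: One_nat_def)
    then have "v [^] (p - 1) = \<one>"
      using pow_cong[OF v(1) exp[OF v(1)] power_sum_cong_last[OF p]] unfolding m_def by simp
    then have "v [^] p = v" using v(1) m by simp
    then show False using exp[OF v(1)] v(2) by simp
  qed
  then show thesis using that wc eigen by blast
qed

section \<open>Actions of elements of prime power order\<close>

context group
begin

lemma set_normalizer_subgroup:
  assumes "S \<subseteq> carrier G"
  shows "subgroup {g \<in> carrier G. \<forall>s\<in>S. g \<otimes> s \<otimes> inv g \<in> S \<and> inv g \<otimes> s \<otimes> g \<in> S} G"
proof (rule subgroupI)
  fix a b
  assume "a \<in> {g \<in> carrier G. \<forall>s\<in>S. g \<otimes> s \<otimes> inv g \<in> S \<and> inv g \<otimes> s \<otimes> g \<in> S}"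
    "b \<in> {g \<in> carrier G. \<forall>s\<in>S. g \<otimes> s \<otimes> inv g \<in> S \<and> inv g \<otimes> s \<otimes> g \<in> S}"
  then have a: "a \<in> carrier G" "\<And>s. s \<in> S \<Longrightarrow> a \<otimes> s \<otimes> inv a \<in> S \<and> inv a \<otimes> s \<otimes> a \<in> S"
    and b: "b \<in> carrier G" "\<And>s. s \<in> S \<Longrightarrow> b \<otimes> s \<otimes> inv b \<in> S \<and> inv b \<otimes> s \<otimes> b \<in> S" by auto
  have "a \<otimes> b \<otimes> s \<otimes> inv (a \<otimes> b) \<in> S \<and> inv (a \<otimes> b) \<otimes> s \<otimes> (a \<otimes> b) \<in> S" if s: "s \<in> S" for s
  proof -
    have sc: "s \<in> carrier G" using s assms by blast
    have "a \<otimes> (b \<otimes> s \<otimes> inv b) \<otimes> inv a \<in> S" "inv b \<otimes> (inv a \<otimes> s \<otimes> a) \<otimes> b \<in> S"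
      using a(2) b(2) s by blast+
    then show ?thesis using a(1) b(1) sc by (simp add: word_simps)
  qed
  then show "a \<otimes> b \<in> {g \<in> carrier G. \<forall>s\<in>S. g \<otimes> s \<otimes> inv g \<in> S \<and> inv g \<otimes> s \<otimes> g \<in> S}"
    using a(1) b(1) by simp
qed (use assms in \<open>auto simp: subset_iff intro!: exI[of _ \<one>]\<close>)

lemma in_set_normalizer:
  assumes "finite S" "S \<subseteq> carrier G" "g \<in> carrier G" "\<And>s. s \<in> S \<Longrightarrow> g \<otimes> s \<otimes> inv g \<in> S"
  shows "g \<in> {g \<in> carrier G. \<forall>s\<in>S. g \<otimes> s \<otimes> inv g \<in> S \<and> inv g \<otimes> s \<otimes> g \<in> S}"
proof -
  have "inj_on (\<lambda>s. g \<otimes> s \<otimes> inv g) S"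
    using assms(2,3) by (intro inj_onI) (auto simp: subset_iff)
  then have im: "(\<lambda>s. g \<otimes> s \<otimes> inv g) ` S = S"
    using assms(1,4) by (intro endo_inj_surj) auto
  have "inv g \<otimes> s \<otimes> g \<in> S" if s: "s \<in> S" for s
  proof -
    obtain r where r: "r \<in> S" "s = g \<otimes> r \<otimes> inv g" using im s by blast
    then have "inv g \<otimes> s \<otimes> g = r" using assms(2,3) by (auto simp: word_simps subset_iff)
    then show ?thesis using r(1) by simp
  qed
  then show ?thesis using assms(3,4) by simp
qed

text \<open>The orbits on \<open>S\<close> of the \<open>q\<close>-group generated by
  \<open>b\<close> have lengths that are powers of \<open>q\<close>, and they cannot all be
  nontrivial.\<close>

lemma q_element_fixed_point:
  assumes "finite (carrier G)" "prime q" "b \<in> carrier G" "b [^] (q ^ k :: nat) = \<one>"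
    and "S \<subseteq> carrier G" "\<And>s. s \<in> S \<Longrightarrow> b \<otimes> s \<otimes> inv b \<in> S" "\<not> q dvd card S"
  obtains c where "c \<in> S" "b \<otimes> c = c \<otimes> b"
proof -
  let ?W = "generate G {b}"
  let ?N = "{g \<in> carrier G. \<forall>s\<in>S. g \<otimes> s \<otimes> inv g \<in> S \<and> inv g \<otimes> s \<otimes> g \<in> S}"
  have fS: "finite S" using assms(1,5) finite_subset by blast
  have "b \<in> ?N" using in_set_normalizer[OF fS assms(5,3,6)] .
  then have WN: "?W \<subseteq> ?N" using set_normalizer_subgroup[OF assms(5)] by (intro generate_subgroup_incl) auto
  have sW: "subgroup ?W G" using assms(3) generate_is_subgroup by simp
  interpret W: group "G\<lparr>carrier := ?W\<rparr>" using sW by (rule subgroup_imp_group)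
  have Wc: "u \<in> carrier G" if "u \<in> ?W" for u using that subgroup.subset[OF sW] by blast
  have Sc: "u \<in> carrier G" if "u \<in> S" for u using that assms(5) by blast
  obtain i where i: "card ?W = q ^ i" using p_element_subgroup_order assms(1-4) by blast
  have cj: "g \<otimes> (y \<otimes> inv g) \<in> S" if "g \<in> ?W" "y \<in> S" for g y
    using subsetD[OF WN that(1)] that(2) Wc[OF that(1)] Sc[OF that(2)] by (simp flip: m_assoc)
  let ?F = "{x \<in> S. \<forall>g\<in>carrier (G\<lparr>carrier := ?W\<rparr>). g \<otimes> x \<otimes> inv g = x}"
  have "[card S = card ?F] (mod q)"
    by (rule W.p_group_fixed_points_cong[where k = i])
      (use assms(2) i in \<open>auto simp: order_def fS Sc Wc cj word_simps\<close>)
  then have "card ?F \<noteq> 0" using assms(7) by (metis cong_0_iff)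
  then have "?F \<noteq> {}" by (metis card.empty)
  moreover have "b \<in> ?W" by (simp add: generate.incl)
  ultimately obtain c where c: "c \<in> S" "b \<otimes> c \<otimes> inv b = c" by auto
  then have "b \<otimes> c = c \<otimes> b" using assms(3) Sc inv_solve_right'[of c "b \<otimes> c" b] by auto
  with c(1) show thesis using that by blast
qed

text \<open>\<open>M\<close> acts on its own cosets and fixes \<open>M\<close>. The number of
  fixed cosets is divisible by \<open>p\<close>, so there is another one, and its
  representatives normalize \<open>M\<close>.\<close>

lemma maximal_subgroup_of_p_group:
  assumes "prime p" "order G = p ^ k" "maximal_subgroup G M"
  shows "M \<lhd> G" "card (carrier G) = p * card M"
proof -
  have fin: "finite (carrier G)"
    using assms(1,2) order_gt_0_iff_finite prime_gt_0_nat by (metis zero_less_power)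
  have sM: "subgroup M G" and Mne: "M \<noteq> carrier G"
    and max: "\<And>K. subgroup K G \<Longrightarrow> M \<subseteq> K \<Longrightarrow> K = M \<or> K = carrier G"
    using assms(3) unfolding maximal_subgroup_def by auto
  have Msub: "M \<subseteq> carrier G" using subgroup.subset[OF sM] .
  have fM: "finite M" using Msub fin finite_subset by blast
  have Mc: "u \<in> carrier G" if "u \<in> M" for u using that Msub by blast
  have L: "card (rcosets M) * card M = p ^ k" using lagrange[OF sM] assms(2) by simp
  have "card (rcosets M) dvd p ^ k" using L by (metis dvd_triv_left)
  then obtain j where j: "card (rcosets M) = p ^ j" using assms(1) by (auto simp: divides_primepow_nat)
  have "card M \<noteq> card (carrier G)" using Mne Msub fin card_subset_eq by blast
  then have "j \<noteq> 0" using L j assms(2) by (intro notI) (simp add: order_def)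
  then have pd: "p dvd card (rcosets M)" using j by (cases j) auto
  have "card M dvd p ^ k" using L by (metis dvd_triv_right)
  then obtain i where i: "card M = p ^ i" using assms(1) by (auto simp: divides_primepow_nat)
  let ?F = "{C \<in> rcosets M. \<forall>u\<in>M. C #> inv u = C}"
  from cong_dvd_iff[OF card_fixed_cosets_cong[OF fin assms(1) sM sM i]]
  have pF: "p dvd card ?F" using pd by blast
  have "M \<in> rcosets M" using subgroup.subgroup_in_rcosets[OF sM is_group] .
  moreover have "M #> inv u = M" if "u \<in> M" for u
    using subgroup.rcos_const[OF sM is_group] subgroup.m_inv_closed[OF sM that] by blast
  ultimately have MF: "M \<in> ?F" by simp
  have "?F \<noteq> {M}"
  proof
    assume "?F = {M}"
    then have "card ?F = 1" by simp
    then show False using pF assms(1) by (simp add: not_prime_unit)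
  qed
  then obtain C where "C \<in> ?F" "C \<noteq> M" using MF by blast
  then have C: "C \<in> rcosets M" "C \<noteq> M" "\<And>u. u \<in> M \<Longrightarrow> C #> inv u = C" by simp_all
  obtain a where a: "a \<in> carrier G" "C = M #> a" using C(1) by (auto simp: RCOSETS_def)
  have aM: "a \<notin> M" using a C(2) subgroup.rcos_const[OF sM is_group] by blast
  have "a \<otimes> u \<otimes> inv a \<in> M" if "u \<in> M" for u
    using conj_mem_of_fixed_coset[OF sM sM a(1) _ that] C(3) unfolding a(2) by blast
  let ?N = "{g \<in> carrier G. \<forall>s\<in>M. g \<otimes> s \<otimes> inv g \<in> M \<and> inv g \<otimes> s \<otimes> g \<in> M}"
  have "a \<in> ?N" using in_set_normalizer[OF fM Msub a(1)] \<open>\<And>u. u \<in> M \<Longrightarrow> a \<otimes> u \<otimes> inv a \<in> M\<close> .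
  moreover have "M \<subseteq> ?N"
    using Mc by (auto intro!: subgroup.m_closed[OF sM] subgroup.m_inv_closed[OF sM])
  ultimately have "?N = carrier G" using max[OF set_normalizer_subgroup[OF Msub]] aM by blast
  then show N: "M \<lhd> G" using sM by (intro normal_invI) blast+
  interpret N: normal M G by fact
  interpret Q: group "G Mod M" by (rule N.factorgroup_is_group)
  have fQ: "finite (carrier (G Mod M))" using N.finite_quotient[OF fin] .
  have "p dvd order (G Mod M)" using pd by (simp add: order_def FactGroup_def)
  then obtain x where x: "x \<in> carrier (G Mod M)" "x \<noteq> \<one>\<^bsub>G Mod M\<^esub>" "x [^]\<^bsub>G Mod M\<^esub> p = \<one>\<^bsub>G Mod M\<^esub>"
    using Q.Cauchy[OF fQ assms(1)] by blast
  let ?X = "generate (G Mod M) {x}"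
  have sX: "subgroup ?X (G Mod M)" using x(1) Q.generate_is_subgroup by simp
  have cX: "card ?X = p" using Q.card_generate_prime[OF x(1,2) assms(1) x(3)] .
  note U = N.union_of_quotient_subgroup[OF fin sX]
  have "card M > 0" using i assms(1) prime_gt_0_nat by simp
  then have "\<Union>?X \<noteq> M" using U(2) cX prime_gt_1_nat[OF assms(1)] by (intro notI) simp
  then have "\<Union>?X = carrier G" using max[OF N.factgroup_subgroup_union_subgroup[OF sX] U(1)] by blast
  then show "card (carrier G) = p * card M" using U(2) cX by simp
qed

end

section \<open>Homomorphic images of weak normal products\<close>

lemma (in group) Sylow_subgroup_exists:
  assumes "finite (carrier G)" "prime p"
  obtains P where "sylow_subgroup p G P"
proof -
  obtain m where "order G = p ^ multiplicity p (order G) * m"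
    using multiplicity_dvd[of p "order G"] by blast
  then show thesis
    using sylow_thm[OF assms(2) is_group _ assms(1)] that assms(2) unfolding sylow_subgroup_def by blast
qed

lemma (in group) conj_hom: "g \<in> carrier G \<Longrightarrow> group_hom G G (\<lambda>x. inv g \<otimes> x \<otimes> g)"
  by (auto simp: group_hom_def group_hom_axioms_def is_group word_simps intro!: homI)

text \<open>The image of a Sylow subgroup \<open>P\<close> of \<open>G\<close> has index prime
  to \<open>p\<close>, so it contains a conjugate of \<open>Q\<close>, and it is equal to this
  conjugate by its order. Hence \<open>Q\<close> is the image of a conjugate of
  \<open>P\<close>.\<close>

lemma (in group_hom) Sylow_subgroup_lift:
  assumes "finite (carrier G)" "h ` carrier G = carrier H" "sylow_subgroup p H Q"
  obtains P where "sylow_subgroup p G P" "h ` P = Q"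
proof -
  have p: "prime p" and sQ: "subgroup Q H" and cQ: "card Q = p ^ multiplicity p (order H)"
    using assms(3) unfolding sylow_subgroup_def by auto
  have fH: "finite (carrier H)" using assms(1,2) by (metis finite_imageI)
  obtain P where P: "subgroup P G" "card P = p ^ multiplicity p (order G)"
    using G.Sylow_subgroup_exists[OF assms(1) p] unfolding sylow_subgroup_def by blast
  have shP: "subgroup (h ` P) H" using subgroup_img_is_subgroup P(1) .
  have "\<not> p dvd card (rcosets\<^bsub>H\<^esub> (h ` P))"
    using image_index_coprime[OF assms(1) P(1) G.Sylow_index_coprime[OF assms(1) p P] assms(2)] .
  then obtain g where g: "g \<in> carrier H" "\<And>u. u \<in> Q \<Longrightarrow> g \<otimes>\<^bsub>H\<^esub> u \<otimes>\<^bsub>H\<^esub> inv\<^bsub>H\<^esub> g \<in> h ` P"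
    using H.p_subgroup_into_conjugate[OF fH p shP _ sQ cQ] by blast
  obtain a where a: "a \<in> carrier G" "g = h a" using g(1) assms(2) by auto
  have Pc: "x \<in> carrier G" if "x \<in> P" for x using that subgroup.subset[OF P(1)] by blast
  have Qc: "x \<in> carrier H" if "x \<in> Q" for x using that subgroup.subset[OF sQ] by blast
  have fP: "finite P" using assms(1) subgroup.subset[OF P(1)] finite_subset by blast
  let ?c = "\<lambda>x. inv a \<otimes> x \<otimes> a"
  have "subgroup (?c ` P) G"
    using group_hom.subgroup_img_is_subgroup[OF G.conj_hom[OF a(1)] P(1)] .
  moreover have "inj_on ?c P" using a(1) by (intro inj_onI) (simp add: Pc)
  then have "card (?c ` P) = card P" by (rule card_image)
  ultimately have "sylow_subgroup p G (?c ` P)" using P(2) p unfolding sylow_subgroup_def by simp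
  moreover have "h ` ?c ` P = Q"
  proof (rule card_seteq[symmetric])
    show "finite (h ` ?c ` P)" using fP by simp
    show "Q \<subseteq> h ` ?c ` P"
    proof
      fix u assume u: "u \<in> Q"
      obtain x where x: "x \<in> P" "h a \<otimes>\<^bsub>H\<^esub> u \<otimes>\<^bsub>H\<^esub> inv\<^bsub>H\<^esub> h a = h x" using g(2)[OF u] a(2) by auto
      have "h (?c x) = inv\<^bsub>H\<^esub> h a \<otimes>\<^bsub>H\<^esub> h x \<otimes>\<^bsub>H\<^esub> h a" using x(1) a(1) Pc by simp
      also have "\<dots> = u" unfolding x(2)[symmetric] using a(1) Qc[OF u] by (simp add: H.word_simps)
      finally have "u = h (?c x)" ..
      then show "u \<in> h ` ?c ` P" using x(1) by blast
    qed
    have "h ` ?c ` P = (\<lambda>y. inv\<^bsub>H\<^esub> h a \<otimes>\<^bsub>H\<^esub> y \<otimes>\<^bsub>H\<^esub> h a) ` h ` P"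
      using a(1) Pc by (simp add: image_image)
    then have "card (h ` ?c ` P) \<le> card (h ` P)" using card_image_le fP by (metis finite_imageI)
    also have "card (h ` P) \<le> card Q"
    proof -
      interpret P: group_hom "G\<lparr>carrier := P\<rparr>" H h using P(1) by (rule induced_group_hom')
      have "card (h ` P) dvd p ^ multiplicity p (order G)"
        using P.card_image_kernel P(2) by (simp add: order_def)
      then obtain i where i: "card (h ` P) = p ^ i" using p by (auto simp: divides_primepow_nat)
      have "p ^ i dvd order H" using H.subgroup_card_dvd[OF shP] i by simp
      moreover have "order H \<noteq> 0" using fH H.order_gt_0_iff_finite by simp
      ultimately have "i \<le> multiplicity p (order H)"
        using multiplicity_geI[of "order H" p i] p prime_gt_1_nat[OF p] by simp
      then show ?thesis unfolding i cQ using prime_gt_1_nat[OF p] by (intro power_increasing) simp_all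
    qed
    finally show "card (h ` ?c ` P) \<le> card Q" .
  qed
  ultimately show thesis using that by blast
qed

lemma (in group_hom) maximal_subgroup_preimage:
  assumes "h ` carrier G = carrier H" "maximal_subgroup H M"
  shows "maximal_subgroup G {x \<in> carrier G. h x \<in> M}" "h ` {x \<in> carrier G. h x \<in> M} = M"
proof -
  let ?M = "{x \<in> carrier G. h x \<in> M}"
  have sM: "subgroup M H" and Mne: "M \<noteq> carrier H"
    and max: "\<And>K. subgroup K H \<Longrightarrow> M \<subseteq> K \<Longrightarrow> K = M \<or> K = carrier H"
    using assms(2) unfolding maximal_subgroup_def by auto
  have Msub: "M \<subseteq> carrier H" using subgroup.subset[OF sM] .
  show im: "h ` ?M = M"
  proof
    show "M \<subseteq> h ` ?M"
    proof
      fix y assume y: "y \<in> M"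
      then obtain x where "x \<in> carrier G" "y = h x" using Msub assms(1) by blast
      with y show "y \<in> h ` ?M" by blast
    qed
  qed blast
  have "subgroup ?M G"
    using subgroup.one_closed[OF sM] subgroup.m_closed[OF sM] subgroup.m_inv_closed[OF sM]
    by (intro G.subgroupI) auto
  moreover have "?M \<noteq> carrier G" using im Mne assms(1) by metis
  moreover have "K = ?M \<or> K = carrier G" if K: "subgroup K G" "?M \<subseteq> K" for K
  proof -
    have Kc: "K \<subseteq> carrier G" using subgroup.subset[OF K(1)] .
    have "M \<subseteq> h ` K" using im K(2) by blast
    then consider "h ` K = M" | "h ` K = carrier H" using max[OF subgroup_img_is_subgroup[OF K(1)]] by blast
    then show ?thesis
    proof cases
      case 1
      then have "K \<subseteq> ?M" using Kc by blast
      then show ?thesis using K(2) by blast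
    next
      case 2
      have "x \<in> K" if x: "x \<in> carrier G" for x
      proof -
        have "h x \<in> h ` K" using 2 x by simp
        then obtain k where k: "k \<in> K" "h x = h k" by blast
        then have kc: "k \<in> carrier G" using Kc by blast
        have "h (x \<otimes> inv k) = \<one>\<^bsub>H\<^esub>" using k(2) x kc by simp
        then have "x \<otimes> inv k \<in> ?M" using x kc subgroup.one_closed[OF sM] by simp
        then have "x \<otimes> inv k \<otimes> k \<in> K" using K(2) k(1) subgroup.m_closed[OF K(1)] by blast
        then show ?thesis using x kc by (simp add: G.m_assoc)
      qed
      then show ?thesis using Kc by blast
    qed
  qed
  ultimately show "maximal_subgroup G ?M" unfolding maximal_subgroup_def by blast
qed

text \<open>A maximal subgroup \<open>M\<close> of a Sylow subgroup of the image of
  \<open>A\<close> is the image of a maximal subgroup of a Sylow subgroup \<open>P\<close> of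
  \<open>A\<close>, namely of its preimage in \<open>P\<close>.\<close>

lemma (in group_hom) weak_normal_product_image:
  assumes "finite (carrier G)" "h ` carrier G = carrier H" "weak_normal_product G A B"
  shows "weak_normal_product H (h ` A) (h ` B)"
proof -
  have sA: "subgroup A G" and sB: "subgroup B G" and AB: "carrier G = A <#>\<^bsub>G\<^esub> B" and nA: "A \<lhd> G"
    and perm: "\<And>p P M. sylow_subgroup p (G\<lparr>carrier := A\<rparr>) P \<Longrightarrow>
      maximal_subgroup (G\<lparr>carrier := P\<rparr>) M \<Longrightarrow> permuting G B M"
    using assms(3) unfolding weak_normal_product_def by blast+
  have Ac: "A \<subseteq> carrier G" and Bc: "B \<subseteq> carrier G"
    using subgroup.subset[OF sA] subgroup.subset[OF sB] .
  have "permuting H (h ` B) M"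
    if Q: "sylow_subgroup p (H\<lparr>carrier := h ` A\<rparr>) Q" and M: "maximal_subgroup (H\<lparr>carrier := Q\<rparr>) M" for p Q M
  proof -
    interpret A: group_hom "G\<lparr>carrier := A\<rparr>" "H\<lparr>carrier := h ` A\<rparr>" h using sA by (rule restrict_subgroups)
    have fA: "finite A" using assms(1) Ac finite_subset by blast
    obtain P where P: "sylow_subgroup p (G\<lparr>carrier := A\<rparr>) P" "h ` P = Q"
      using A.Sylow_subgroup_lift[OF _ _ Q] fA by auto
    have sP: "subgroup P G"
      using P(1) G.incl_subgroup[OF sA] unfolding sylow_subgroup_def by blast
    interpret P: group_hom "G\<lparr>carrier := P\<rparr>" "H\<lparr>carrier := Q\<rparr>" h
      using restrict_subgroups[OF sP] unfolding P(2) .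
    let ?M = "{x \<in> P. h x \<in> M}"
    have M': "maximal_subgroup (G\<lparr>carrier := P\<rparr>) ?M" "h ` ?M = M"
      using P.maximal_subgroup_preimage[OF _ M] P(2) by simp_all
    have "?M \<subseteq> carrier G" using subgroup.subset[OF sP] by blast
    then show ?thesis
      using perm[OF P(1) M'(1)] set_mult_hom[OF homh Bc, of ?M] set_mult_hom[OF homh _ Bc, of ?M] M'(2)
      unfolding permuting_def by simp
  qed
  moreover have "carrier H = h ` A <#>\<^bsub>H\<^esub> h ` B"
    using set_mult_hom[OF homh Ac Bc] AB assms(2) by simp
  moreover have "h ` A \<lhd> H"
    using normal.surj_hom_normal_subgroup[OF nA group_hom_axioms assms(2)] .
  ultimately show ?thesis
    using subgroup_img_is_subgroup[OF sA] subgroup_img_is_subgroup[OF sB]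
    unfolding weak_normal_product_def by blast
qed

context group
begin

text \<open>For the largest prime divisor \<open>p\<close> of the order of \<open>A\<close>, the
  Sylow \<open>p\<close>-subgroup is normal in \<open>A\<close>. So it consists of all
  \<open>p\<close>-elements of \<open>A\<close>, and this set is invariant under
  \<open>G\<close>.\<close>

lemma largest_prime_Sylow_normal:
  assumes "finite (carrier G)" "A \<lhd> G" "supersoluble (G\<lparr>carrier := A\<rparr>)" "A \<noteq> {\<one>}"
  obtains p P where "sylow_subgroup p (G\<lparr>carrier := A\<rparr>) P" "P \<lhd> G" "P \<noteq> {\<one>}"
proof -
  have sA: "subgroup A G" using assms(2) by (rule normal_imp_subgroup)
  have fA: "finite A" using assms(1) subgroup.subset[OF sA] finite_subset by blast
  interpret A: group "G\<lparr>carrier := A\<rparr>" using sA by (rule subgroup_imp_group)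
  have "card A \<noteq> 1" using assms(4) subgroup.one_closed[OF sA] by (metis card_1_singletonE singletonD)
  have "card A > 0" using fA subgroup.one_closed[OF sA] by (metis card_gt_0_iff empty_iff)
  define p where "p = Max {q. prime q \<and> q dvd card A}"
  have fin: "finite {q. prime q \<and> q dvd card A}"
    using \<open>card A > 0\<close> by (intro finite_subset[OF _ finite_atMost[of "card A"]]) (auto dest: dvd_imp_le)
  have "{q. prime q \<and> q dvd card A} \<noteq> {}" using \<open>card A \<noteq> 1\<close> prime_factor_nat by blast
  then have p: "prime p" "p dvd card A" using Max_in[OF fin] unfolding p_def by auto
  have pmax: "q \<le> p" if "prime q" "q dvd card A" for q unfolding p_def using that fin by simp
  obtain P where P: "sylow_subgroup p (G\<lparr>carrier := A\<rparr>) P"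
    using A.Sylow_subgroup_exists[of p] p(1) fA by auto
  then have sPA: "subgroup P (G\<lparr>carrier := A\<rparr>)" and cP: "card P = p ^ multiplicity p (card A)"
    unfolding sylow_subgroup_def by (simp_all add: order_def)
  have idx: "\<not> p dvd card (rcosets\<^bsub>G\<lparr>carrier := A\<rparr>\<^esub> P)"
    using A.Sylow_index_coprime[OF _ p(1) sPA] fA cP by (simp add: order_def)
  have PA: "P \<lhd> G\<lparr>carrier := A\<rparr>"
    by (rule A.supersoluble_Sylow_normal[OF _ assms(3) p(1) _ sPA cP idx])
      (use fA pmax in \<open>simp_all add: order_def\<close>)
  have sP: "subgroup P G" using incl_subgroup[OF sA sPA] .
  have PsubA: "P \<subseteq> A" using subgroup.subset[OF sPA] by simp
  have "P \<lhd> G"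
  proof (rule normal_invI[OF sP])
    fix g u assume g: "g \<in> carrier G" and u: "u \<in> P"
    have uc: "u \<in> carrier G" using u subgroup.subset[OF sP] by blast
    have "(g \<otimes> u \<otimes> inv g) [^] (p ^ multiplicity p (card A)) = \<one>"
      using conj_nat_pow[OF g uc] subgroup_pow_card[OF sP u] g cP by simp
    then show "g \<otimes> u \<otimes> inv g \<in> P"
      using A.p_element_in_normal_Sylow[OF _ p(1) PA idx] fA normal_conj[OF assms(2) g] u PsubA
      by (auto simp flip: nat_pow_consistent)
  qed
  moreover have "P \<noteq> {\<one>}"
  proof
    assume "P = {\<one>}"
    moreover have "multiplicity p (card A) \<ge> 1"
      using p \<open>card A > 0\<close> by (intro multiplicity_geI) auto
    then have "p dvd card P" unfolding cP by (simp add: dvd_power)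
    moreover have "\<not> p dvd 1" using p(1) by (metis not_prime_unit)
    ultimately show False by simp
  qed
  ultimately show thesis using that P by blast
qed

lemma minimal_normal_below:
  assumes "finite (carrier G)" "P \<lhd> G" "P \<noteq> {\<one>}"
  obtains X where "X \<lhd> G" "X \<subseteq> P" "X \<noteq> {\<one>}"
    "\<And>Y. Y \<lhd> G \<Longrightarrow> Y \<subseteq> X \<Longrightarrow> Y = {\<one>} \<or> Y = X"
proof -
  let ?Q = "\<lambda>X. X \<lhd> G \<and> X \<subseteq> P \<and> X \<noteq> {\<one>}"
  obtain X where X: "?Q X" "\<And>Y. ?Q Y \<Longrightarrow> card X \<le> card Y"
    using ex_has_least_nat[of ?Q P card] assms(2,3) by blast
  have fX: "finite X" using X(1) assms(1) normal_in_carrier by (meson finite_subset subsetI)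
  have "Y = {\<one>} \<or> Y = X" if Y: "Y \<lhd> G" "Y \<subseteq> X" for Y
  proof (rule disjCI)
    assume "Y \<noteq> X"
    then have "card Y < card X" using Y(2) fX by (simp add: psubset_card_mono psubsetI)
    then show "Y = {\<one>}" using X(2)[of Y] X(1) Y by fastforce
  qed
  with X(1) that show thesis by blast
qed

lemma maximal_subgroup_above:
  assumes "finite (carrier G)" "subgroup C G" "C \<noteq> carrier G"
  obtains M where "maximal_subgroup G M" "C \<subseteq> M"
proof -
  let ?Q = "\<lambda>M. subgroup M G \<and> C \<subseteq> M \<and> M \<noteq> carrier G"
  have "\<forall>M. ?Q M \<longrightarrow> card M < Suc (card (carrier G))"
    using assms(1) card_mono subgroup.subset less_Suc_eq_le by metis
  then obtain M where M: "?Q M" "\<And>K. ?Q K \<Longrightarrow> card K \<le> card M"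
    using ex_has_greatest_nat[of ?Q C card "Suc (card (carrier G))"] assms(2,3) by blast
  have "K = M \<or> K = carrier G" if K: "subgroup K G" "M \<subseteq> K" for K
  proof (rule disjCI)
    assume "K \<noteq> carrier G"
    then have "card K \<le> card M" using M K by blast
    moreover have "finite K" using assms(1) subgroup.subset[OF K(1)] finite_subset by blast
    ultimately show "K = M" using K(2) card_seteq[of K M] by blast
  qed
  then show thesis using that M(1) unfolding maximal_subgroup_def by blast
qed

end

section \<open>Power maps on minimal normal subgroups\<close>

context group
begin

lemma centralizer_normal:
  assumes "X \<lhd> G"
  shows "{c \<in> carrier G. \<forall>x\<in>X. c \<otimes> x = x \<otimes> c} \<lhd> G"
proof (rule normal_invI)
  have Xc: "X \<subseteq> carrier G" using assms normal_in_carrier by blast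
  show "subgroup {c \<in> carrier G. \<forall>x\<in>X. c \<otimes> x = x \<otimes> c} G" using Xc by (rule centralizer_subgroup)
  fix g c assume g: "g \<in> carrier G" and c: "c \<in> {c \<in> carrier G. \<forall>x\<in>X. c \<otimes> x = x \<otimes> c}"
  have "g \<otimes> c \<otimes> inv g \<otimes> x = x \<otimes> (g \<otimes> c \<otimes> inv g)" if x: "x \<in> X" for x
  proof -
    have xc: "x \<in> carrier G" and cc: "c \<in> carrier G" using x c Xc by auto
    have "inv g \<otimes> x \<otimes> g \<in> X" using normal_conj[OF assms, of "inv g" x] g x by simp
    then have "c \<otimes> (inv g \<otimes> x \<otimes> g) = (inv g \<otimes> x \<otimes> g) \<otimes> c" using c by blast
    then have "g \<otimes> (c \<otimes> (inv g \<otimes> x \<otimes> g)) \<otimes> inv g = g \<otimes> ((inv g \<otimes> x \<otimes> g) \<otimes> c) \<otimes> inv g" by simp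
    then show ?thesis using g cc xc by (simp add: word_simps)
  qed
  then show "g \<otimes> c \<otimes> inv g \<in> {c \<in> carrier G. \<forall>x\<in>X. c \<otimes> x = x \<otimes> c}" using g c by simp
qed

lemma commutator_in_normal_product:
  assumes "C \<lhd> G" "carrier G = A <#> B" "A \<subseteq> carrier G" "B \<subseteq> carrier G" "z \<in> carrier G"
    and "\<And>a. a \<in> A \<Longrightarrow> z \<otimes> a \<otimes> inv z \<otimes> inv a \<in> C" "\<And>b. b \<in> B \<Longrightarrow> z \<otimes> b \<otimes> inv z \<otimes> inv b \<in> C"
    and "g \<in> carrier G"
  shows "z \<otimes> g \<otimes> inv z \<otimes> inv g \<in> C"
proof -
  obtain a b where ab: "a \<in> A" "b \<in> B" "g = a \<otimes> b" using assms(2,8) by (auto simp: set_mult_def)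
  have c: "a \<in> carrier G" "b \<in> carrier G" using ab assms(3,4) by auto
  have "(z \<otimes> a \<otimes> inv z \<otimes> inv a) \<otimes> (a \<otimes> (z \<otimes> b \<otimes> inv z \<otimes> inv b) \<otimes> inv a) \<in> C"
    using assms(6)[OF ab(1)] normal_conj[OF assms(1) c(1) assms(7)[OF ab(2)]]
    by (rule subgroup.m_closed[OF normal_imp_subgroup[OF assms(1)]])
  then show ?thesis using c assms(5) ab(3) by (simp add: word_simps)
qed

text \<open>The eigenspace of \<open>z\<close> for the eigenvalue \<open>k\<close> is normal in
  \<open>G\<close>, because \<open>z\<close> commutes with \<open>G\<close> up to elements that
  centralize \<open>X\<close>.\<close>

lemma power_map_on_minimal_normal:
  assumes "X \<lhd> G" and min: "\<And>Y. Y \<lhd> G \<Longrightarrow> Y \<subseteq> X \<Longrightarrow> Y = {\<one>} \<or> Y = X"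
    and comm: "\<And>x y. x \<in> X \<Longrightarrow> y \<in> X \<Longrightarrow> x \<otimes> y = y \<otimes> x"
    and z: "z \<in> carrier G"
    and com: "\<And>g. g \<in> carrier G \<Longrightarrow>
      z \<otimes> g \<otimes> inv z \<otimes> inv g \<in> {c \<in> carrier G. \<forall>x\<in>X. c \<otimes> x = x \<otimes> c}"
    and y: "y \<in> X" "y \<noteq> \<one>" "z \<otimes> y \<otimes> inv z = y [^] (k::int)"
    and x: "x \<in> X"
  shows "z \<otimes> x \<otimes> inv z = x [^] k"
proof -
  have sX: "subgroup X G" using assms(1) by (rule normal_imp_subgroup)
  have Xc: "u \<in> carrier G" if "u \<in> X" for u using that subgroup.subset[OF sX] by blast
  define E where "E = {x \<in> X. z \<otimes> x \<otimes> inv z = x [^] k}"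
  have "E \<lhd> G"
  proof (rule normal_invI)
    show "subgroup E G"
    proof (rule subgroupI)
      show "E \<subseteq> carrier G" unfolding E_def using Xc by blast
      show "E \<noteq> {}" unfolding E_def using y by blast
      fix a assume a: "a \<in> E"
      then have aX: "a \<in> X" "a \<in> carrier G" "z \<otimes> a \<otimes> inv z = a [^] k" unfolding E_def using Xc by auto
      have "z \<otimes> inv a \<otimes> inv z = inv (z \<otimes> a \<otimes> inv z)" using aX(2) z by (simp add: word_simps)
      also have "\<dots> = inv a [^] k" unfolding aX(3) using aX(2) by (simp add: int_pow_inv)
      finally show "inv a \<in> E" unfolding E_def using subgroup.m_inv_closed[OF sX aX(1)] by simp
      fix b assume "b \<in> E"
      then have bX: "b \<in> X" "b \<in> carrier G" "z \<otimes> b \<otimes> inv z = b [^] k" unfolding E_def using Xc by auto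
      have "z \<otimes> (a \<otimes> b) \<otimes> inv z = (z \<otimes> a \<otimes> inv z) \<otimes> (z \<otimes> b \<otimes> inv z)"
        using aX(2) bX(2) z by (simp add: word_simps)
      also have "\<dots> = (a \<otimes> b) [^] k"
        unfolding aX(3) bX(3) using int_pow_mult_distrib[OF comm[OF aX(1) bX(1)] aX(2) bX(2)] by simp
      finally show "a \<otimes> b \<in> E" unfolding E_def using subgroup.m_closed[OF sX aX(1) bX(1)] by simp
    qed
    fix g x assume g: "g \<in> carrier G" and "x \<in> E"
    then have x: "x \<in> X" "x \<in> carrier G" "z \<otimes> x \<otimes> inv z = x [^] k" unfolding E_def using Xc by auto
    let ?c = "z \<otimes> g \<otimes> inv z \<otimes> inv g"
    let ?w = "g \<otimes> x [^] k \<otimes> inv g"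
    have "?w \<in> X" using normal_conj[OF assms(1) g] subgroup_int_pow_closed[OF sX x(1)] by blast
    then have w: "?c \<otimes> ?w = ?w \<otimes> ?c" using com[OF g] by blast
    have "z \<otimes> (g \<otimes> x \<otimes> inv g) \<otimes> inv z = ?c \<otimes> (g \<otimes> (z \<otimes> x \<otimes> inv z) \<otimes> inv g) \<otimes> inv ?c"
      using z g x(2) by (simp add: word_simps)
    also have "\<dots> = ?c \<otimes> ?w \<otimes> inv ?c" unfolding x(3) ..
    also have "\<dots> = ?w \<otimes> ?c \<otimes> inv ?c" unfolding w ..
    also have "\<dots> = ?w" using z g x(2) by (simp add: word_simps)
    also have "\<dots> = (g \<otimes> x \<otimes> inv g) [^] k" using conj_int_pow[OF g x(2)] by simp
    finally show "g \<otimes> x \<otimes> inv g \<in> E" unfolding E_def using normal_conj[OF assms(1) g x(1)] by simp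
  qed
  moreover have "E \<subseteq> X" "y \<in> E" unfolding E_def using y by auto
  ultimately have "E = X" using min[of E] y(2) by blast
  then show ?thesis using x unfolding E_def by blast
qed

lemma prime_order_normal_conj:
  assumes "X \<lhd> G" "prime p" "card X = p" "x \<in> X" "x \<noteq> \<one>" "g \<in> carrier G"
  obtains m :: nat where "g \<otimes> x \<otimes> inv g = x [^] m"
proof -
  have sX: "subgroup X G" using assms(1) by (rule normal_imp_subgroup)
  have xc: "x \<in> carrier G" using subgroup.mem_carrier[OF sX assms(4)] .
  have "g \<otimes> x \<otimes> inv g \<in> generate G {x}"
    using prime_order_generate[OF sX _ assms(4,5)] normal_conj[OF assms(1,6,4)] assms(2,3) by simp
  then obtain k :: int where k: "g \<otimes> x \<otimes> inv g = x [^] k" using generate_pow[OF xc] by blast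
  have "ord x dvd p" using subgroup_pow_card[OF sX assms(4)] assms(3) pow_eq_id[OF xc] by simp
  moreover have "int p dvd int (nat (k mod int p)) - k"
    using prime_gt_0_nat[OF assms(2)] by (simp add: mod_eq_dvd_iff[symmetric])
  ultimately have "x [^] k = x [^] int (nat (k mod int p))"
    using int_pow_eq[OF xc] by (meson dvd_trans int_dvd_int_iff)
  then have "g \<otimes> x \<otimes> inv g = x [^] nat (k mod int p)" using k by (simp only: int_pow_int)
  then show thesis by (rule that)
qed

lemma commute_prime_order_subgroup:
  assumes "subgroup X G" "prime (card X)" "x \<in> X" "x \<noteq> \<one>" "c \<in> carrier G" "c \<otimes> x = x \<otimes> c" "y \<in> X"
  shows "c \<otimes> y = y \<otimes> c"
proof -
  have xc: "x \<in> carrier G" using subgroup.mem_carrier[OF assms(1,3)] .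
  have "subgroup {g \<in> carrier G. \<forall>u\<in>{c}. g \<otimes> u = u \<otimes> g} G"
    using assms(5) by (intro centralizer_subgroup) simp
  then have "generate G {x} \<subseteq> {g \<in> carrier G. \<forall>u\<in>{c}. g \<otimes> u = u \<otimes> g}"
    using xc assms(6) by (intro generate_subgroup_incl) simp_all
  then show ?thesis using prime_order_generate[OF assms(1-4)] assms(7) by auto
qed

text \<open>\<open>G\<close> acts on \<open>X\<close> through the automorphism group of a group
  of order \<open>p\<close>, which is abelian of exponent \<open>p - 1\<close>.\<close>

lemma prime_order_normal_centralized:
  assumes "X \<lhd> G" "prime p" "card X = p" "y \<in> X"
  shows "a \<in> carrier G \<Longrightarrow> b \<in> carrier G \<Longrightarrow>
      (a \<otimes> b \<otimes> inv a \<otimes> inv b) \<otimes> y = y \<otimes> (a \<otimes> b \<otimes> inv a \<otimes> inv b)"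
    and "b \<in> carrier G \<Longrightarrow> b [^] (p - 1) \<otimes> y = y \<otimes> b [^] (p - 1)"
proof -
  have sX: "subgroup X G" using assms(1) by (rule normal_imp_subgroup)
  have pX: "prime (card X)" using assms(2,3) by simp
  have "X \<noteq> {\<one>}" using pX by auto
  then obtain x where x: "x \<in> X" "x \<noteq> \<one>" using subgroup.one_closed[OF sX] by blast
  have xc: "x \<in> carrier G" using subgroup.mem_carrier[OF sX x(1)] .
  note cj = prime_order_normal_conj[OF assms(1-3) x]
  note com = commute_prime_order_subgroup[OF sX pX x _ _ assms(4)]
  show "(a \<otimes> b \<otimes> inv a \<otimes> inv b) \<otimes> y = y \<otimes> (a \<otimes> b \<otimes> inv a \<otimes> inv b)"
    if ab: "a \<in> carrier G" "b \<in> carrier G"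
  proof (rule com)
    obtain m :: nat where "inv a \<otimes> x \<otimes> inv (inv a) = x [^] m" using cj[OF inv_closed[OF ab(1)]] by blast
    then have m: "inv a \<otimes> x \<otimes> a = x [^] int m" using ab by (simp add: int_pow_int)
    obtain k :: nat where "inv b \<otimes> x \<otimes> inv (inv b) = x [^] k" using cj[OF inv_closed[OF ab(2)]] by blast
    then have k: "inv b \<otimes> x \<otimes> b = x [^] int k" using ab by (simp add: int_pow_int)
    show "(a \<otimes> b \<otimes> inv a \<otimes> inv b) \<otimes> x = x \<otimes> (a \<otimes> b \<otimes> inv a \<otimes> inv b)"
      using commutator_centralizes_cyclic[OF ab xc m k] .
  qed (use ab in simp)
  show "b [^] (p - 1) \<otimes> y = y \<otimes> b [^] (p - 1)" if b: "b \<in> carrier G"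
  proof (rule com)
    obtain m :: nat where m: "b \<otimes> x \<otimes> inv b = x [^] m" using cj[OF b] by blast
    have xp: "x [^] p = \<one>" using subgroup_pow_card[OF sX x(1)] assms(3) by simp
    have "\<not> p dvd m"
    proof
      assume "p dvd m"
      then have "[m = 0] (mod p)" by (simp add: cong_0_iff)
      then have "b \<otimes> x \<otimes> inv b = \<one>" using m pow_cong[OF xc xp] by (metis nat_pow_0)
      then show False using x(2) b xc by (metis inv_closed inv_comm l_cancel_one' m_assoc m_closed r_cancel_one' r_inv)
    qed
    have "b [^] j \<otimes> x \<otimes> inv (b [^] j) = x [^] (m ^ j)" for j :: nat
    proof (induction j)
      case (Suc j)
      have "b [^] Suc j \<otimes> x \<otimes> inv (b [^] Suc j) = b [^] j \<otimes> (b \<otimes> x \<otimes> inv b) \<otimes> inv (b [^] j)"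
        using b xc by (simp add: word_simps)
      also have "\<dots> = (b [^] j \<otimes> x \<otimes> inv (b [^] j)) [^] m"
        unfolding m using conj_nat_pow[of "b [^] j" x m] b xc by simp
      also have "\<dots> = x [^] (m ^ Suc j)" unfolding Suc using xc by (simp add: nat_pow_pow mult.commute)
      finally show ?case .
    qed (use xc in simp)
    then have "b [^] (p - 1) \<otimes> x \<otimes> inv (b [^] (p - 1)) = x [^] (m ^ (p - 1))" .
    also have "\<dots> = x [^] (1::nat)"
      using pow_cong[OF xc xp fermat_theorem[OF assms(2) \<open>\<not> p dvd m\<close>]] .
    finally show "b [^] (p - 1) \<otimes> x = x \<otimes> b [^] (p - 1)"
      using b xc by (simp add: inv_solve_right')
  qed (use b in simp)
qed

lemma prime_section_centralized:
  assumes "finite (carrier G)" "U \<lhd> G" "V \<lhd> G" "U \<subseteq> V" "prime p" "card V = p * card U" "v \<in> V"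
  shows "a \<in> carrier G \<Longrightarrow> b \<in> carrier G \<Longrightarrow>
      (a \<otimes> b \<otimes> inv a \<otimes> inv b) \<otimes> v \<otimes> inv (a \<otimes> b \<otimes> inv a \<otimes> inv b) \<otimes> inv v \<in> U"
    and "b \<in> carrier G \<Longrightarrow> b [^] (p - 1) \<otimes> v \<otimes> inv (b [^] (p - 1)) \<otimes> inv v \<in> U"
proof -
  interpret U: normal U G by fact
  define Q where "Q = G Mod U"
  define h where "h = (\<lambda>x. U #> x)"
  interpret h: group_hom G Q h unfolding Q_def h_def by (rule U.quotient_hom)
  have hsurj: "h ` carrier G = carrier Q" unfolding Q_def h_def by (rule U.quotient_surj)
  have ker: "h u = \<one>\<^bsub>Q\<^esub> \<longleftrightarrow> u \<in> U" if "u \<in> carrier G" for u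
    unfolding h_def Q_def using U.rcos_eq_self_iff[OF that] by simp
  have sV: "subgroup V G" using assms(3) by (rule normal_imp_subgroup)
  have hV: "h ` V \<lhd> Q" using normal.surj_hom_normal_subgroup[OF assms(3) h.group_hom_axioms hsurj] .
  have "kernel (G\<lparr>carrier := V\<rparr>) Q h = U"
    using ker assms(4) subgroup.subset[OF sV] by (auto simp: kernel_def)
  moreover have "card U > 0" using U.finite_imp_card_positive assms(1) by blast
  ultimately have cV: "card (h ` V) = p"
    using group_hom.card_image_kernel[OF h.induced_group_hom'[OF sV]] assms(6) by (simp add: order_def)
  have vc: "v \<in> carrier G" using subgroup.mem_carrier[OF sV assms(7)] .
  have hv: "h v \<in> h ` V" using assms(7) by blast
  have fin: "c \<otimes> v \<otimes> inv c \<otimes> inv v \<in> U" if c: "c \<in> carrier G" and eq: "h c \<otimes>\<^bsub>Q\<^esub> h v = h v \<otimes>\<^bsub>Q\<^esub> h c" for c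
  proof -
    have "h (c \<otimes> v \<otimes> inv c \<otimes> inv v) = h c \<otimes>\<^bsub>Q\<^esub> h v \<otimes>\<^bsub>Q\<^esub> inv\<^bsub>Q\<^esub> h c \<otimes>\<^bsub>Q\<^esub> inv\<^bsub>Q\<^esub> h v"
      using c vc by simp
    also have "\<dots> = \<one>\<^bsub>Q\<^esub>" unfolding eq using c vc by (simp add: h.H.word_simps)
    finally have "h (c \<otimes> v \<otimes> inv c \<otimes> inv v) = \<one>\<^bsub>Q\<^esub>" .
    then show ?thesis by (rule iffD1[OF ker, rotated]) (use c vc in simp)
  qed
  show "(a \<otimes> b \<otimes> inv a \<otimes> inv b) \<otimes> v \<otimes> inv (a \<otimes> b \<otimes> inv a \<otimes> inv b) \<otimes> inv v \<in> U"
    if "a \<in> carrier G" "b \<in> carrier G"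
    using h.H.prime_order_normal_centralized(1)[OF hV assms(5) cV hv, of "h a" "h b"] that
    by (intro fin) simp_all
  show "b [^] (p - 1) \<otimes> v \<otimes> inv (b [^] (p - 1)) \<otimes> inv v \<in> U" if "b \<in> carrier G"
    using h.H.prime_order_normal_centralized(2)[OF hV assms(5) cV hv, of "h b"] that
    by (intro fin) (simp_all add: h.hom_nat_pow)
qed

end

section \<open>Trivial action on sections of prime order\<close>

text \<open>The elements of \<open>B\<close> that act trivially on all sections \<open>V /
  U\<close> of order \<open>p\<close> of \<open>G\<close> normalized by \<open>B\<close>; the
  group \<open>N\<close> serves to express this and that \<open>U\<close> is normal in
  \<open>V\<close>. The quotient of \<open>B\<close> by the section kernel is abelian of
  exponent dividing \<open>p - 1\<close>, because groups of order \<open>p\<close> have abelian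
  automorphism groups of exponent \<open>p - 1\<close>.\<close>

definition section_kernel :: "('a, 'b) monoid_scheme \<Rightarrow> nat \<Rightarrow> 'a set \<Rightarrow> 'a set" where
  "section_kernel G p B = {b \<in> B. \<forall>N U V. subgroup N G \<longrightarrow> B \<subseteq> N \<longrightarrow> U \<lhd> G\<lparr>carrier := N\<rparr> \<longrightarrow>
     V \<lhd> G\<lparr>carrier := N\<rparr> \<longrightarrow> U \<subseteq> V \<longrightarrow> card V = p * card U \<longrightarrow>
     (\<forall>v\<in>V. b \<otimes>\<^bsub>G\<^esub> v \<otimes>\<^bsub>G\<^esub> inv\<^bsub>G\<^esub> b \<otimes>\<^bsub>G\<^esub> inv\<^bsub>G\<^esub> v \<in> U)}"

context group
begin

lemma section_kernelD:
  assumes "b \<in> section_kernel G p B" "subgroup N G" "B \<subseteq> N"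
    "U \<lhd> G\<lparr>carrier := N\<rparr>" "V \<lhd> G\<lparr>carrier := N\<rparr>" "U \<subseteq> V" "card V = p * card U" "v \<in> V"
  shows "b \<otimes> v \<otimes> inv b \<otimes> inv v \<in> U"
  using assms unfolding section_kernel_def by blast

lemma section_kernel_subgroup:
  assumes "subgroup B G"
  shows "subgroup (section_kernel G p B) G"
proof (rule subgroupI)
  let ?K = "section_kernel G p B"
  have KB: "?K \<subseteq> B" unfolding section_kernel_def by blast
  then show "?K \<subseteq> carrier G" using subgroup.subset[OF assms] by blast
  have sect: "U \<subseteq> V \<and> V \<subseteq> N \<and> subgroup U G \<and> subgroup V G \<and>
      (\<forall>g\<in>N. \<forall>u\<in>U. g \<otimes> u \<otimes> inv g \<in> U) \<and> (\<forall>g\<in>N. \<forall>v\<in>V. g \<otimes> v \<otimes> inv g \<in> V)"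
    if "subgroup N G" "U \<lhd> G\<lparr>carrier := N\<rparr>" "V \<lhd> G\<lparr>carrier := N\<rparr>" "U \<subseteq> V" for N U V
  proof -
    interpret N: group "G\<lparr>carrier := N\<rparr>" using that(1) by (rule subgroup_imp_group)
    have "\<And>g u. g \<in> N \<Longrightarrow> u \<in> U \<Longrightarrow> g \<otimes> u \<otimes> inv g \<in> U"
      using N.normal_conj[OF that(2)] that(1) by simp
    moreover have "\<And>g u. g \<in> N \<Longrightarrow> u \<in> V \<Longrightarrow> g \<otimes> u \<otimes> inv g \<in> V"
      using N.normal_conj[OF that(3)] that(1) by simp
    moreover have "subgroup U G" "subgroup V G" "V \<subseteq> N"
      using incl_subgroup[OF that(1)] normal_imp_subgroup that(2,3) N.normal_in_carrier[OF that(3)] by auto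
    ultimately show ?thesis using that(4) by blast
  qed
  have "\<one> \<in> ?K"
  proof -
    have "\<one> \<otimes> v \<otimes> inv \<one> \<otimes> inv v \<in> U"
      if H: "subgroup N G" "U \<lhd> G\<lparr>carrier := N\<rparr>" "V \<lhd> G\<lparr>carrier := N\<rparr>" "U \<subseteq> V" "v \<in> V" for N U V v
    proof -
      note S = sect[OF H(1-4)]
      have "v \<in> carrier G" using S H(5) subgroup.mem_carrier by metis
      then show ?thesis using S by (simp add: subgroup.one_closed)
    qed
    then show ?thesis using subgroup.one_closed[OF assms] unfolding section_kernel_def by blast
  qed
  then show "?K \<noteq> {}" by blast
  fix a assume a: "a \<in> ?K"
  then have aB: "a \<in> B" and ac: "a \<in> carrier G" using KB subgroup.subset[OF assms] by auto
  show "inv a \<in> ?K"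
    unfolding section_kernel_def
  proof (intro CollectI conjI allI impI ballI)
    show "inv a \<in> B" using aB subgroup.m_inv_closed[OF assms] by blast
    fix N U V v
    assume H: "subgroup N G" "B \<subseteq> N" "U \<lhd> G\<lparr>carrier := N\<rparr>" "V \<lhd> G\<lparr>carrier := N\<rparr>" "U \<subseteq> V"
      "card V = p * card U" "v \<in> V"
    note S = sect[OF H(1,3-5)]
    have sU: "subgroup U G" and sV: "subgroup V G" using S by blast+
    have vc: "v \<in> carrier G" using subgroup.mem_carrier[OF sV H(7)] .
    have "inv a \<in> N" using aB H(2) subgroup.m_inv_closed[OF H(1)] by blast
    moreover have "inv (a \<otimes> v \<otimes> inv a \<otimes> inv v) \<in> U"
      using subgroup.m_inv_closed[OF sU section_kernelD[OF a H]] .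
    ultimately have "inv a \<otimes> inv (a \<otimes> v \<otimes> inv a \<otimes> inv v) \<otimes> inv (inv a) \<in> U" using S by blast
    then show "inv a \<otimes> v \<otimes> inv (inv a) \<otimes> inv v \<in> U" using ac vc by (simp add: word_simps)
  qed
  fix b assume b: "b \<in> ?K"
  then have bB: "b \<in> B" and bc: "b \<in> carrier G" using KB subgroup.subset[OF assms] by auto
  show "a \<otimes> b \<in> ?K"
    unfolding section_kernel_def
  proof (intro CollectI conjI allI impI ballI)
    show "a \<otimes> b \<in> B" using aB bB subgroup.m_closed[OF assms] by blast
    fix N U V v
    assume H: "subgroup N G" "B \<subseteq> N" "U \<lhd> G\<lparr>carrier := N\<rparr>" "V \<lhd> G\<lparr>carrier := N\<rparr>" "U \<subseteq> V"
      "card V = p * card U" "v \<in> V"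
    note S = sect[OF H(1,3-5)]
    have sU: "subgroup U G" and sV: "subgroup V G" using S by blast+
    have vc: "v \<in> carrier G" using subgroup.mem_carrier[OF sV H(7)] .
    have "a \<otimes> (b \<otimes> v \<otimes> inv b \<otimes> inv v) \<otimes> inv a \<in> U"
      using section_kernelD[OF b H] S aB H(2) by blast
    then have "a \<otimes> (b \<otimes> v \<otimes> inv b \<otimes> inv v) \<otimes> inv a \<otimes> (a \<otimes> v \<otimes> inv a \<otimes> inv v) \<in> U"
      using section_kernelD[OF a H] by (rule subgroup.m_closed[OF sU])
    then show "a \<otimes> b \<otimes> v \<otimes> inv (a \<otimes> b) \<otimes> inv v \<in> U" using ac bc vc by (simp add: word_simps)
  qed
qed

lemma section_kernel_members:
  assumes "finite (carrier G)" "subgroup B G" "prime p" "a \<in> B" "b \<in> B"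
  shows "a \<otimes> b \<otimes> inv a \<otimes> inv b \<in> section_kernel G p B" "b [^] (p - 1) \<in> section_kernel G p B"
proof -
  have Bc: "x \<in> carrier G" if "x \<in> B" for x using that subgroup.subset[OF assms(2)] by blast
  have "a \<otimes> b \<otimes> inv a \<otimes> inv b \<in> B"
    using assms(4,5) by (intro subgroup.m_closed[OF assms(2)] subgroup.m_inv_closed[OF assms(2)])
  have pow: "b [^] (n::nat) \<in> B" for n
    using assms(5) by (induction n) (simp_all add: subgroup.one_closed[OF assms(2)] subgroup.m_closed[OF assms(2)])
  have "(a \<otimes> b \<otimes> inv a \<otimes> inv b) \<otimes> v \<otimes> inv (a \<otimes> b \<otimes> inv a \<otimes> inv b) \<otimes> inv v \<in> U \<and>
      b [^] (p - 1) \<otimes> v \<otimes> inv (b [^] (p - 1)) \<otimes> inv v \<in> U"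
    if H: "subgroup N G" "B \<subseteq> N" "U \<lhd> G\<lparr>carrier := N\<rparr>" "V \<lhd> G\<lparr>carrier := N\<rparr>" "U \<subseteq> V"
      "card V = p * card U" "v \<in> V" for N U V v
  proof -
    interpret N: group "G\<lparr>carrier := N\<rparr>" using H(1) by (rule subgroup_imp_group)
    have fN: "finite (carrier (G\<lparr>carrier := N\<rparr>))"
      using assms(1) subgroup.subset[OF H(1)] finite_subset by simp blast
    have vN: "v \<in> N" using N.normal_in_carrier[OF H(4,7)] by simp
    have abN: "a \<in> N" "b \<in> N" using assms(4,5) H(2) by auto
    have eq: "inv\<^bsub>G\<lparr>carrier := N\<rparr>\<^esub> x = inv x" if "x \<in> N" for x using that H(1) by simp
    have c: "a \<otimes> b \<otimes> inv a \<otimes> inv b \<in> N"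
      using \<open>a \<otimes> b \<otimes> inv a \<otimes> inv b \<in> B\<close> H(2) by blast
    have d: "b [^] (p - 1) \<in> N" using pow H(2) by blast
    show ?thesis
      using N.prime_section_centralized(1)[OF fN H(3,4,5) assms(3) H(6,7), of a b]
        N.prime_section_centralized(2)[OF fN H(3,4,5) assms(3) H(6,7), of b] abN vN c d
      by (simp add: eq flip: nat_pow_consistent)
  qed
  note main = this
  show "a \<otimes> b \<otimes> inv a \<otimes> inv b \<in> section_kernel G p B"
    unfolding section_kernel_def
  proof (intro CollectI conjI allI impI ballI)
    fix N U V v
    assume H: "subgroup N G" "B \<subseteq> N" "U \<lhd> G\<lparr>carrier := N\<rparr>" "V \<lhd> G\<lparr>carrier := N\<rparr>" "U \<subseteq> V"
      "card V = p * card U" "v \<in> V"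
    show "(a \<otimes> b \<otimes> inv a \<otimes> inv b) \<otimes> v \<otimes> inv (a \<otimes> b \<otimes> inv a \<otimes> inv b) \<otimes> inv v \<in> U"
      using main[OF H] ..
  qed fact
  show "b [^] (p - 1) \<in> section_kernel G p B"
    unfolding section_kernel_def
  proof (intro CollectI conjI allI impI ballI)
    fix N U V v
    assume H: "subgroup N G" "B \<subseteq> N" "U \<lhd> G\<lparr>carrier := N\<rparr>" "V \<lhd> G\<lparr>carrier := N\<rparr>" "U \<subseteq> V"
      "card V = p * card U" "v \<in> V"
    show "b [^] (p - 1) \<otimes> v \<otimes> inv (b [^] (p - 1)) \<otimes> inv v \<in> U" using main[OF H] ..
  qed (rule pow)
qed

text \<open>Conjugation by \<open>b\<close> permutes the coset of \<open>x\<close>, whose size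
  is prime to \<open>q\<close>.\<close>

lemma commutes_with_coset_element:
  assumes "finite (carrier G)" "prime q" "b \<in> carrier G" "b [^] (q ^ k :: nat) = \<one>"
    and "subgroup Y G" "\<not> q dvd card Y" "\<And>y. y \<in> Y \<Longrightarrow> b \<otimes> y \<otimes> inv b \<in> Y"
    and "x \<in> carrier G" "b \<otimes> x \<otimes> inv b \<otimes> inv x \<in> Y"
  obtains y where "y \<in> Y" "b \<otimes> (y \<otimes> x) = (y \<otimes> x) \<otimes> b"
proof -
  have Yc: "y \<in> carrier G" if "y \<in> Y" for y using that subgroup.subset[OF assms(5)] by blast
  have "Y #> x \<in> rcosets Y" using rcosetsI[OF subgroup.subset[OF assms(5)] assms(8)] .
  then have card: "card (Y #> x) = card Y" using card_rcosets_equal[OF _ subgroup.subset[OF assms(5)]] by simp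
  have "b \<otimes> s \<otimes> inv b \<in> Y #> x" if s: "s \<in> Y #> x" for s
  proof -
    obtain y where y: "y \<in> Y" "s = y \<otimes> x" using s by (auto simp: r_coset_def)
    have "(b \<otimes> y \<otimes> inv b) \<otimes> (b \<otimes> x \<otimes> inv b \<otimes> inv x) \<in> Y"
      using subgroup.m_closed[OF assms(5) assms(7)[OF y(1)] assms(9)] .
    moreover have "b \<otimes> s \<otimes> inv b = (b \<otimes> y \<otimes> inv b) \<otimes> (b \<otimes> x \<otimes> inv b \<otimes> inv x) \<otimes> x"
      using y assms(3,8) Yc by (simp add: word_simps)
    ultimately show ?thesis by (auto simp: r_coset_def)
  qed
  moreover have "Y #> x \<subseteq> carrier G" using r_coset_subset_G[OF subgroup.subset[OF assms(5)] assms(8)] .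
  ultimately obtain c where c: "c \<in> Y #> x" "b \<otimes> c = c \<otimes> b"
    using q_element_fixed_point[OF assms(1-4)] card assms(6) by metis
  then show thesis using that by (auto simp: r_coset_def)
qed

end

context group
begin

text \<open>Climbing up from the trivial subgroup to \<open>B \<inter> P\<close> through normal
  subgroups of \<open>B\<close>: if \<open>b\<close> centralizes \<open>Y\<close> and acts
  trivially on \<open>X / Y\<close>, then it commutes with an element of each coset of
  \<open>Y\<close> in \<open>X\<close>, and so with all of \<open>X\<close>.\<close>

lemma section_kernel_centralizes_Int:
  assumes "finite (carrier G)" "subgroup B G" "supersoluble (G\<lparr>carrier := B\<rparr>)"
    and "P \<lhd> G" "prime p" "card P = p ^ k"
    and "b \<in> section_kernel G p B" "prime q" "q \<noteq> p" "b [^] (q ^ m :: nat) = \<one>"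
    and "x \<in> B \<inter> P"
  shows "b \<otimes> x = x \<otimes> b"
proof -
  interpret B: group "G\<lparr>carrier := B\<rparr>" using assms(2) by (rule subgroup_imp_group)
  have bB: "b \<in> B" using assms(7) unfolding section_kernel_def by blast
  have Bsub: "B \<subseteq> carrier G" using subgroup.subset[OF assms(2)] .
  have bc: "b \<in> carrier G" using bB Bsub by blast
  have fB: "finite B" using assms(1) Bsub finite_subset by blast
  have R: "B \<inter> P \<lhd> G\<lparr>carrier := B\<rparr>"
    using normal_Int_subgroup[OF assms(2,4)] by (simp add: Int_commute)
  let ?Q = "\<lambda>Y. Y \<lhd> G\<lparr>carrier := B\<rparr> \<and> Y \<subseteq> B \<inter> P \<and> (\<forall>y\<in>Y. b \<otimes> y = y \<otimes> b)"
  have "?Q {\<one>}"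
    using B.one_is_normal bc subgroup.one_closed[OF assms(2)]
      subgroup.one_closed[OF normal_imp_subgroup[OF assms(4)]] by simp
  moreover have "card Y < Suc (card B)" if "?Q Y" for Y
    using that card_mono[OF fB, of Y] by auto
  ultimately obtain Y where Y: "?Q Y" "\<And>Z. ?Q Z \<Longrightarrow> card Z \<le> card Y"
    using ex_has_greatest_nat[of ?Q "{\<one>}" card "Suc (card B)"] by blast
  have "Y = B \<inter> P"
  proof (rule ccontr)
    assume "Y \<noteq> B \<inter> P"
    then have YR: "Y \<subset> B \<inter> P" and YB: "Y \<lhd> G\<lparr>carrier := B\<rparr>" using Y(1) by blast+
    have fB': "finite (carrier (G\<lparr>carrier := B\<rparr>))" using fB by simp
    obtain X where X: "X \<lhd> G\<lparr>carrier := B\<rparr>" "Y \<subseteq> X" "X \<subseteq> B \<inter> P"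
      "prime (card X div card Y)" "card X = (card X div card Y) * card Y"
      by (rule B.supersoluble_section_prime[OF fB' assms(3) YB R YR])
    define r where "r = card X div card Y"
    have r: "prime r" "card X = r * card Y" using X(4,5) r_def by auto
    have sX: "subgroup X G" and sY: "subgroup Y G"
      using incl_subgroup[OF assms(2)] normal_imp_subgroup X(1) Y(1) by auto
    have "card X dvd p ^ k"
      using subgroup_card_dvd_subgroup[OF sX normal_imp_subgroup[OF assms(4)]] X(3) assms(6) by auto
    then have "r dvd p ^ k" "card Y dvd p ^ k" using r(2) by (auto intro: dvd_mult_left dvd_mult_right)
    then have rp: "r = p" using r(1) assms(5) prime_dvd_power primes_dvd_imp_eq by blast
    have qY: "\<not> q dvd card Y"
    proof
      assume "q dvd card Y"
      then have "q dvd p ^ k" using \<open>card Y dvd p ^ k\<close> dvd_trans by blast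
      then show False using assms(5,8,9) prime_dvd_power primes_dvd_imp_eq by blast
    qed
    have "b \<otimes> x = x \<otimes> b" if x: "x \<in> X" for x
    proof -
      have xc: "x \<in> carrier G" using subgroup.mem_carrier[OF sX x] .
      have "b \<otimes> x \<otimes> inv b \<otimes> inv x \<in> Y"
        using section_kernelD[OF assms(7,2) order_refl _ X(1,2) _ x] Y(1) r(2) rp by blast
      moreover have Yb: "b \<otimes> y = y \<otimes> b" "y \<in> carrier G" if "y \<in> Y" for y
        using Y(1) that subgroup.mem_carrier[OF sY that] by auto
      then have "b \<otimes> y \<otimes> inv b \<in> Y" if "y \<in> Y" for y
        using that bc by (simp add: m_assoc)
      ultimately obtain y where y: "y \<in> Y" "b \<otimes> (y \<otimes> x) = (y \<otimes> x) \<otimes> b"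
        using commutes_with_coset_element[OF assms(1,8) bc assms(10) sY qY _ xc] by blast
      have yc: "y \<in> carrier G" using Yb(2)[OF y(1)] .
      have "inv y \<otimes> b = b \<otimes> inv y" using commute_inv[OF Yb(1)[OF y(1), symmetric] yc bc] .
      from commute_mult[OF this y(2)[symmetric]]
      have "inv y \<otimes> (y \<otimes> x) \<otimes> b = b \<otimes> (inv y \<otimes> (y \<otimes> x))" using yc xc bc by simp
      then show ?thesis using yc xc bc by (simp add: inv_cancel)
    qed
    then have "?Q X" using X by blast
    then have "card X \<le> card Y" by (rule Y(2))
    moreover have "card Y > 0"
      using subgroup.finite_imp_card_positive[OF sY] assms(1) .
    then have "card Y < r * card Y" using prime_gt_1_nat[OF r(1)] by simp
    ultimately show False using r(2) by simp
  qed
  then show ?thesis using Y(1) assms(11) by blast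
qed

text \<open>Since \<open>B M\<close> is a subgroup, \<open>B\<close> normalizes \<open>B M
  \<inter> P\<close>, which is \<open>(B \<inter> P) M = M\<close> by the modular law.\<close>

lemma permuting_imp_normalizes:
  assumes "P \<lhd> G" "subgroup B G" "subgroup M G" "M \<subseteq> P" "permuting G B M" "B \<inter> P \<subseteq> M"
    and "c \<in> B" "u \<in> M"
  shows "c \<otimes> u \<otimes> inv c \<in> M"
proof -
  have "c \<otimes> u \<in> B <#> M" using assms(7,8) by (auto simp: set_mult_def)
  then have "c \<otimes> u \<in> M <#> B" using assms(5) by (simp add: permuting_def)
  then obtain u' c' where uc: "u' \<in> M" "c' \<in> B" "c \<otimes> u = u' \<otimes> c'" by (auto simp: set_mult_def)
  have car: "c \<in> carrier G" "c' \<in> carrier G" "u \<in> carrier G" "u' \<in> carrier G"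
    using subgroup.mem_carrier[OF assms(2)] subgroup.mem_carrier[OF assms(3)] assms(7,8) uc(1,2) by auto
  have sP: "subgroup P G" using assms(1) by (rule normal_imp_subgroup)
  have "c \<otimes> u \<otimes> inv c \<in> P" "u' \<in> P"
    using normal_conj[OF assms(1) car(1)] assms(4,8) uc(1) by blast+
  then have "inv u' \<otimes> (c \<otimes> u \<otimes> inv c) \<in> P"
    using subgroup.m_closed[OF sP subgroup.m_inv_closed[OF sP]] by blast
  moreover have "inv u' \<otimes> (c \<otimes> u \<otimes> inv c) = c' \<otimes> inv c"
    unfolding uc(3) using car by (simp add: word_simps)
  moreover have "c' \<otimes> inv c \<in> B"
    using uc(2) assms(7) by (intro subgroup.m_closed[OF assms(2)] subgroup.m_inv_closed[OF assms(2)])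
  ultimately have "c' \<otimes> inv c \<in> M" using assms(6) by auto
  then have "u' \<otimes> (c' \<otimes> inv c) \<in> M" by (rule subgroup.m_closed[OF assms(3) uc(1)])
  then show ?thesis unfolding uc(3) using car by (simp add: m_assoc)
qed

text \<open>If the centralizer of \<open>b\<close> in \<open>P\<close> is proper, it lies in a
  maximal subgroup \<open>M\<close> of \<open>P\<close>. Then \<open>M\<close> contains \<open>B
  \<inter> P\<close>, so \<open>B\<close> normalizes \<open>M\<close> and \<open>b\<close> acts
  trivially on \<open>P / M\<close>. Then \<open>b\<close> commutes with an element of each
  coset of \<open>M\<close> in \<open>P\<close>, although these elements belong to
  \<open>M\<close>.\<close>

lemma section_kernel_centralizes:
  assumes "finite (carrier G)" "subgroup B G" "supersoluble (G\<lparr>carrier := B\<rparr>)"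
    and "P \<lhd> G" "prime p" "card P = p ^ k"
    and perm: "\<And>M. maximal_subgroup (G\<lparr>carrier := P\<rparr>) M \<Longrightarrow> permuting G B M"
    and "b \<in> section_kernel G p B" "prime q" "q \<noteq> p" "b [^] (q ^ m :: nat) = \<one>"
    and "x \<in> P"
  shows "b \<otimes> x = x \<otimes> b"
proof (rule ccontr)
  assume neq: "b \<otimes> x \<noteq> x \<otimes> b"
  have sP: "subgroup P G" using assms(4) by (rule normal_imp_subgroup)
  interpret P: group "G\<lparr>carrier := P\<rparr>" using sP by (rule subgroup_imp_group)
  have Psub: "P \<subseteq> carrier G" using subgroup.subset[OF sP] .
  have fP: "finite P" using assms(1) Psub finite_subset by blast
  have bB: "b \<in> B" using assms(8) unfolding section_kernel_def by blast
  have bc: "b \<in> carrier G" using subgroup.mem_carrier[OF assms(2) bB] .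
  let ?Z = "{g \<in> carrier G. \<forall>u\<in>{b}. g \<otimes> u = u \<otimes> g}"
  define C where "C = P \<inter> ?Z"
  have "subgroup ?Z G" using bc by (intro centralizer_subgroup) simp
  then have "subgroup C G" unfolding C_def using subgroups_Inter_pair[OF sP] by blast
  then have "subgroup C (G\<lparr>carrier := P\<rparr>)" using sP subgroup_incl unfolding C_def by blast
  moreover have "x \<notin> C" using neq unfolding C_def by auto
  then have "C \<noteq> carrier (G\<lparr>carrier := P\<rparr>)" using assms(12) by auto
  ultimately obtain M where M: "maximal_subgroup (G\<lparr>carrier := P\<rparr>) M" "C \<subseteq> M"
    using P.maximal_subgroup_above fP by auto
  have "order (G\<lparr>carrier := P\<rparr>) = p ^ k" using assms(6) by (simp add: order_def)
  note MP = P.maximal_subgroup_of_p_group[OF assms(5) this M(1)]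
  have cP: "card P = p * card M" using MP(2) by simp
  have sM: "subgroup M G" using incl_subgroup[OF sP normal_imp_subgroup[OF MP(1)]] .
  have MsubP: "M \<subseteq> P" using P.normal_in_carrier[OF MP(1)] by auto
  have Msub: "M \<subseteq> carrier G" and fM: "finite M" using MsubP Psub fP finite_subset by blast+
  have "B \<inter> P \<subseteq> C"
    unfolding C_def using section_kernel_centralizes_Int[OF assms(1-6,8-11)] Psub by auto
  then have BPM: "B \<inter> P \<subseteq> M" using M(2) by blast
  note norm = permuting_imp_normalizes[OF assms(4,2) sM MsubP perm[OF M(1)] BPM]
  let ?N = "{g \<in> carrier G. \<forall>s\<in>M. g \<otimes> s \<otimes> inv g \<in> M \<and> inv g \<otimes> s \<otimes> g \<in> M}"
  have sN: "subgroup ?N G" using Msub by (rule set_normalizer_subgroup)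
  have BN: "B \<subseteq> ?N"
    using in_set_normalizer[OF fM Msub] norm subgroup.mem_carrier[OF assms(2)] by blast
  have PM: "g \<otimes> s \<otimes> inv g \<in> M" if "g \<in> P" "s \<in> M" for g s
    using P.normal_conj[OF MP(1), of g s] that sP by simp
  then have PN: "P \<subseteq> ?N" using in_set_normalizer[OF fM Msub] Psub by blast
  have "M \<lhd> G\<lparr>carrier := ?N\<rparr>"
  proof -
    interpret N: group "G\<lparr>carrier := ?N\<rparr>" using sN by (rule subgroup_imp_group)
    have "subgroup M (G\<lparr>carrier := ?N\<rparr>)" using subgroup_incl[OF sM sN] MsubP PN by blast
    then show ?thesis using m_inv_consistent[OF sN] by (intro N.normal_invI) simp_all
  qed
  moreover have "P \<lhd> G\<lparr>carrier := ?N\<rparr>" using normal_in_subgroup[OF assms(4) sN PN] .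
  ultimately have key: "b \<otimes> v \<otimes> inv b \<otimes> inv v \<in> M" if "v \<in> P" for v
    using section_kernelD[OF assms(8) sN BN _ _ MsubP cP that] by blast
  have "card M dvd p ^ k" using cP assms(6) by (metis dvd_triv_right)
  then have qM: "\<not> q dvd card M"
    using assms(5,9,10) by (metis dvd_trans prime_dvd_power primes_dvd_imp_eq)
  have "v \<in> M" if v: "v \<in> P" for v
  proof -
    have vc: "v \<in> carrier G" using v Psub by blast
    obtain y where y: "y \<in> M" "b \<otimes> (y \<otimes> v) = (y \<otimes> v) \<otimes> b"
      using commutes_with_coset_element[OF assms(1,9) bc assms(11) sM qM _ vc key[OF v]] norm bB by blast
    have yc: "y \<in> carrier G" using y(1) Msub by blast
    have "y \<otimes> v \<in> P" using y(1) MsubP v by (intro subgroup.m_closed[OF sP]) auto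
    then have "y \<otimes> v \<in> C" unfolding C_def using y(2) yc vc by simp
    then have "y \<otimes> v \<in> M" using M(2) by blast
    then have "inv y \<otimes> (y \<otimes> v) \<in> M"
      using subgroup.m_closed[OF sM subgroup.m_inv_closed[OF sM y(1)]] by blast
    then show ?thesis using yc vc by (simp add: inv_cancel)
  qed
  then have "M = P" using MsubP by blast
  then show False using M(1) unfolding maximal_subgroup_def by simp
qed

text \<open>The Sylow subgroups of \<open>K\<close> for the primes other than \<open>p\<close>
  lie in all stabilizers, so the lengths of the orbits are powers of \<open>p\<close>.\<close>

lemma nontrivial_fixed_point:
  assumes "finite (carrier G)" "subgroup K G" "prime p" "X \<lhd> G" "p dvd card X"
    and cent: "\<And>q b m x. prime q \<Longrightarrow> q \<noteq> p \<Longrightarrow> b \<in> K \<Longrightarrow> b [^] (q ^ m :: nat) = \<one> \<Longrightarrow> x \<in> X \<Longrightarrow>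
      b \<otimes> x = x \<otimes> b"
  obtains x where "x \<in> X" "x \<noteq> \<one>" "\<And>g. g \<in> K \<Longrightarrow> g \<otimes> x = x \<otimes> g"
proof -
  interpret K: group "G\<lparr>carrier := K\<rparr>" using assms(2) by (rule subgroup_imp_group)
  have Kc: "u \<in> carrier G" if "u \<in> K" for u using that subgroup.subset[OF assms(2)] by blast
  have sX: "subgroup X G" using assms(4) by (rule normal_imp_subgroup)
  have Xc: "u \<in> carrier G" if "u \<in> X" for u using that subgroup.subset[OF sX] by blast
  have fX: "finite X" and fK: "finite K"
    using assms(1) subgroup.subset[OF sX] subgroup.subset[OF assms(2)] finite_subset by blast+
  let ?f = "\<lambda>g x. g \<otimes> x \<otimes> inv g"
  let ?F = "{x \<in> X. \<forall>g\<in>carrier (G\<lparr>carrier := K\<rparr>). ?f g x = x}"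
  have act: "?f g x \<in> X" if "g \<in> carrier (G\<lparr>carrier := K\<rparr>)" "x \<in> X" for g x
    using normal_conj[OF assms(4)] Kc that by simp
  have act1: "?f \<one>\<^bsub>G\<lparr>carrier := K\<rparr>\<^esub> x = x" if "x \<in> X" for x using Xc[OF that] by simp
  have act2: "?f (g \<otimes>\<^bsub>G\<lparr>carrier := K\<rparr>\<^esub> h) x = ?f g (?f h x)"
    if "g \<in> carrier (G\<lparr>carrier := K\<rparr>)" "h \<in> carrier (G\<lparr>carrier := K\<rparr>)" "x \<in> X" for g h x
    using that Kc Xc by (simp add: word_simps)
  have "[card X = card ?F] (mod p)"
    using act act1 act2 fX
  proof (rule K.card_fixed_points_cong)
    fix x assume x: "x \<in> X" and nf: "\<exists>g\<in>carrier (G\<lparr>carrier := K\<rparr>). ?f g x \<noteq> x"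
    let ?O = "(\<lambda>g. ?f g x) ` carrier (G\<lparr>carrier := K\<rparr>)"
    let ?S = "{g \<in> carrier (G\<lparr>carrier := K\<rparr>). ?f g x = x}"
    have os: "card ?O * card ?S = order (G\<lparr>carrier := K\<rparr>)"
      using act act1 act2 x by (rule K.orbit_stabilizer_card(1))
    have sS: "subgroup ?S (G\<lparr>carrier := K\<rparr>)"
      using act act1 act2 x by (rule K.orbit_stabilizer_card(2))
    have nz: "order (G\<lparr>carrier := K\<rparr>) > 0" using fK K.order_gt_0_iff_finite by simp
    have "card ?O \<noteq> 1"
    proof
      assume "card ?O = 1"
      then obtain y where y: "?O = {y}" by (auto simp: card_1_singleton_iff)
      have "?f \<one> x \<in> ?O" using subgroup.one_closed[OF assms(2)] by (intro image_eqI[of _ _ \<one>]) simp_all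
      then have "y = x" using y act1[OF x] by simp
      then show False using y nf by blast
    qed
    show "p dvd card ?O"
    proof (rule ccontr)
      assume np: "\<not> p dvd card ?O"
      obtain q where q: "prime q" "q dvd card ?O" using \<open>card ?O \<noteq> 1\<close> prime_factor_nat by blast
      have "q \<noteq> p" using q(2) np by blast
      obtain Q where Q: "sylow_subgroup q (G\<lparr>carrier := K\<rparr>) Q"
        using K.Sylow_subgroup_exists[of q] q(1) fK by auto
      then have sQ: "subgroup Q (G\<lparr>carrier := K\<rparr>)" and cQ: "card Q = q ^ multiplicity q (order (G\<lparr>carrier := K\<rparr>))"
        unfolding sylow_subgroup_def by auto
      have QK: "Q \<subseteq> K" using subgroup.subset[OF sQ] by simp
      have "Q \<subseteq> ?S"
      proof
        fix b assume b: "b \<in> Q"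
        then have bK: "b \<in> K" using QK by blast
        have "b [^] card Q = \<one>"
          using subgroup_pow_card[OF incl_subgroup[OF assms(2) sQ] b] .
        then have "b \<otimes> x = x \<otimes> b" using cent[OF q(1) \<open>q \<noteq> p\<close> bK _ x] cQ by metis
        then have "?f b x = x" using Kc[OF bK] Xc[OF x] by (simp add: m_assoc)
        then show "b \<in> ?S" using bK by simp
      qed
      then have "card Q dvd card ?S" using K.subgroup_card_dvd_subgroup[OF sQ sS] by blast
      with q(2) have "q * card Q dvd card ?O * card ?S" by (rule mult_dvd_mono)
      then have "q * card Q dvd order (G\<lparr>carrier := K\<rparr>)" unfolding os .
      then have "q ^ Suc (multiplicity q (order (G\<lparr>carrier := K\<rparr>))) dvd order (G\<lparr>carrier := K\<rparr>)"
        using cQ by simp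
      then show False
        using multiplicity_geI[of "order (G\<lparr>carrier := K\<rparr>)" q "Suc (multiplicity q (order (G\<lparr>carrier := K\<rparr>)))"]
          nz prime_gt_1_nat[OF q(1)] by simp
    qed
  qed
  from cong_dvd_iff[OF this] have pF: "p dvd card ?F" using assms(5) by blast
  have "?F \<noteq> {\<one>}"
  proof
    assume "?F = {\<one>}"
    then have "card ?F = 1" by simp
    then show False using pF assms(3) by (simp add: not_prime_unit)
  qed
  moreover have "\<one> \<in> ?F" using subgroup.one_closed[OF sX] Kc by simp
  ultimately obtain x where "x \<in> ?F" "x \<noteq> \<one>" by blast
  then have x: "x \<in> X" "\<And>g. g \<in> K \<Longrightarrow> g \<otimes> x \<otimes> inv g = x" by auto
  have "g \<otimes> x = x \<otimes> g" if g: "g \<in> K" for g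
    using x(2)[OF g] Kc[OF g] Xc[OF x(1)] inv_solve_right'[of x "g \<otimes> x" g] by auto
  with x(1) \<open>x \<noteq> \<one>\<close> that show thesis by blast
qed

section \<open>Supersolubility and residuals\<close>

text \<open>For the largest prime divisor \<open>p\<close> of the order of \<open>A\<close>, a
  minimal normal subgroup \<open>X\<close> of \<open>G\<close> inside the Sylow
  \<open>p\<close>-subgroup \<open>P\<close> of \<open>A\<close> has order \<open>p\<close>: it
  will turn out that all elements of \<open>A\<close> and of \<open>B\<close> induce power maps
  on \<open>X\<close>, so that \<open>G\<close> normalizes each cyclic subgroup of
  \<open>X\<close>.\<close>

lemma normal_prime_of_product:
  assumes fin: "finite (carrier G)" and wnp: "weak_normal_product G A B"
    and ssA: "supersoluble (G\<lparr>carrier := A\<rparr>)" and ssB: "supersoluble (G\<lparr>carrier := B\<rparr>)"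
    and nil: "lower_central G (commutator_subgroup G A B) c = {\<one>}" and "A \<noteq> {\<one>}"
  obtains X where "X \<lhd> G" "prime (card X)"
proof -
  have sA: "subgroup A G" and sB: "subgroup B G" and AB: "carrier G = A <#> B" and nA: "A \<lhd> G"
    and perm: "\<And>p P M. sylow_subgroup p (G\<lparr>carrier := A\<rparr>) P \<Longrightarrow>
      maximal_subgroup (G\<lparr>carrier := P\<rparr>) M \<Longrightarrow> permuting G B M"
    using wnp unfolding weak_normal_product_def by blast+
  have Ac: "A \<subseteq> carrier G" and Bc: "B \<subseteq> carrier G"
    using subgroup.subset[OF sA] subgroup.subset[OF sB] .
  have split: "\<exists>a\<in>A. \<exists>b\<in>B. g = a \<otimes> b" if "g \<in> carrier G" for g
    using that AB by (auto simp: set_mult_def)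
  interpret A: group "G\<lparr>carrier := A\<rparr>" using sA by (rule subgroup_imp_group)
  have fA: "finite (carrier (G\<lparr>carrier := A\<rparr>))" using fin Ac finite_subset by simp blast
  obtain p P where Psyl: "sylow_subgroup p (G\<lparr>carrier := A\<rparr>) P" and nP: "P \<lhd> G" and "P \<noteq> {\<one>}"
    using largest_prime_Sylow_normal[OF fin nA ssA \<open>A \<noteq> {\<one>}\<close>] by blast
  have p: "prime p" and PA: "P \<subseteq> A"
    using Psyl subgroup.subset[of P "G\<lparr>carrier := A\<rparr>"] unfolding sylow_subgroup_def by auto
  obtain k where cP: "card P = p ^ k" using Psyl unfolding sylow_subgroup_def by blast
  have permP: "permuting G B M" if "maximal_subgroup (G\<lparr>carrier := P\<rparr>) M" for M
    using perm[OF Psyl that] .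
  obtain X where nX: "X \<lhd> G" and XP: "X \<subseteq> P" and "X \<noteq> {\<one>}"
    and min: "\<And>Y. Y \<lhd> G \<Longrightarrow> Y \<subseteq> X \<Longrightarrow> Y = {\<one>} \<or> Y = X"
    using minimal_normal_below[OF fin nP \<open>P \<noteq> {\<one>}\<close>] by blast
  have sX: "subgroup X G" using nX by (rule normal_imp_subgroup)
  have Xc: "x \<in> carrier G" if "x \<in> X" for x using subgroup.mem_carrier[OF sX that] .
  have XA: "X \<subseteq> A" using XP PA by blast
  define C where "C = {c \<in> carrier G. \<forall>x\<in>X. c \<otimes> x = x \<otimes> c}"
  have nC: "C \<lhd> G" unfolding C_def using nX by (rule centralizer_normal)
  have sC: "subgroup C G" using nC by (rule normal_imp_subgroup)
  have nilC: "N \<subseteq> C" if N: "N \<lhd> G" "lower_central G N n = {\<one>}" for N n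
  proof
    fix y assume y: "y \<in> N"
    have "x \<otimes> y = y \<otimes> x" if x: "x \<in> X" for x
      using nX N min x y by (rule nilpotent_centralizes_minimal_normal)
    then show "y \<in> C" unfolding C_def using normal_in_carrier[OF N(1) y] by simp
  qed
  have WC: "commutator_subgroup G A B \<subseteq> C"
    using nilC commutator_subgroup_normal_product[OF nA sB AB] nil by blast
  have DC: "derived G A \<subseteq> C"
  proof -
    have nD: "derived G A \<lhd> G" using nA by (rule derived_is_normal)
    have DA: "derived G A \<subseteq> A" using derived_incl[OF order_refl sA] .
    obtain n where "lower_central (G\<lparr>carrier := A\<rparr>) (derived (G\<lparr>carrier := A\<rparr>) A) n = {\<one>}"
      using A.derived_supersoluble_nilpotent[OF ssA] by auto
    then have "lower_central G (derived G A) n = {\<one>}"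
      using lower_central_consistent[OF sA normal_imp_subgroup[OF nD] DA]
        derived_consistent[OF order_refl sA] by simp
    then show ?thesis using nilC nD by blast
  qed
  have derived_mem: "a \<otimes> b \<otimes> inv a \<otimes> inv b \<in> derived G S" if "a \<in> S" "b \<in> S" for a b S
    unfolding derived_def using that by (intro generate.incl) blast
  have comm: "x \<otimes> y = y \<otimes> x" if xy: "x \<in> X" "y \<in> X" for x y
  proof (cases "derived G X = X")
    case True
    then have "X \<subseteq> C" using mono_derived[OF XA] DC by blast
    then show ?thesis using xy unfolding C_def by blast
  next
    case False
    then have "derived G X = {\<one>}"
      using min derived_is_normal[OF nX] derived_incl[OF order_refl sX] by blast
    then have "x \<otimes> y \<otimes> inv x \<otimes> inv y = \<one>" using derived_mem[OF xy] by blast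
    then have "x \<otimes> y \<otimes> inv x = y"
      using inv_solve_right'[of \<one> "x \<otimes> y \<otimes> inv x" y] Xc xy by simp
    then show ?thesis using inv_solve_right'[of y "x \<otimes> y" x] Xc xy by simp
  qed
  have "card X dvd p ^ k"
    using subgroup_card_dvd_subgroup[OF sX normal_imp_subgroup[OF nP] XP] cP by simp
  then obtain j where j: "card X = p ^ j" using p by (auto simp: divides_primepow_nat)
  have "card X \<noteq> 1" using \<open>X \<noteq> {\<one>}\<close> subgroup.one_closed[OF sX] by (metis card_1_singletonE singletonD)
  then have pX: "p dvd card X" using j by (cases j) auto
  have exp: "x [^] p = \<one>" if "x \<in> X" for x
  proof -
    let ?E = "{x \<in> X. x [^] p = \<one>}"
    have "?E \<lhd> G"
    proof (rule normal_invI)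
      show "subgroup ?E G"
      proof (rule subgroupI)
        show "?E \<subseteq> carrier G" using Xc by blast
        show "?E \<noteq> {}" using subgroup.one_closed[OF sX] by auto
        fix a assume a: "a \<in> ?E"
        then show "inv a \<in> ?E" using Xc subgroup.m_inv_closed[OF sX] by (simp add: nat_pow_inv)
        fix b assume b: "b \<in> ?E"
        show "a \<otimes> b \<in> ?E"
          using a b Xc subgroup.m_closed[OF sX] pow_mult_distrib[of a b p] comm[of a b] by simp
      qed
      fix g x assume "g \<in> carrier G" "x \<in> ?E"
      then show "g \<otimes> x \<otimes> inv g \<in> ?E"
        using normal_conj[OF nX] conj_nat_pow[of g x p] Xc by simp
    qed
    moreover have "?E \<noteq> {\<one>}"
    proof -
      interpret X: group "G\<lparr>carrier := X\<rparr>" using sX by (rule subgroup_imp_group)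
      have "finite X" using fin subgroup.subset[OF sX] finite_subset by blast
      then obtain x where "x \<in> X" "x \<noteq> \<one>" "x [^] p = \<one>"
        using X.Cauchy[OF _ p] pX by (auto simp: order_def simp flip: nat_pow_consistent)
      then show ?thesis by blast
    qed
    ultimately have "?E = X" using min[of ?E] by blast
    then show ?thesis using that by blast
  qed
  have power_map: "z \<otimes> x \<otimes> inv z = x [^] m"
    if "z \<in> carrier G" "\<And>g. g \<in> carrier G \<Longrightarrow> z \<otimes> g \<otimes> inv z \<otimes> inv g \<in> C"
      "y \<in> X" "y \<noteq> \<one>" "z \<otimes> y \<otimes> inv z = y [^] m" "x \<in> X" for z x y and m :: int
    using nX min comm that(1) that(2)[unfolded C_def] that(3-6)
    by (rule power_map_on_minimal_normal)
  \<comment> \<open>A normal subgroup of prime order of \<open>A\<close> inside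
    \<open>X\<close> provides a common eigenvector of the elements of
    \<open>A\<close>.\<close>
  have powA: "\<exists>m::int. \<forall>x\<in>X. a \<otimes> x \<otimes> inv a = x [^] m" if a: "a \<in> A" for a
  proof -
    have ac: "a \<in> carrier G" using a Ac by blast
    have "X \<lhd> G\<lparr>carrier := A\<rparr>" using normal_in_subgroup[OF nX sA XA] .
    then obtain Y where Y: "Y \<lhd> G\<lparr>carrier := A\<rparr>" "Y \<subseteq> X" "prime (card Y)"
      using A.supersoluble_normal_prime[OF fA ssA] \<open>X \<noteq> {\<one>}\<close> by auto
    have "Y \<noteq> {\<one>}" using Y(3) by auto
    moreover have "\<one> \<in> Y" using subgroup.one_closed[OF normal_imp_subgroup[OF Y(1)]] by simp
    ultimately obtain y where y: "y \<in> Y" "y \<noteq> \<one>" by blast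
    obtain m :: nat where "a \<otimes> y \<otimes> inv\<^bsub>G\<lparr>carrier := A\<rparr>\<^esub> a = y [^]\<^bsub>G\<lparr>carrier := A\<rparr>\<^esub> m"
      using A.prime_order_normal_conj[OF Y(1,3) refl y(1), of a] y(2) a by auto
    then have "a \<otimes> y \<otimes> inv a = y [^] int m"
      using a sA by (simp add: int_pow_int flip: nat_pow_consistent)
    moreover have "a \<otimes> g \<otimes> inv a \<otimes> inv g \<in> C" if "g \<in> carrier G" for g
      using derived_mem[OF a] commutator_mem[OF a] DC WC
      by (intro commutator_in_normal_product[OF nC AB Ac Bc ac _ _ that]) blast+
    ultimately show ?thesis using power_map[of a y "int m"] ac y Y(2) by blast
  qed
  \<comment> \<open>\<open>B\<close> need not normalize a subgroup of prime order of
    \<open>X\<close> from the start, because \<open>X\<close> may have trivial intersection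
    with \<open>B\<close>. The fixed points of \<open>K\<close> form a normal subgroup
    \<open>E\<close> of \<open>G\<close>, so that \<open>K\<close> centralizes
    \<open>X\<close>, and \<open>B\<close> acts on \<open>X\<close> as an abelian group of
    exponent dividing \<open>p - 1\<close>.\<close>
  define K where "K = section_kernel G p B"
  have sK: "subgroup K G" unfolding K_def using sB by (rule section_kernel_subgroup)
  have KB: "K \<subseteq> B" unfolding K_def section_kernel_def by blast
  have Kc: "g \<in> carrier G" if "g \<in> K" for g using subgroup.mem_carrier[OF sK that] .
  note Kmem = section_kernel_members[OF fin sB p, folded K_def]
  have "\<exists>x\<in>X. x \<noteq> \<one> \<and> (\<forall>g\<in>K. g \<otimes> x = x \<otimes> g)"
  proof (rule nontrivial_fixed_point[OF fin sK p nX pX])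
    fix q b m x assume "prime q" "q \<noteq> p" "b \<in> K" "b [^] (q ^ m) = \<one>" "x \<in> X"
    then show "b \<otimes> x = x \<otimes> b"
      using section_kernel_centralizes[OF fin sB ssB nP p cP permP] XP unfolding K_def by blast
  next
    fix x assume "x \<in> X" "x \<noteq> \<one>" "\<And>g. g \<in> K \<Longrightarrow> g \<otimes> x = x \<otimes> g"
    then show "\<exists>x\<in>X. x \<noteq> \<one> \<and> (\<forall>g\<in>K. g \<otimes> x = x \<otimes> g)" by blast
  qed
  then obtain x0 where x0: "x0 \<in> X" "x0 \<noteq> \<one>" "\<And>g. g \<in> K \<Longrightarrow> g \<otimes> x0 = x0 \<otimes> g" by blast
  define E where "E = X \<inter> {x \<in> carrier G. \<forall>g\<in>K. x \<otimes> g = g \<otimes> x}"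
  have sE: "subgroup E G"
    unfolding E_def using centralizer_subgroup[of K] Kc by (intro subgroups_Inter_pair sX) blast
  have EB: "b \<otimes> x \<otimes> inv b \<in> E" if b: "b \<in> B" and x: "x \<in> E" for b x
  proof -
    have xX: "x \<in> X" and xc: "x \<in> carrier G" and bc: "b \<in> carrier G"
      using x b Xc Bc unfolding E_def by auto
    have "(b \<otimes> x \<otimes> inv b) \<otimes> g = g \<otimes> (b \<otimes> x \<otimes> inv b)" if g: "g \<in> K" for g
    proof -
      have "inv b \<otimes> g \<otimes> inv (inv b) \<otimes> inv g \<in> K"
        using Kmem(1)[of "inv b" g] b g KB subgroup.m_inv_closed[OF sB] by blast
      then have "inv b \<otimes> g \<otimes> inv (inv b) \<otimes> inv g \<otimes> g \<in> K" using g by (rule subgroup.m_closed[OF sK])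
      then have "inv b \<otimes> g \<otimes> b \<in> K" using bc Kc[OF g] by (simp add: word_simps)
      then have "x \<otimes> (inv b \<otimes> g \<otimes> b) = (inv b \<otimes> g \<otimes> b) \<otimes> x" using x unfolding E_def by blast
      then have "b \<otimes> (x \<otimes> (inv b \<otimes> g \<otimes> b)) \<otimes> inv b = b \<otimes> ((inv b \<otimes> g \<otimes> b) \<otimes> x) \<otimes> inv b" by simp
      then show ?thesis using bc xc Kc[OF g] by (simp add: word_simps)
    qed
    then show ?thesis using normal_conj[OF nX bc xX] Xc unfolding E_def by blast
  qed
  have EA: "a \<otimes> x \<otimes> inv a \<in> E" if a: "a \<in> A" and x: "x \<in> E" for a x
  proof -
    obtain m :: int where "a \<otimes> x \<otimes> inv a = x [^] m" using powA[OF a] x unfolding E_def by blast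
    then show ?thesis using subgroup_int_pow_closed[OF sE x] by simp
  qed
  have "E \<lhd> G"
  proof (rule normal_invI[OF sE])
    fix g x assume g: "g \<in> carrier G" and x: "x \<in> E"
    obtain a b where ab: "a \<in> A" "b \<in> B" "g = a \<otimes> b" using split[OF g] by blast
    have "g \<otimes> x \<otimes> inv g = a \<otimes> (b \<otimes> x \<otimes> inv b) \<otimes> inv a"
      using ab Ac Bc subgroup.mem_carrier[OF sE x] by (auto simp: word_simps subset_iff)
    then show "g \<otimes> x \<otimes> inv g \<in> E" using EA[OF ab(1) EB[OF ab(2) x]] by simp
  qed
  moreover have "x0 \<in> E" unfolding E_def using x0 Xc by simp
  ultimately have "E = X" using min[of E] x0(2) unfolding E_def by blast
  have KC: "K \<subseteq> C"
  proof
    fix g assume g: "g \<in> K"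
    have "g \<otimes> x = x \<otimes> g" if "x \<in> X" for x
    proof -
      have "x \<in> E" using that \<open>E = X\<close> by simp
      then show ?thesis using g unfolding E_def by simp
    qed
    then show "g \<in> C" unfolding C_def using Kc[OF g] by simp
  qed
  have powB: "\<exists>m::int. \<forall>x\<in>X. b \<otimes> x \<otimes> inv b = x [^] m" if b: "b \<in> B" for b
  proof -
    have bc: "b \<in> carrier G" using b Bc by blast
    have com: "b \<otimes> g \<otimes> inv b \<otimes> inv g \<in> C" if "g \<in> carrier G" for g
    proof (rule commutator_in_normal_product[OF nC AB Ac Bc bc _ _ that])
      fix a assume a: "a \<in> A"
      have "inv (a \<otimes> b \<otimes> inv a \<otimes> inv b) \<in> C"
        using commutator_mem[OF a b] WC subgroup.m_inv_closed[OF sC] by blast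
      then show "b \<otimes> a \<otimes> inv b \<otimes> inv a \<in> C" using a Ac bc by (auto simp: word_simps subset_iff)
    next
      fix b' assume "b' \<in> B"
      then show "b \<otimes> b' \<otimes> inv b \<otimes> inv b' \<in> C" using Kmem(1)[OF b] KC by blast
    qed
    interpret X: group "G\<lparr>carrier := X\<rparr>" using sX by (rule subgroup_imp_group)
    interpret X: comm_group "G\<lparr>carrier := X\<rparr>" using comm by (intro X.group_comm_groupI) simp
    let ?f = "\<lambda>x. b \<otimes> x \<otimes> inv b"
    have f: "?f \<in> hom (G\<lparr>carrier := X\<rparr>) (G\<lparr>carrier := X\<rparr>)"
      using normal_conj[OF nX bc] bc Xc by (auto intro!: homI simp: word_simps)
    have iter: "(?f ^^ n) x0 = b [^] n \<otimes> x0 \<otimes> inv (b [^] n)" for n :: nat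
    proof (induction n)
      case (Suc n)
      have "(?f ^^ Suc n) x0 = b \<otimes> (b [^] n \<otimes> x0 \<otimes> inv (b [^] n)) \<otimes> inv b" using Suc by simp
      also have "\<dots> = b [^] Suc n \<otimes> x0 \<otimes> inv (b [^] Suc n)"
        unfolding nat_pow_Suc2[OF bc] using bc Xc[OF x0(1)] by (simp add: word_simps del: nat_pow_Suc)
      finally show ?case .
    qed (use Xc[OF x0(1)] in simp)
    have "b [^] (p - 1) \<otimes> x0 = x0 \<otimes> b [^] (p - 1)" using Kmem(2)[OF b b] x0(3) by blast
    then have fx: "(?f ^^ (p - 1)) x0 = x0" unfolding iter using bc Xc[OF x0(1)] by (simp add: m_assoc)
    have expX: "w [^]\<^bsub>G\<lparr>carrier := X\<rparr>\<^esub> p = \<one>\<^bsub>G\<lparr>carrier := X\<rparr>\<^esub>" if "w \<in> carrier (G\<lparr>carrier := X\<rparr>)" for w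
      using exp that by (simp flip: nat_pow_consistent)
    have x0X: "x0 \<in> carrier (G\<lparr>carrier := X\<rparr>)" "x0 \<noteq> \<one>\<^bsub>G\<lparr>carrier := X\<rparr>\<^esub>" using x0(1,2) by simp_all
    obtain l :: nat and w where "w \<in> carrier (G\<lparr>carrier := X\<rparr>)" "w \<noteq> \<one>\<^bsub>G\<lparr>carrier := X\<rparr>\<^esub>"
        "?f w = w [^]\<^bsub>G\<lparr>carrier := X\<rparr>\<^esub> l"
      using X.endomorphism_eigenvector[OF p expX f x0X fx] by blast
    then have w: "w \<in> X" "w \<noteq> \<one>" "b \<otimes> w \<otimes> inv b = w [^] int l"
      by (simp_all add: int_pow_int flip: nat_pow_consistent)
    then show ?thesis using power_map[of b w "int l"] bc com by blast
  qed
  have x0c: "x0 \<in> carrier G" using Xc x0(1) .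
  have "generate G {x0} \<lhd> G"
  proof (rule generate_singleton_normal[OF x0c])
    fix g assume g: "g \<in> carrier G"
    obtain a b where ab: "a \<in> A" "b \<in> B" "g = a \<otimes> b" using split[OF g] by blast
    have abc: "a \<in> carrier G" "b \<in> carrier G" using ab Ac Bc by auto
    obtain m :: int where m: "b \<otimes> x0 \<otimes> inv b = x0 [^] m" using powB[OF ab(2)] x0(1) by blast
    obtain l :: int where l: "a \<otimes> x0 \<otimes> inv a = x0 [^] l" using powA[OF ab(1)] x0(1) by blast
    have "g \<otimes> x0 \<otimes> inv g = a \<otimes> (b \<otimes> x0 \<otimes> inv b) \<otimes> inv a" unfolding ab(3) using abc x0c by (simp add: word_simps)
    also have "\<dots> = (x0 [^] l) [^] m" unfolding m using conj_int_pow[OF abc(1) x0c, of m] l by simp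
    also have "\<dots> = x0 [^] (l * m)" using x0c by (simp add: int_pow_pow)
    finally show "\<exists>m::int. g \<otimes> x0 \<otimes> inv g = x0 [^] m" ..
  qed
  moreover have "card (generate G {x0}) = p" using card_generate_prime[OF x0c x0(2) p exp[OF x0(1)]] .
  ultimately show thesis using that p by blast
qed

end

lemma (in group_hom) weak_normal_product_image_properties:
  assumes "finite (carrier G)" "h ` carrier G = carrier H" "weak_normal_product G A B"
    and "supersoluble (G\<lparr>carrier := A\<rparr>)" "supersoluble (G\<lparr>carrier := B\<rparr>)"
  shows "weak_normal_product H (h ` A) (h ` B)"
    and "supersoluble (H\<lparr>carrier := h ` A\<rparr>)" "supersoluble (H\<lparr>carrier := h ` B\<rparr>)"
    and "lower_central H (commutator_subgroup H (h ` A) (h ` B)) c =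
      h ` lower_central G (commutator_subgroup G A B) c"
proof -
  have sA: "subgroup A G" and sB: "subgroup B G"
    using assms(3) unfolding weak_normal_product_def by blast+
  show "weak_normal_product H (h ` A) (h ` B)" using assms(1-3) by (rule weak_normal_product_image)
  show "supersoluble (H\<lparr>carrier := h ` A\<rparr>)"
    using group_hom.supersoluble_image[OF restrict_subgroups[OF sA] assms(4)] by simp
  show "supersoluble (H\<lparr>carrier := h ` B\<rparr>)"
    using group_hom.supersoluble_image[OF restrict_subgroups[OF sB] assms(5)] by simp
  show "lower_central H (commutator_subgroup H (h ` A) (h ` B)) c =
      h ` lower_central G (commutator_subgroup G A B) c"
    using lower_central_image[OF G.commutator_subgroup_subgroup] commutator_subgroup_image
      subgroup.subset[OF sA] subgroup.subset[OF sB] by simp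
qed

context group
begin

text \<open>The hypotheses are inherited by all quotients, and a quotient in which the image of
  \<open>A\<close> is trivial is an image of \<open>B\<close>.\<close>

lemma supersoluble_weak_normal_product:
  assumes fin: "finite (carrier G)" and wnp: "weak_normal_product G A B"
    and ssA: "supersoluble (G\<lparr>carrier := A\<rparr>)" and ssB: "supersoluble (G\<lparr>carrier := B\<rparr>)"
    and nil: "lower_central G (commutator_subgroup G A B) c = {\<one>}"
  shows "supersoluble G"
proof (rule supersolubleI[OF fin])
  fix Y assume Y: "Y \<lhd> G" "Y \<noteq> carrier G"
  interpret Y: normal Y G by fact
  define Q where "Q = G Mod Y"
  define h where "h = (\<lambda>x. Y #> x)"
  interpret h: group_hom G Q h unfolding Q_def h_def by (rule Y.quotient_hom)
  have hsurj: "h ` carrier G = carrier Q" unfolding Q_def h_def by (rule Y.quotient_surj)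
  have fQ: "finite (carrier Q)" unfolding Q_def using Y.finite_quotient fin .
  note im = h.weak_normal_product_image_properties[OF fin hsurj wnp ssA ssB]
  have "\<exists>X. X \<lhd> Q \<and> prime (card X)"
  proof (cases "h ` A = {\<one>\<^bsub>Q\<^esub>}")
    case False
    have "lower_central Q (commutator_subgroup Q (h ` A) (h ` B)) c = {\<one>\<^bsub>Q\<^esub>}"
      unfolding im(4) nil by simp
    then show ?thesis
      using h.H.normal_prime_of_product[OF fQ im(1-3) _ False] by blast
  next
    case True
    have sB: "subgroup (h ` B) Q" and Q: "carrier Q = h ` A <#>\<^bsub>Q\<^esub> h ` B"
      using im(1) unfolding weak_normal_product_def by blast+
    have "carrier Q = h ` B"
      unfolding Q True set_mult_def using subgroup.mem_carrier[OF sB] by auto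
    then have "supersoluble (Q\<lparr>carrier := carrier Q\<rparr>)" using im(3) by (simp only:)
    then have "supersoluble Q" by simp
    moreover have "carrier Q \<noteq> {\<one>\<^bsub>Q\<^esub>}"
    proof
      assume "carrier Q = {\<one>\<^bsub>Q\<^esub>}"
      then have "h x = \<one>\<^bsub>Q\<^esub>" if "x \<in> carrier G" for x using that h.hom_closed by blast
      then have "carrier G \<subseteq> Y" using Y.rcos_eq_self_iff unfolding h_def Q_def by auto
      then show False using Y(2) Y.subset by blast
    qed
    ultimately show ?thesis
      using h.H.supersoluble_normal_prime[OF fQ _ h.H.normal_self] by blast
  qed
  then show "\<exists>X. X \<lhd> (G Mod Y) \<and> prime (card X)" unfolding Q_def .
qed

lemma supersoluble_quotient_derived:
  assumes "N \<lhd> G" "supersoluble (G Mod N)"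
  shows "\<exists>n. lower_central G (derived G (carrier G)) n \<subseteq> N"
proof -
  interpret N: normal N G by fact
  define Q where "Q = G Mod N"
  define h where "h = (\<lambda>x. N #> x)"
  interpret h: group_hom G Q h unfolding Q_def h_def by (rule N.quotient_hom)
  have hsurj: "h ` carrier G = carrier Q" unfolding Q_def h_def by (rule N.quotient_surj)
  have nD: "derived G (carrier G) \<lhd> G" by (rule derived_self_is_normal)
  obtain n where "lower_central Q (derived Q (carrier Q)) n = {\<one>\<^bsub>Q\<^esub>}"
    using h.H.derived_supersoluble_nilpotent assms(2) unfolding Q_def by blast
  then have *: "h ` lower_central G (derived G (carrier G)) n = {\<one>\<^bsub>Q\<^esub>}"
    using h.lower_central_image[OF normal_imp_subgroup[OF nD], of n]
      h.derived_img[OF order_refl] hsurj by simp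
  have "x \<in> N" if x: "x \<in> lower_central G (derived G (carrier G)) n" for x
  proof -
    have "x \<in> carrier G" using normal_in_carrier[OF lower_central_normal[OF nD] x] .
    moreover have "h x = \<one>\<^bsub>Q\<^esub>" using * x by blast
    ultimately show ?thesis using N.rcos_eq_self_iff unfolding h_def Q_def by simp
  qed
  then show ?thesis by blast
qed

end

theorem corollaryD:
  fixes G :: "('a, 'b) monoid_scheme" and A B :: "'a set"
  assumes "group G" and "finite (carrier G)"
    and "weak_normal_product G A B"
    and "supersoluble (G\<lparr>carrier := A\<rparr>)" and "supersoluble (G\<lparr>carrier := B\<rparr>)"
  shows "residual supersoluble G =
           residual nilpotent (G\<lparr>carrier := derived G (carrier G)\<rparr>) \<and>
         residual nilpotent (G\<lparr>carrier := derived G (carrier G)\<rparr>) =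
           residual nilpotent (G\<lparr>carrier := commutator_subgroup G A B\<rparr>)"
proof -
  interpret group G by fact
  have sA: "subgroup A G" and sB: "subgroup B G" and AB: "carrier G = A <#>\<^bsub>G\<^esub> B" and nA: "A \<lhd> G"
    using assms(3) unfolding weak_normal_product_def by blast+
  have Ac: "A \<subseteq> carrier G" and Bc: "B \<subseteq> carrier G"
    using subgroup.subset[OF sA] subgroup.subset[OF sB] .
  define C where "C = commutator_subgroup G A B"
  define D where "D = derived G (carrier G)"
  have nC: "C \<lhd> G" unfolding C_def using nA sB AB by (rule commutator_subgroup_normal_product)
  have sD: "subgroup D G" unfolding D_def using derived_self_is_normal by (rule normal_imp_subgroup)
  have "C \<subseteq> D"
    unfolding C_def
  proof (rule commutator_subgroup_subset[OF sD])
    fix x y assume "x \<in> A" "y \<in> B"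
    then have "x \<in> carrier G" "y \<in> carrier G" using Ac Bc by auto
    then show "x \<otimes>\<^bsub>G\<^esub> y \<otimes>\<^bsub>G\<^esub> inv\<^bsub>G\<^esub> x \<otimes>\<^bsub>G\<^esub> inv\<^bsub>G\<^esub> y \<in> D"
      unfolding D_def derived_def by (intro generate.incl) blast
  qed
  define RC where "RC = (\<Inter>n. lower_central G C n)"
  define RD where "RD = (\<Inter>n. lower_central G D n)"
  have res: "residual nilpotent (G\<lparr>carrier := C\<rparr>) = RC" "residual nilpotent (G\<lparr>carrier := D\<rparr>) = RD"
    unfolding RC_def RD_def
    using nilpotent_residual_subgroup(1)[OF assms(2)] normal_imp_subgroup[OF nC] sD by blast+
  have "RC \<subseteq> RD" unfolding RC_def RD_def using lower_central_mono[OF \<open>C \<subseteq> D\<close>] by blast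
  obtain n where n: "RC = lower_central G C n"
    unfolding RC_def using nilpotent_residual_subgroup(2)[OF assms(2) normal_imp_subgroup[OF nC]] by blast
  have nRC: "RC \<lhd> G" unfolding n using nC by (rule lower_central_normal)
  have least: "RD \<subseteq> N" if N: "N \<lhd> G" "supersoluble (G Mod N)" for N
    using supersoluble_quotient_derived[OF N] unfolding RD_def D_def by blast
  have ss: "supersoluble (G Mod RC)"
  proof -
    interpret N: normal RC G by fact
    define Q where "Q = G Mod RC"
    define h where "h = (\<lambda>x. RC #>\<^bsub>G\<^esub> x)"
    interpret h: group_hom G Q h unfolding Q_def h_def by (rule N.quotient_hom)
    have hsurj: "h ` carrier G = carrier Q" unfolding Q_def h_def by (rule N.quotient_surj)
    have fQ: "finite (carrier Q)" unfolding Q_def using N.finite_quotient assms(2) .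
    note im = h.weak_normal_product_image_properties[OF assms(2) hsurj assms(3-5)]
    have "h x = \<one>\<^bsub>Q\<^esub>" if "x \<in> RC" for x
      using that N.rcos_const unfolding h_def Q_def by simp
    moreover have "\<one>\<^bsub>G\<^esub> \<in> RC" by (rule N.one_closed)
    ultimately have "h ` RC = {\<one>\<^bsub>Q\<^esub>}" by blast
    then have "lower_central Q (commutator_subgroup Q (h ` A) (h ` B)) n = {\<one>\<^bsub>Q\<^esub>}"
      unfolding im(4) C_def[symmetric] n[symmetric] .
    then show ?thesis
      using h.H.supersoluble_weak_normal_product[OF fQ im(1-3)] unfolding Q_def by blast
  qed
  have "RD = RC" using \<open>RC \<subseteq> RD\<close> least[OF nRC ss] by blast
  moreover have "residual supersoluble G = RC"
    unfolding residual_def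
    by (rule Least_equality) (use nRC ss least \<open>RD = RC\<close> in auto)
  ultimately show ?thesis using res unfolding C_def D_def by simp
qed

end
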